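(* Let $N$ be a non-negative integer and write $\theta=\arg\nu$. (a) For $|\theta|<\frac{3\pi}{2}$, $$|R_N(\nu)|\le\frac{1}{3\pi}|d_{2N}|\frac{\Gamma\left(\frac{2N+1}{3}\right)}{|\nu|^{\frac{2N+1}{3}}}\begin{cases}\left|\csc\left(\frac23\theta\right)\right| & \text{if } \frac{3\pi}{4}<|\theta|<\frac{3\pi}{2},\\ 1 & \text{if } |\theta|\le\frac{3\pi}{4}.\end{cases}$$ (b) If $\nu>0$, then $$R_N(\nu) = \frac{1}{3\pi}d_{2N}\frac{\Gamma\left(\frac{2N+1}{3}\right)}{\nu^{\frac{2N+1}{3}}}\Xi$$ for some number $0<\Xi<1$ depending on $\nu$ and $N$. (c) For $\frac{3\pi}{4}<|\theta|\le\frac{3\pi}{2}$, $$|R_N(\nu)|\le\sqrt{\frac{3e}{2}(N+2)}\;\frac{1}{3\pi}|d_{2N}|\frac{\Gamma\left(\frac{2N+1}{3}\right)}{|\nu|^{\frac{2N+1}{3}}}.$$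
   Context: The Anger--Weber function is $\mathbf{A}_{-\nu}(z) = \frac{1}{\pi}\int_0^{+\infty} e^{\nu t - z\sinh t}\,dt$ for $|\arg z|<\frac{\pi}{2}$; thus $\mathbf{A}_{-\nu}(\nu)=\frac1\pi\int_0^{+\infty}e^{-\nu(\sinh t-t)}dt$ for $|\arg\nu|<\frac\pi2$, and $\nu\mapsto\mathbf{A}_{-\nu}(\nu)$ is extended to other values of $\arg\nu$ by analytic continuation on the Riemann surface of the logarithm. The coefficients $d_{2n}$ and the remainder $R_N(\nu)$ are defined by $$d_{2n} = \frac{1}{(2n)!}\left[\frac{d^{2n}}{dt^{2n}}\left(\frac{t^3}{\sinh t - t}\right)^{\frac{2n+1}{3}}\right]_{t=0},\qquad \mathbf{A}_{-\nu}(\nu) = \frac{1}{3\pi}\sum_{n=0}^{N-1} d_{2n}\frac{\Gamma\left(\frac{2n+1}{3}\right)}{\nu^{\frac{2n+1}{3}}} + R_N(\nu)$$ (removable singularity at $t=0$ removed, fractional power positive for real $t$). Cube roots of $\nu$ are positive for $\nu>0$ and defined by analytic continuation elsewhere. Empty sums are zero. *)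

theory Defs
  imports "HOL-Complex_Analysis.Complex_Analysis" "HOL-Real_Asymp.Real_Asymp"
begin

text \<open>The integral representation of \<open>A\<^sub>\<mu>(z)\<close>; it converges for \<open>Re z > 0\<close>, i.e. for
  \<open>\<bar>arg z\<bar> < \<pi>/2\<close>.\<close>

definition anger_weber :: "complex \<Rightarrow> complex \<Rightarrow> complex" where
  "anger_weber \<mu> z =
     1 / of_real pi * (LINT t:{0..}|lborel. exp (- \<mu> * of_real t - z * sinh (of_real t)))"

text \<open>A point of the Riemann surface of the logarithm is represented by its logarithm \<open>w\<close>, so that
  \<open>\<nu> = exp w\<close>, \<open>\<bar>\<nu>\<bar> = exp (Re w)\<close> and \<open>arg \<nu> = Im w\<close> ranges over all reals. In this coordinate
  functions on the surface are functions on the whole complex plane, and the point with modulus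
  \<open>r\<close> and argument \<open>\<theta>\<close> is the following.\<close>

definition surface_point :: "real \<Rightarrow> real \<Rightarrow> complex" where
  "surface_point r \<theta> = Complex (ln r) \<theta>"

text \<open>The analytic continuation of \<open>\<nu> \<mapsto> A\<^bsub>-\<nu>\<^esub>(\<nu>)\<close> from \<open>\<bar>arg \<nu>\<bar> < \<pi>/2\<close> to the whole surface
  (unique by the identity theorem).\<close>

definition anger_weber_diag :: "complex \<Rightarrow> complex" where
  "anger_weber_diag = (THE F. F holomorphic_on UNIV \<and>
     (\<forall>w. \<bar>Im w\<bar> < pi / 2 \<longrightarrow> F w = anger_weber (- exp w) (exp w)))"

definition sinh_quotient :: "real \<Rightarrow> real" where
  "sinh_quotient t = (if t = 0 then 6 else t ^ 3 / (sinh t - t))"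

text \<open>The value 6 at the origin removes the singularity.\<close>

lemma sinh_quotient_tendsto: "(sinh_quotient \<longlongrightarrow> sinh_quotient 0) (at 0)"
proof -
  have "((\<lambda>t::real. t ^ 3 / (sinh t - t)) \<longlongrightarrow> 6) (at 0)"
    by real_asymp
  moreover have "eventually (\<lambda>t. t ^ 3 / (sinh t - t) = sinh_quotient t) (at 0)"
    by (auto simp: sinh_quotient_def eventually_at_filter)
  ultimately have "(sinh_quotient \<longlongrightarrow> 6) (at 0)"
    by (rule Lim_transform_eventually)
  then show ?thesis
    by (simp add: sinh_quotient_def)
qed

text \<open>\<open>aw_coeff n\<close> is the coefficient \<open>d\<^bsub>2n\<^esub>\<close>.\<close>

definition aw_coeff :: "nat \<Rightarrow> real" where
  "aw_coeff n = 1 / fact (2 * n) *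
     (deriv ^^ (2 * n)) (\<lambda>t. sinh_quotient t powr (real (2 * n + 1) / 3)) 0"

text \<open>The remainder \<open>R\<^sub>N\<close>; the power \<open>\<nu>\<^bsup>(2n+1)/3\<^esup>\<close> continued from \<open>\<nu> > 0\<close> is
  \<open>exp ((2n+1)/3 * w)\<close>.\<close>

definition aw_remainder :: "nat \<Rightarrow> complex \<Rightarrow> complex" where
  "aw_remainder N w = anger_weber_diag w -
     1 / (3 * of_real pi) *
       (\<Sum>n<N. of_real (aw_coeff n) * of_real (Gamma (real (2 * n + 1) / 3))
                 / exp (of_real (real (2 * n + 1) / 3) * w))"

end

theory Submission
  imports Defs
begin

text \<open>Put \<open>y\<^sup>3 = sinh t - t\<close>. For \<open>Re \<nu> > 0\<close> the substitution turns \<open>\<pi> A\<^bsub>-\<nu>\<^esub>(\<nu>)\<close> into the Laplace type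
  integral of \<open>exp (-\<nu> y\<^sup>3) f(y)\<close> over \<open>y > 0\<close> with \<open>f = dt/dy\<close>. In the \<open>t\<close>-plane the singularities
  of \<open>f\<close> come from the saddle points \<open>\<pm>2\<pi>i\<close>; on the explicit curve \<open>cos (Im t) = Re t / sinh (Re t)\<close>
  issuing from \<open>2\<pi>i\<close> the function \<open>y\<close> is purely imaginary, \<open>y = i\<eta>\<close>. Cauchy's theorem for the
  region below this curve, applied to \<open>2y / (y\<^sup>2 - y\<^sub>0\<^sup>2)\<close>, shows that \<open>f\<close> is the Stieltjes type function
  \<open>f(y) = 2/\<pi> \<integral> \<eta>(x) / (\<eta>(x)\<^sup>2 + y\<^sup>2) dx\<close> with a positive density. Expanding the geometric series gives
  the coefficients and, as \<open>\<nu> y\<^sup>3\<close> becomes the variable of integration, an exact remainder whose kernel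
  is \<open>1 / (1 + x exp (-2i\<theta>/3))\<close> with \<open>x > 0\<close>; this yields (a) and (b). For (c) the ray of
  integration is first rotated by an angle that depends on \<open>N\<close> only.\<close>

subsection \<open>Parameter integrals and elementary inequalities\<close>

text \<open>The kernel \<open>2y / (y^2 - y0^2)\<close> is the even combination of
  \<open>1 / (y - y0)\<close> and \<open>1 / (y + y0)\<close>: wherever y is purely imaginary it is
  i times a real number. So its real part vanishes on the imaginary axis, and along the curve the
  slope of the curve drops out of the imaginary part of the contour integral. This is why the
  density can be written in the parameter x, without inverting eta. Decay of order 1/y over a height
  below 2 pi removes the right end, and the half residue at t leaves pi times dt/dy.

  The obstacle is to know that \<open>y^2 = y0^2\<close> holds only at t.

  To be holomorphic at the origin as well, y is built as z times a cube root of a zero-free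
  function. Continuation to the surface of the logarithm uses an explicit entire function; all other
  representations are compared with it by the identity theorem on horizontal strips.\<close>

text \<open>Cauchy's estimate on discs of half the radius turns the majorant \<open>G\<close> into
  the majorant \<open>2 / r * G\<close> for all difference quotients at \<open>w0\<close>, so
  dominated convergence along sequences yields the derivative. No bound on the derivative of the
  integrand has to be supplied.\<close>

lemma holomorphic_on_parametric_integral:
  fixes f :: "complex \<Rightarrow> 'a \<Rightarrow> complex"
  assumes U: "open U"
    and hol: "\<And>x. x \<in> space M \<Longrightarrow> (\<lambda>w. f w x) holomorphic_on U"
    and meas: "\<And>w. w \<in> U \<Longrightarrow> f w \<in> borel_measurable M"
    and dom: "\<And>w0. w0 \<in> U \<Longrightarrow> \<exists>r>0. \<exists>G. cball w0 r \<subseteq> U \<and> integrable M G \<and>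
                (\<forall>w\<in>cball w0 r. \<forall>x\<in>space M. norm (f w x) \<le> G x)"
  shows "(\<lambda>w. \<integral>x. f w x \<partial>M) holomorphic_on U"
proof (rule holomorphic_onI)
  fix w0 assume w0: "w0 \<in> U"
  from dom[OF w0] obtain r G where r: "r > 0" "cball w0 r \<subseteq> U" and G: "integrable M G"
    and bd: "\<And>w x. w \<in> cball w0 r \<Longrightarrow> x \<in> space M \<Longrightarrow> norm (f w x) \<le> G x"
    by meson
  have int: "integrable M (f w)" if "w \<in> cball w0 r" for w
  proof (rule Bochner_Integration.integrable_bound[OF G])
    show "f w \<in> borel_measurable M" using that r by (intro meas) blast
    show "AE x in M. norm (f w x) \<le> norm (G x)"
      using bd[OF that] by (intro AE_I2) (metis abs_ge_self order.trans real_norm_def)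
  qed
  define d where "d = (\<lambda>x. deriv (\<lambda>w. f w x) w0)"
  let ?S = "ball w0 (r / 2)"
  have lip: "norm ((f w x - f w0 x) / (w - w0)) \<le> 2 / r * G x"
    if x: "x \<in> space M" and w: "w \<in> ?S - {w0}" for w x
  proof -
    have G0: "G x \<ge> 0"
      using order.trans[OF norm_ge_zero bd[of w0 x]] x r by simp
    have der: "norm (deriv (\<lambda>w. f w x) z) \<le> 2 / r * G x" if z: "z \<in> ?S" for z
    proof -
      have sub: "cball z (r / 2) \<subseteq> cball w0 r"
      proof
        fix y assume "y \<in> cball z (r / 2)"
        then show "y \<in> cball w0 r" using z dist_triangle[of w0 y z] by simp
      qed
      have "norm ((deriv ^^ 1) (\<lambda>w. f w x) z) \<le> fact 1 * G x / (r / 2) ^ 1"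
      proof (rule Cauchy_inequality)
        show "(\<lambda>w. f w x) holomorphic_on ball z (r / 2)"
          using sub r(2) ball_subset_cball by (intro holomorphic_on_subset[OF hol[OF x]]) blast
        show "continuous_on (cball z (r / 2)) (\<lambda>w. f w x)"
          using sub r(2) by (intro holomorphic_on_imp_continuous_on holomorphic_on_subset[OF hol[OF x]]) blast
        show "norm (f y x) \<le> G x" if "norm (z - y) = r / 2" for y
          using that sub x by (intro bd) (auto simp: dist_norm)
      qed (use r in auto)
      then show ?thesis by (simp add: field_simps)
    qed
    have "norm (f w x - f w0 x) \<le> 2 / r * G x * norm (w - w0)"
    proof (rule field_differentiable_bound[where S = ?S and f' = "deriv (\<lambda>w. f w x)"])
      fix z assume z: "z \<in> ?S"
      then have "z \<in> cball w0 r" using r by simp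
      then have "z \<in> U" using r by blast
      then show "((\<lambda>w. f w x) has_field_derivative deriv (\<lambda>w. f w x) z) (at z within ?S)"
        by (rule has_field_derivative_at_within[OF holomorphic_derivI[OF hol[OF x] U]])
      show "norm (deriv (\<lambda>w. f w x) z) \<le> 2 / r * G x" by (rule der[OF z])
    qed (use w r in auto)
    moreover have "norm (w - w0) > 0" using w by simp
    ultimately show ?thesis by (simp add: norm_divide divide_le_eq)
  qed
  have "((\<lambda>w. ((\<integral>x. f w x \<partial>M) - (\<integral>x. f w0 x \<partial>M)) / (w - w0)) \<longlongrightarrow> (\<integral>x. d x \<partial>M)) (at w0 within ?S)"
    unfolding tendsto_at_iff_sequentially
  proof (intro allI impI)
    fix X :: "nat \<Rightarrow> complex" assume X: "\<forall>i. X i \<in> ?S - {w0}" "X \<longlonglongrightarrow> w0"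
    have Xc: "X i \<in> cball w0 r" for i
    proof -
      have "dist w0 (X i) < r / 2" using X(1) by simp
      then show ?thesis using r by simp
    qed
    have w0c: "w0 \<in> cball w0 r" using r by simp
    have lim: "(\<lambda>i. (f (X i) x - f w0 x) / (X i - w0)) \<longlonglongrightarrow> d x" if x: "x \<in> space M" for x
    proof -
      have "((\<lambda>w. f w x) has_field_derivative d x) (at w0)"
        unfolding d_def using hol[OF x] U w0 by (rule holomorphic_derivI)
      then have "((\<lambda>w. (f w x - f w0 x) / (w - w0)) \<longlongrightarrow> d x) (at w0)"
        by (simp add: has_field_derivative_iff)
      then show ?thesis
        using X unfolding tendsto_at_iff_sequentially by (auto simp: o_def)
    qed
    have measq: "(\<lambda>x. (f (X i) x - f w0 x) / (X i - w0)) \<in> borel_measurable M" for i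
      using int[OF Xc] int[OF w0c] by (intro borel_measurable_divide borel_measurable_diff) auto
    \<comment> \<open>Measurability of the derivative comes from its being a pointwise limit of
      difference quotients.\<close>
    have "d \<in> borel_measurable M"
      by (rule borel_measurable_LIMSEQ_metric[OF measq lim])
    then have "(\<lambda>i. \<integral>x. (f (X i) x - f w0 x) / (X i - w0) \<partial>M) \<longlonglongrightarrow> (\<integral>x. d x \<partial>M)"
      using measq lim lip X
      by (intro integral_dominated_convergence[where w = "\<lambda>x. 2 / r * G x"]) (auto intro!: AE_I2 G)
    then show "((\<lambda>w. ((\<integral>x. f w x \<partial>M) - (\<integral>x. f w0 x \<partial>M)) / (w - w0)) \<circ> X) \<longlonglongrightarrow> (\<integral>x. d x \<partial>M)"
      using int[OF Xc] int[OF w0c] by (simp add: o_def)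
  qed
  then have "((\<lambda>w. \<integral>x. f w x \<partial>M) has_field_derivative (\<integral>x. d x \<partial>M)) (at w0 within ?S)"
    by (simp add: has_field_derivative_iff)
  moreover have "at w0 within ?S = at w0" using r by (intro at_within_open) auto
  ultimately show "(\<lambda>w. \<integral>x. f w x \<partial>M) field_differentiable at w0 within U"
    by (auto simp: field_differentiable_def intro: has_field_derivative_at_within)
qed

lemma DERIV_pos_imp_less:
  fixes f :: "real \<Rightarrow> real"
  assumes ab: "a < b" and d: "\<And>y. a \<le> y \<Longrightarrow> y \<le> b \<Longrightarrow> (f has_real_derivative f' y) (at y)"
    and pos: "\<And>y. a < y \<Longrightarrow> y < b \<Longrightarrow> 0 < f' y"
  shows "f a < f b"
proof (rule DERIV_pos_imp_increasing_open[OF ab])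
  show "\<exists>z. (f has_real_derivative z) (at y) \<and> 0 < z" if "a < y" "y < b" for y
    using d[of y] pos[of y] that by auto
  show "continuous_on {a..b} f"
    by (intro continuous_at_imp_continuous_on ballI) (auto intro: DERIV_isCont d)
qed

lemma DERIV_nonneg_imp_le:
  fixes f :: "real \<Rightarrow> real"
  assumes "a \<le> b" and "\<And>y. a \<le> y \<Longrightarrow> y \<le> b \<Longrightarrow> (f has_real_derivative f' y) (at y)"
    and "\<And>y. a \<le> y \<Longrightarrow> y \<le> b \<Longrightarrow> 0 \<le> f' y"
  shows "f a \<le> f b"
  using DERIV_nonneg_imp_nondecreasing[OF assms(1), of f] assms(2,3) by blast

lemma cos_mult_less_sin:
  fixes s :: real assumes "0 < s" "s < pi" shows "s * cos s < sin s"
proof -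
  have "sin 0 - 0 * cos 0 < sin s - s * cos s"
    by (rule DERIV_pos_imp_less[where f = "\<lambda>s. sin s - s * cos s" and f' = "\<lambda>x. x * sin x"])
      (use assms in \<open>auto intro!: derivative_eq_intros mult_pos_pos sin_gt_zero simp: algebra_simps\<close>)
  then show ?thesis by simp
qed

lemma sinh_less_mult_cosh:
  fixes x :: real assumes "0 < x" shows "sinh x < x * cosh x"
proof -
  have "0 * cosh 0 - sinh 0 < x * cosh x - sinh x"
    by (rule DERIV_pos_imp_less[where f = "\<lambda>x. x * cosh x - sinh x" and f' = "\<lambda>x. x * sinh x"])
      (use assms in \<open>auto intro!: derivative_eq_intros simp: algebra_simps\<close>)
  then show ?thesis by simp
qed

lemma sin_less_self:
  fixes x :: real assumes "0 < x" shows "sin x < x"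
proof (cases "x \<le> 1")
  case True
  have "cos y < 1" if "0 < y" "y < x" for y
    using that True pi_gt3 cos_monotone_0_pi[of 0 y] by simp
  then have "0 - sin 0 < x - sin x"
    by (intro DERIV_pos_imp_less[where f = "\<lambda>x. x - sin x" and f' = "\<lambda>x. 1 - cos x"])
      (use assms in \<open>auto intro!: derivative_eq_intros\<close>)
  then show ?thesis by simp
next
  case False then show ?thesis using sin_le_one[of x] by linarith
qed

lemma cosh_gt_one:
  fixes x :: real assumes "0 < x" shows "1 < cosh x"
  using cosh_real_strict_mono[of 0 x] assms by simp

lemma sinh_minus_strict_mono: "0 \<le> s \<Longrightarrow> s < t \<Longrightarrow> sinh s - s < sinh t - t" for s t :: real
  by (rule DERIV_pos_imp_less[where f = "\<lambda>x. sinh x - x" and f' = "\<lambda>x. cosh x - 1"])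
    (use cosh_gt_one in \<open>auto intro!: derivative_eq_intros\<close>)

lemma less_sinh:
  fixes x :: real assumes "0 < x" shows "x < sinh x"
  using sinh_minus_strict_mono[of 0 x] assms by simp

subsection \<open>The function \<open>sinh z - z\<close> in a strip\<close>

lemma Re_sinh: "Re (sinh z) = sinh (Re z) * cos (Im z)"
  and Im_sinh: "Im (sinh z) = cosh (Re z) * sin (Im z)" for z :: complex
proof -
  have "sinh z = sinh (of_real (Re z) + \<i> * of_real (Im z))" by (simp flip: complex_eq)
  also have "\<dots> = Complex (sinh (Re z) * cos (Im z)) (cosh (Re z) * sin (Im z))"
    unfolding sinh_def cosh_def
    by (simp add: complex_eq_iff exp_add Re_exp Im_exp algebra_simps diff_divide_distrib exp_minus)
  finally show "Re (sinh z) = sinh (Re z) * cos (Im z)" "Im (sinh z) = cosh (Re z) * sin (Im z)" by simp_all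
qed

definition awg :: "complex \<Rightarrow> complex" where "awg z = sinh z - z"

lemma Re_awg: "Re (awg z) = sinh (Re z) * cos (Im z) - Re z"
  and Im_awg: "Im (awg z) = cosh (Re z) * sin (Im z) - Im z"
  by (simp_all add: awg_def Re_sinh Im_sinh)

text \<open>If \<open>Im z \<noteq> 0\<close> and \<open>awg z\<close> is real, then \<open>cosh x = s / sin s\<close>, so that
  \<open>sinh x * cos s = (s * cos s / sin s) * tanh x < x\<close>.\<close>

lemma awg_not_nonneg_real_upper:
  assumes x: "0 < Re z" and s: "0 < Im z" "Im z < 2 * pi" and im: "Im (awg z) = 0"
  shows "Re (awg z) < 0"
proof -
  define x where "x = Re z" define s where "s = Im z"
  have cs: "cosh x * sin s = s" using im by (simp add: Im_awg x_def s_def)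
  have sin: "sin s > 0"
  proof (rule ccontr)
    assume "\<not> sin s > 0"
    then have "cosh x * sin s \<le> 0" by (simp add: mult_le_0_iff)
    with cs s show False by (simp add: s_def)
  qed
  have spi: "s < pi"
  proof (rule ccontr)
    assume "\<not> s < pi"
    then have "sin s \<le> 0" using s sin_le_zero[of s] by (simp add: s_def)
    with sin show False by simp
  qed
  have "cos s * cosh x * sin s = s * cos s" using cs by (simp add: mult.assoc)
  also have "\<dots> < 1 * sin s" using cos_mult_less_sin[of s] spi s by (simp add: s_def)
  finally have "cos s * cosh x * sin s < 1 * sin s" .
  then have c1: "cos s * cosh x < 1" using sin by simp
  have x0: "x > 0" using x by (simp add: x_def)
  have "sinh x * cos s < x"
  proof (cases "cos s > 0")
    case True
    have "sinh x * cos s < x * cosh x * cos s"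
      using sinh_less_mult_cosh[OF x0] True by simp
    also have "\<dots> = x * (cos s * cosh x)" by simp
    also have "\<dots> \<le> x * 1" using c1 x0 by (intro mult_left_mono) auto
    finally show ?thesis by simp
  next
    case False
    then have "sinh x * cos s \<le> 0" using x0 by (simp add: mult_nonneg_nonpos)
    then show ?thesis using x0 by simp
  qed
  then show ?thesis by (simp add: Re_awg x_def[symmetric] s_def[symmetric])
qed

lemma awg_cnj: "awg (cnj z) = cnj (awg z)"
  by (simp add: complex_eq_iff Re_awg Im_awg)

lemma awg_minus: "awg (- z) = - awg z"
  by (simp add: awg_def)

lemma awg_of_real: "awg (of_real t) = of_real (sinh t - t)"
  by (simp add: complex_eq_iff Re_awg Im_awg)

lemma awg_nonreal:
  assumes "0 < Re z" "Im z \<noteq> 0" "\<bar>Im z\<bar> < 2 * pi" and "Im (awg z) = 0"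
  shows "Re (awg z) < 0"
proof (cases "Im z > 0")
  case True then show ?thesis using assms awg_not_nonneg_real_upper[of z] by simp
next
  case False then show ?thesis using assms awg_not_nonneg_real_upper[of "cnj z"] by (simp add: awg_cnj)
qed

lemma awg_nonzero_right:
  assumes "0 < Re z" "\<bar>Im z\<bar> < 2 * pi" shows "awg z \<noteq> 0"
proof (cases "Im z = 0")
  case True then show ?thesis using less_sinh[of "Re z"] assms by (auto simp: complex_eq_iff Re_awg)
next
  case False then show ?thesis using awg_nonreal[of z] assms by auto
qed

text \<open>Once the triple zero at the origin is divided out, a zero-free function on the strip
  remains, which has a logarithm. Oddness reduces to \<open>Re z \<ge> 0\<close>; on the imaginary
  axis the question is whether \<open>sin s = s\<close>.\<close>

lemma awg_nonzero:
  assumes "z \<noteq> 0" "\<bar>Im z\<bar> < 2 * pi" shows "awg z \<noteq> 0"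
proof -
  consider "Re z > 0" | "Re z < 0" | "Re z = 0" by linarith
  then show ?thesis
  proof cases
    case 1 then show ?thesis using awg_nonzero_right[of z] assms by simp
  next
    case 2 then show ?thesis using awg_nonzero_right[of "- z"] assms by (simp add: awg_minus)
  next
    case 3
    then have "Im z \<noteq> 0" using assms by (simp add: complex_eq_iff)
    then have "sin (Im z) \<noteq> Im z"
      using sin_less_self[of "Im z"] sin_less_self[of "- Im z"] by (cases "Im z > 0") auto
    then show ?thesis using 3 by (auto simp: complex_eq_iff Im_awg)
  qed
qed

lemma awg_holomorphic [holomorphic_intros]: "awg holomorphic_on A"
proof -
  have "(\<lambda>z. (exp z - exp (- z)) / 2 - z) holomorphic_on A" by (intro holomorphic_intros) auto
  then show ?thesis
    by (rule holomorphic_transform) (simp add: awg_def sinh_def scaleR_conv_of_real)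
qed

lemma awg_has_derivative: "(awg has_field_derivative (cosh z - 1)) (at z)"
  unfolding awg_def by (auto intro!: derivative_eq_intros)

text \<open>The witness arises from three successive difference quotients at the origin.\<close>

lemma awq_exists: "\<exists>q. q holomorphic_on UNIV \<and> (\<forall>z. awg z = z ^ 3 * q z) \<and> q 0 = 1 / 6"
proof -
  define quot where "quot = (\<lambda>(f :: complex \<Rightarrow> complex) z. if z = 0 then deriv f 0 else (f z - f 0) / (z - 0))"
  have hol: "quot f holomorphic_on UNIV" if "f holomorphic_on UNIV" for f
    unfolding quot_def using pole_lemma_open[OF that, of 0] by simp
  have eq: "f z = f 0 + z * quot f z" for f z by (simp add: quot_def)
  \<comment> \<open>By continuity the value at the origin can be read off from a limit along the
    reals.\<close>
  have zero: "f 0 = 0" if "f holomorphic_on UNIV" "((\<lambda>t::real. f (of_real t)) \<longlongrightarrow> 0) (at 0)" for f :: "complex \<Rightarrow> complex"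
  proof -
    have "isCont f 0"
      using that(1) by (simp add: holomorphic_on_imp_differentiable_at field_differentiable_imp_continuous_at)
    then have "((\<lambda>t::real. f (of_real t)) \<longlongrightarrow> f 0) (at 0)"
      by (intro isCont_tendsto_compose[of _ f]) (auto intro!: tendsto_eq_intros)
    then show ?thesis using that(2) tendsto_unique[of "at (0::real)"] by fastforce
  qed
  have lim: "((\<lambda>t. h (of_real t)) \<longlongrightarrow> complex_of_real l) (at 0)"
    if "\<And>t::real. t \<noteq> 0 \<Longrightarrow> h (of_real t) = complex_of_real (k t)" "(k \<longlongrightarrow> l) (at 0)" for h :: "complex \<Rightarrow> complex" and k l
    by (rule Lim_transform_eventually[OF tendsto_of_real[OF that(2)]])
      (auto simp: eventually_at_filter that(1))
  define f1 where "f1 = quot awg" define f2 where "f2 = quot f1" define f3 where "f3 = quot f2"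
  have h1: "f1 holomorphic_on UNIV" unfolding f1_def by (intro hol holomorphic_intros)
  have h2: "f2 holomorphic_on UNIV" unfolding f2_def by (intro hol h1)
  have h3: "f3 holomorphic_on UNIV" unfolding f3_def by (intro hol h2)
  have e1: "awg z = z * f1 z" for z using eq[of awg z] by (simp add: f1_def awg_def)
  have r1: "f1 (of_real t) = of_real ((sinh t - t) / t)" if "t \<noteq> 0" for t
    using e1[of "of_real t"] that by (simp add: awg_of_real field_simps)
  have z1: "f1 0 = 0"
  proof (rule zero[OF h1])
    have "((\<lambda>t::real. (sinh t - t) / t) \<longlongrightarrow> 0) (at 0)" by real_asymp
    from lim[OF r1 this] show "((\<lambda>t::real. f1 (of_real t)) \<longlongrightarrow> 0) (at 0)" by simp
  qed
  have e2: "f1 z = z * f2 z" for z using eq[of f1 z] z1 by (simp add: f2_def)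
  have r2: "f2 (of_real t) = of_real ((sinh t - t) / t / t)" if "t \<noteq> 0" for t
    using e2[of "of_real t"] that r1[of t] by (simp add: field_simps)
  have z2: "f2 0 = 0"
  proof (rule zero[OF h2])
    have "((\<lambda>t::real. (sinh t - t) / t / t) \<longlongrightarrow> 0) (at 0)" by real_asymp
    from lim[OF r2 this] show "((\<lambda>t::real. f2 (of_real t)) \<longlongrightarrow> 0) (at 0)" by simp
  qed
  have e3: "f2 z = z * f3 z" for z using eq[of f2 z] z2 by (simp add: f3_def)
  have r3: "f3 (of_real t) = of_real ((sinh t - t) / t / t / t)" if "t \<noteq> 0" for t
    using e3[of "of_real t"] that r2[of t] by (simp add: field_simps)
  have z3: "f3 0 - 1 / 6 = 0"
  proof (rule zero)
    show "(\<lambda>z. f3 z - 1 / 6) holomorphic_on UNIV" by (intro holomorphic_intros h3)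
    have "((\<lambda>t::real. (sinh t - t) / t / t / t) \<longlongrightarrow> 1 / 6) (at 0)" by real_asymp
    from tendsto_diff[OF lim[OF r3 this] tendsto_const[of "1 / 6"]]
    show "((\<lambda>t::real. f3 (of_real t) - 1 / 6) \<longlongrightarrow> 0) (at 0)" by simp
  qed
  show ?thesis
    using h3 e1 e2 e3 z3 by (intro exI[of _ f3]) (simp add: power3_eq_cube mult.assoc)
qed


section \<open>A holomorphic cube root of \<open>awg\<close> on the strip\<close>

definition awq :: "complex \<Rightarrow> complex" where
  "awq = (SOME q. q holomorphic_on UNIV \<and> (\<forall>z. awg z = z ^ 3 * q z) \<and> q 0 = 1 / 6)"

lemma awq: "awq holomorphic_on UNIV" "awg z = z ^ 3 * awq z" "awq 0 = 1 / 6"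
  using someI_ex[OF awq_exists] unfolding awq_def[symmetric] by blast+

definition strip :: "complex set" where "strip = {z. \<bar>Im z\<bar> < 2 * pi}"

lemma open_strip: "open strip"
  unfolding strip_def by (intro open_Collect_less continuous_intros)

lemma convex_strip: "convex strip"
proof -
  have "strip = {z. Im z < 2 * pi} \<inter> {z. Im z > - (2 * pi)}" by (auto simp: strip_def)
  then show ?thesis by (metis convex_Int convex_halfspace_Im_lt convex_halfspace_Im_gt)
qed

lemma awq_nonzero: "z \<in> strip \<Longrightarrow> awq z \<noteq> 0"
  using awg_nonzero[of z] awq(2)[of z] awq(3) by (cases "z = 0") (auto simp: strip_def)

text \<open>The value at the origin fixes the branch: it is the real logarithm of
  \<open>awq 0\<close>, and it makes the cube root below real on the real axis.\<close>

lemma awl_exists: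
  "\<exists>l. l holomorphic_on strip \<and> (\<forall>z\<in>strip. exp (l z) = awq z) \<and> l 0 = - of_real (ln 6)"
proof -
  obtain l where l: "l holomorphic_on strip" "\<And>z. z \<in> strip \<Longrightarrow> exp (l z) = awq z"
  proof (rule holomorphic_logarithm_exists[OF convex_strip open_strip])
    show "awq holomorphic_on strip" by (rule holomorphic_on_subset[OF awq(1)]) auto
    show "(0 :: complex) \<in> strip" by (simp add: strip_def)
  qed (use awq_nonzero in blast)+
  \<comment> \<open>The shift does not change the exponential, since
    \<open>exp (l 0) = awq 0 = 1 / 6\<close>.\<close>
  define l' where "l' = (\<lambda>z. l z - l 0 - of_real (ln 6))"
  have "exp (l' z) = awq z" if "z \<in> strip" for z
    using l(2)[of 0] l(2)[OF that] awq(3)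
    by (simp add: l'_def exp_diff exp_of_real strip_def)
  moreover have "l' holomorphic_on strip" unfolding l'_def by (intro holomorphic_intros l)
  ultimately show ?thesis by (intro exI[of _ l']) (simp add: l'_def)
qed

definition awl :: "complex \<Rightarrow> complex" where
  "awl = (SOME l. l holomorphic_on strip \<and> (\<forall>z\<in>strip. exp (l z) = awq z) \<and> l 0 = - of_real (ln 6))"

lemma awl: "awl holomorphic_on strip" "z \<in> strip \<Longrightarrow> exp (awl z) = awq z" "awl 0 = - of_real (ln 6)"
  using someI_ex[OF awl_exists] unfolding awl_def[symmetric] by blast+

text \<open>A cube root of \<open>awg\<close> in which the triple zero is taken out by hand, so that
  it is holomorphic on the whole strip, the origin included.\<close>

definition awy :: "complex \<Rightarrow> complex" where "awy z = z * exp (awl z / 3)"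

lemma awy_holomorphic: "awy holomorphic_on strip"
  unfolding awy_def by (intro holomorphic_intros awl) auto

lemma awy_cube: "z \<in> strip \<Longrightarrow> awy z ^ 3 = awg z"
  by (simp add: awy_def power_mult_distrib awl(2) awq(2)[of z] flip: exp_of_nat_mult)

text \<open>The device that confines continuous arguments below: a value that is never attained
  cannot be crossed.\<close>

lemma IVT_avoid:
  fixes u :: "real \<Rightarrow> real"
  assumes "a \<le> b" "continuous_on {a..b} u" "u a < c" "\<And>x. x \<in> {a..b} \<Longrightarrow> u x \<noteq> c"
  shows "u b < c"
proof (rule ccontr)
  assume "\<not> u b < c"
  then obtain x where "a \<le> x" "x \<le> b" "u x = c"
    using IVT'[of u a c b] assms by auto
  then show False using assms(4) by auto
qed

text \<open>Along the segment from 0 to \<open>z\<close> the function \<open>awq\<close> is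
  positive, so the cosine of \<open>Im (awl _)\<close> is positive there and this imaginary part,
  starting from 0, never leaves the interval from \<open>-pi/2\<close> to \<open>pi/2\<close>. Its
  sine vanishes at the end point, hence so does the imaginary part itself.\<close>

lemma awl_eq_ln:
  assumes z: "z \<in> strip" and pos: "\<And>\<tau>. \<tau> \<in> {0..1} \<Longrightarrow> \<exists>\<rho>>0. awq (of_real \<tau> * z) = of_real \<rho>"
  shows "awl z = of_real (ln (Re (awq z)))"
proof -
  define u where "u = (\<lambda>\<tau>. Im (awl (of_real \<tau> * z)))"
  have strip: "of_real \<tau> * z \<in> strip" if "\<tau> \<in> {0..1}" for \<tau>
  proof -
    have "\<bar>\<tau> * Im z\<bar> \<le> 1 * \<bar>Im z\<bar>" using that by (simp only: abs_mult) (intro mult_right_mono, auto)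
    then show ?thesis using z by (simp add: strip_def)
  qed
  have cont: "continuous_on {0..1} u"
    unfolding u_def using strip
    by (intro continuous_intros continuous_on_compose2[OF holomorphic_on_imp_continuous_on[OF awl(1)]]) auto
  have cos: "cos (u \<tau>) > 0" if \<tau>: "\<tau> \<in> {0..1}" for \<tau>
  proof -
    obtain \<rho> where "\<rho> > 0" "awq (of_real \<tau> * z) = of_real \<rho>" using pos[OF \<tau>] by blast
    then have "Re (exp (awl (of_real \<tau> * z))) > 0" by (simp add: awl(2)[OF strip[OF \<tau>]])
    then show ?thesis by (simp add: Re_exp u_def zero_less_mult_iff)
  qed
  have u0: "u 0 = 0" by (simp add: u_def awl(3))
  have "u 1 < pi / 2"
  proof (rule IVT_avoid[OF _ cont])
    fix x :: real assume "x \<in> {0..1}"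
    then show "u x \<noteq> pi / 2" using cos[of x] by (metis cos_pi_half order_less_irrefl)
  qed (auto simp: u0)
  moreover have "- u 1 < pi / 2"
  proof (rule IVT_avoid[of 0 1 "\<lambda>x. - u x"])
    fix x :: real assume "x \<in> {0..1}"
    then show "- u x \<noteq> pi / 2" using cos[of x] by (metis cos_minus cos_pi_half order_less_irrefl)
  qed (use u0 in \<open>auto intro: continuous_intros cont\<close>)
  moreover have "sin (u 1) = 0"
  proof -
    obtain \<rho> where "\<rho> > 0" "awq (of_real 1 * z) = of_real \<rho>" using pos[of 1] by auto
    then have "Im (exp (awl z)) = 0" by (simp add: awl(2)[OF z])
    then show ?thesis by (simp add: Im_exp u_def)
  qed
  ultimately have "u 1 = 0"
    using sin_gt_zero[of "u 1"] sin_gt_zero[of "- u 1"] by (cases "u 1" "0 :: real" rule: linorder_cases) auto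
  then have im: "Im (awl z) = 0" by (simp add: u_def)
  have "Re (awq z) = exp (Re (awl z))" using im by (simp add: Re_exp flip: awl(2)[OF z])
  then show ?thesis using im by (simp add: complex_eq_iff)
qed

lemma awq_of_real: "t \<noteq> 0 \<Longrightarrow> awq (of_real t) = of_real ((sinh t - t) / t ^ 3)"
  using awq(2)[of "of_real t"] by (simp add: awg_of_real field_simps)

lemma sinh_quot_pos: "t \<noteq> 0 \<Longrightarrow> 0 < (sinh t - t) / t ^ 3" for t :: real
  using less_sinh[of t] less_sinh[of "- t"]
  by (cases "t > 0") (auto simp: zero_less_divide_iff power_less_zero_eq)

lemma awq_real_pos: "\<exists>\<rho>>0. awq (of_real t) = of_real \<rho>"
proof (cases "t = 0")
  case True then show ?thesis using awq(3) by (intro exI[of _ "1 / 6"]) simp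
next
  case False then show ?thesis
    using awq_of_real[of t] sinh_quot_pos[of t] by (intro exI[of _ "(sinh t - t) / t ^ 3"]) simp
qed

lemma awl_of_real: "awl (of_real t) = of_real (ln (Re (awq (of_real t))))"
proof (rule awl_eq_ln)
  show "complex_of_real t \<in> strip" by (simp add: strip_def)
  show "\<exists>\<rho>>0. awq (of_real \<tau> * of_real t) = of_real \<rho>" for \<tau>
    using awq_real_pos[of "\<tau> * t"] by simp
qed

lemma exp_ln_third: "a > 0 \<Longrightarrow> exp (ln a / 3) = root 3 a" for a :: real
  by (metis exp_ln ln_root exp_not_eq_zero real_root_gt_zero zero_less_numeral of_nat_numeral)

lemma awy_of_real: "awy (of_real t) = of_real (root 3 (sinh t - t))"
proof (cases "t = 0")
  case False
  have "awy (of_real t) = of_real (t * root 3 ((sinh t - t) / t ^ 3))"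
    using sinh_quot_pos[OF False]
    by (simp add: awy_def awl_of_real awq_of_real[OF False] exp_ln_third flip: exp_of_real del: of_real_divide)
       (simp flip: exp_of_real exp_ln_third)
  also have "t * root 3 ((sinh t - t) / t ^ 3) = root 3 (sinh t - t)"
    using False by (simp add: real_root_divide odd_real_root_power_cancel)
  finally show ?thesis .
qed (simp add: awy_def)

text \<open>On the imaginary axis \<open>awq\<close> is positive, so \<open>awl_eq_ln\<close>
  applies; of the three cube roots of \<open>-\<i>\<close> the branch of \<open>awl\<close> selects
  \<open>\<i>\<close>.\<close>

lemma awy_imaginary:
  assumes "0 \<le> s" "s < 2 * pi"
  shows "awy (\<i> * of_real s) = \<i> * of_real (root 3 (s - sin s))"
proof (cases "s = 0")
  case False
  have q: "awq (\<i> * of_real s) = of_real ((s - sin s) / s ^ 3)" if "s > 0" for s :: real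
  proof -
    have "awg (\<i> * of_real s) = \<i> * of_real (sin s - s)" by (simp add: complex_eq_iff Re_awg Im_awg)
    moreover have "(\<i> * complex_of_real s) ^ 3 = - \<i> * of_real (s ^ 3)"
      by (simp add: power3_eq_cube algebra_simps)
    ultimately have "- \<i> * (of_real (s ^ 3) * awq (\<i> * of_real s)) = - \<i> * of_real (s - sin s)"
      using awq(2)[of "\<i> * of_real s"] by (simp only: mult.assoc of_real_diff) (simp add: algebra_simps)
    then have "of_real (s ^ 3) * awq (\<i> * of_real s) = of_real (s - sin s)"
      by (simp only: mult_cancel_left) simp
    moreover have "complex_of_real (s ^ 3) \<noteq> 0" using that by simp
    ultimately show ?thesis by (metis nonzero_mult_div_cancel_left of_real_divide)
  qed
  have pos: "(s - sin s) / s ^ 3 > 0" if "s > 0" for s :: real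
    using sin_less_self[OF that] that by simp
  have "awl (\<i> * of_real s) = of_real (ln (Re (awq (\<i> * of_real s))))"
  proof (rule awl_eq_ln)
    show "\<i> * of_real s \<in> strip" using assms by (simp add: strip_def)
    fix \<tau> :: real assume \<tau>: "\<tau> \<in> {0..1}"
    show "\<exists>\<rho>>0. awq (of_real \<tau> * (\<i> * of_real s)) = of_real \<rho>"
    proof (cases "\<tau> = 0")
      case True then show ?thesis using awq(3) by (intro exI[of _ "1 / 6"]) simp
    next
      case False
      with \<tau> \<open>s \<noteq> 0\<close> assms have "\<tau> * s > 0" by simp
      moreover have "of_real \<tau> * (\<i> * of_real s) = \<i> * complex_of_real (\<tau> * s)" by simp
      ultimately show ?thesis using q[of "\<tau> * s"] pos[of "\<tau> * s"] by metis
    qed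
  qed
  then have "awl (\<i> * of_real s) = of_real (ln ((s - sin s) / s ^ 3))"
    using q[of s] False assms by simp
  then have "awy (\<i> * of_real s) = \<i> * of_real s * of_real (exp (ln ((s - sin s) / s ^ 3) / 3))"
    by (simp add: awy_def flip: exp_of_real)
  also have "exp (ln ((s - sin s) / s ^ 3) / 3) = root 3 (s - sin s) / s"
    using False assms pos[of s] by (simp add: exp_ln_third real_root_divide odd_real_root_power_cancel)
  finally show ?thesis using False by simp
qed (simp add: awy_def)

text \<open>The continuous argument of \<open>awg\<close> along a vertical segment starting on the positive real axis
  cannot reach \<open>0\<close> or \<open>2\<pi>\<close> again, as \<open>awg\<close> does not return to the positive reals.\<close>

lemma awg_arg_range:
  assumes x: "x > 0" and s0: "0 < s0" "s0 < 2 * pi"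
    and cont: "continuous_on {0..s0} u" and u0: "u 0 = 0"
    and rep: "\<And>s. s \<in> {0..s0} \<Longrightarrow> \<exists>\<rho>>0. awg (Complex x s) = rcis \<rho> (u s)"
  shows "0 < u s0 \<and> u s0 < 2 * pi"
proof
  have avoid: "\<not> (sin (u s) = 0 \<and> cos (u s) > 0)" if s: "s \<in> {0<..s0}" for s
  proof
    assume A: "sin (u s) = 0 \<and> cos (u s) > 0"
    obtain \<rho> where \<rho>: "\<rho> > 0" "awg (Complex x s) = rcis \<rho> (u s)" using rep[of s] s by auto
    have "Re (awg (Complex x s)) < 0"
      using awg_not_nonneg_real_upper[of "Complex x s"] s s0 x A \<rho> by (simp add: rcis_def cis.simps)
    then show False using \<rho> A by (simp add: rcis_def cis.simps mult_less_0_iff)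
  qed
  have ne: "u s \<noteq> 0" "u s \<noteq> 2 * pi" if "s \<in> {0<..s0}" for s
    using avoid[OF that] by auto
  show "u s0 < 2 * pi"
  proof (rule IVT_avoid[OF _ cont])
    fix s assume "s \<in> {0..s0}"
    then show "u s \<noteq> 2 * pi" using ne(2)[of s] u0 by (cases "s = 0") auto
  qed (use s0 u0 in auto)
  show "0 < u s0"
  proof (rule ccontr)
    assume "\<not> 0 < u s0"
    then have neg0: "u s0 < 0" using ne[of s0] s0 by force
    have neg: "u s < 0" if s: "s \<in> {0<..s0}" for s
    proof (rule ccontr)
      assume "\<not> u s < 0"
      then have "- u s < 0" using ne[OF s] by simp
      then have "- u s0 < 0"
        using s ne by (intro IVT_avoid[of s s0 "\<lambda>x. - u x"]) (auto intro!: continuous_intros continuous_on_subset[OF cont])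
      then show False using neg0 by simp
    qed
    \<comment> \<open>A negative \<open>u\<close> would lie between \<open>-pi\<close> and 0 for
      small \<open>s\<close>, making \<open>Im awg\<close> negative. But
      \<open>Im awg = cosh x * sin s - s\<close> is positive for small \<open>s\<close>, having
      slope \<open>cosh x - 1 > 0\<close> at 0.\<close>
    have ev1: "eventually (\<lambda>s. - pi < u s) (at_right 0)"
    proof -
      have "(u \<longlongrightarrow> u 0) (at 0 within {0..s0})" using cont s0 by (simp add: continuous_on_def)
      then have "(u \<longlongrightarrow> u 0) (at_right 0)"
        using s0 by (simp add: at_within_Icc_at_right)
      then show ?thesis by (rule order_tendstoD) (simp add: u0)
    qed
    have ev2: "eventually (\<lambda>s. cosh x * sin s - s > 0) (at_right 0)"
    proof -
      have "((\<lambda>s. cosh x * sin s - s) has_real_derivative cosh x - 1) (at 0)"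
        by (auto intro!: derivative_eq_intros)
      from DERIV_pos_inc_right[OF this] cosh_gt_one[OF x]
      obtain d where "d > 0" "\<forall>h>0. h < d \<longrightarrow> 0 < cosh x * sin h - h" by auto
      then show ?thesis by (auto simp: eventually_at_right_field intro!: exI[of _ d])
    qed
    have "eventually (\<lambda>s. s \<in> {0<..<s0}) (at_right (0::real))"
      using s0 by (intro eventually_at_right_real)
    with ev1 ev2 have "eventually (\<lambda>s. - pi < u s \<and> cosh x * sin s - s > 0 \<and> s \<in> {0<..<s0}) (at_right 0)"
      by eventually_elim auto
    then obtain s where s: "- pi < u s" "cosh x * sin s - s > 0" "s \<in> {0<..s0}"
      using eventually_happens'[OF trivial_limit_at_right_real] by force
    obtain \<rho> where \<rho>: "\<rho> > 0" "awg (Complex x s) = rcis \<rho> (u s)" using rep[of s] s by auto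
    have "Im (awg (Complex x s)) > 0" using s by (simp add: Im_awg)
    then have "sin (u s) > 0" using \<rho> by (simp add: rcis_def cis.simps zero_less_mult_iff)
    moreover have "sin (- u s) > 0" using s neg[OF s(3)] by (intro sin_gt_zero) auto
    ultimately show False by simp
  qed
qed

section \<open>The argument of \<open>awg\<close> in the right half-strip\<close>

text \<open>The logarithm of \<open>awg\<close> for \<open>Re z > 0\<close> that is real on the
  positive axis; its imaginary part is the continuous argument to which \<open>awg_arg_range\<close>
  applies.\<close>

definition awL :: "complex \<Rightarrow> complex" where "awL z = 3 * Ln z + awl z"

definition hstrip :: "complex set" where "hstrip = {z. 0 < Re z \<and> \<bar>Im z\<bar> < 2 * pi}"

lemma hstrip_subset: "hstrip \<subseteq> strip" by (auto simp: hstrip_def strip_def)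

lemma open_hstrip: "open hstrip"
proof -
  have "hstrip = {z. 0 < Re z} \<inter> strip" by (auto simp: hstrip_def strip_def)
  then show ?thesis by (metis open_Int open_strip open_halfspace_Re_gt)
qed

lemma convex_hstrip: "convex hstrip"
proof -
  have "hstrip = {z. 0 < Re z} \<inter> strip" by (auto simp: hstrip_def strip_def)
  then show ?thesis by (metis convex_Int convex_strip convex_halfspace_Re_gt)
qed

lemma awL:
  assumes "z \<in> hstrip"
  shows "exp (awL z) = awg z" "awy z = exp (awL z / 3)"
proof -
  have z: "z \<noteq> 0" "z \<in> strip" using assms by (auto simp: hstrip_def strip_def)
  show "exp (awL z) = awg z"
    using z exp_of_nat_mult[of 3 "Ln z"] by (simp add: awL_def exp_add awl(2) awq(2)[of z])
  show "awy z = exp (awL z / 3)"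
    using z by (simp add: awL_def awy_def add_divide_distrib exp_add)
qed

lemma awL_continuous: "continuous_on hstrip awL"
proof -
  have "awL holomorphic_on hstrip"
    unfolding awL_def
    by (intro holomorphic_intros holomorphic_on_subset[OF awl(1) hstrip_subset])
      (auto simp: hstrip_def complex_nonpos_Reals_iff)
  then show ?thesis by (rule holomorphic_on_imp_continuous_on)
qed

lemma awL_of_real: "t > 0 \<Longrightarrow> Im (awL (of_real t)) = 0"
  by (simp add: awL_def awl_of_real Ln_of_real)

lemma awL_arg_upper:
  assumes z: "z \<in> hstrip" "Im z > 0"
  shows "0 < Im (awL z)" "Im (awL z) < 2 * pi"
proof -
  define u where "u = (\<lambda>s. Im (awL (Complex (Re z) s)))"
  have hs: "Complex (Re z) s \<in> hstrip" if "s \<in> {0..Im z}" for s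
    using z that by (auto simp: hstrip_def)
  have "continuous_on {0..Im z} (\<lambda>s. Complex (Re z) s)"
    by (simp add: Complex_eq continuous_intros)
  then have cont: "continuous_on {0..Im z} u"
    unfolding u_def using hs by (intro continuous_intros continuous_on_compose2[OF awL_continuous]) auto
  have "0 < u (Im z) \<and> u (Im z) < 2 * pi"
  proof (rule awg_arg_range[of "Re z" "Im z" u, OF _ _ _ cont])
    show "u 0 = 0" using awL_of_real[of "Re z"] z by (simp add: u_def hstrip_def complex_of_real_def)
    show "\<exists>\<rho>>0. awg (Complex (Re z) s) = rcis \<rho> (u s)" if "s \<in> {0..Im z}" for s
      using awL(1)[OF hs[OF that]]
      by (intro exI[of _ "exp (Re (awL (Complex (Re z) s)))"]) (simp add: u_def exp_eq_polar rcis_def)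
  qed (use z in \<open>auto simp: hstrip_def\<close>)
  then show "0 < Im (awL z)" "Im (awL z) < 2 * pi" by (simp_all add: u_def)
qed

lemma awL_arg_lower:
  assumes z: "z \<in> hstrip" "Im z < 0"
  shows "- (2 * pi) < Im (awL z)" "Im (awL z) < 0"
proof -
  define u where "u = (\<lambda>s. - Im (awL (Complex (Re z) (- s))))"
  have hs: "Complex (Re z) (- s) \<in> hstrip" if "s \<in> {0..- Im z}" for s
    using z that by (auto simp: hstrip_def)
  have "continuous_on {0..- Im z} (\<lambda>s. Complex (Re z) (- s))"
    by (simp add: Complex_eq continuous_intros)
  then have cont: "continuous_on {0..- Im z} u"
    unfolding u_def using hs by (intro continuous_intros continuous_on_compose2[OF awL_continuous]) auto
  have "0 < u (- Im z) \<and> u (- Im z) < 2 * pi"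
  proof (rule awg_arg_range[of "Re z" "- Im z" u, OF _ _ _ cont])
    show "u 0 = 0" using awL_of_real[of "Re z"] z by (simp add: u_def hstrip_def complex_of_real_def)
    show "\<exists>\<rho>>0. awg (Complex (Re z) s) = rcis \<rho> (u s)" if "s \<in> {0..- Im z}" for s
    proof -
      have "awg (Complex (Re z) s) = cnj (awg (Complex (Re z) (- s)))"
        by (simp flip: awg_cnj add: complex_cnj)
      then show ?thesis using awL(1)[OF hs[OF that]]
        by (intro exI[of _ "exp (Re (awL (Complex (Re z) (- s))))"])
          (simp add: u_def exp_eq_polar rcis_def flip: cis_cnj, metis complex_cnj_complex_of_real complex_cnj_mult)
    qed
  qed (use z in \<open>auto simp: hstrip_def\<close>)
  then show "- (2 * pi) < Im (awL z)" "Im (awL z) < 0" by (simp_all add: u_def)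
qed

text \<open>The argument of \<open>(awy z)\<^sup>2\<close> is two thirds of that of
  \<open>awg z\<close>. Off the real axis it is nonzero and less than \<open>4 * pi / 3\<close> in
  modulus, so it is no multiple of \<open>2 * pi\<close> and the square is not positive. This leaves
  the kernel a single pole in the half-strip.\<close>

lemma awy_eq_real_cases:
  assumes z: "z \<in> hstrip" and y0: "y0 > 0" and eq: "(awy z)\<^sup>2 = of_real (y0\<^sup>2)"
  shows "Im z = 0" "root 3 (sinh (Re z) - Re z) = y0"
proof -
  have e: "(awy z)\<^sup>2 = exp (2 * awL z / 3)"
    using awL(2)[OF z] by (simp flip: exp_of_nat_mult)
  define \<phi> where "\<phi> = 2 * Im (awL z) / 3"
  have s: "sin \<phi> = 0" "cos \<phi> > 0"
    using arg_cong[OF eq, of Im] arg_cong[OF eq, of Re] y0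
    unfolding e by (simp_all add: Im_exp Re_exp \<phi>_def zero_less_mult_iff) (metis zero_less_mult_pos exp_gt_zero zero_less_power)
  have range: "\<bar>\<phi>\<bar> < 4 * pi / 3" if "Im z \<noteq> 0"
    using awL_arg_upper[OF z] awL_arg_lower[OF z] that by (cases "Im z > 0") (auto simp: \<phi>_def)
  show im: "Im z = 0"
  proof (rule ccontr)
    assume nz: "Im z \<noteq> 0"
    have "\<phi> \<noteq> 0" using awL_arg_upper[OF z] awL_arg_lower[OF z] nz by (cases "Im z > 0") (auto simp: \<phi>_def)
    have "cos \<phi> = 1" using s sin_cos_squared_add[of \<phi>] by (simp add: power2_eq_1_iff)
    then obtain n :: int where "\<phi> = of_int n * 2 * pi" using cos_one_2pi_int by auto
    moreover from this \<open>\<phi> \<noteq> 0\<close> have "\<bar>of_int n\<bar> \<ge> (1::real)" by (cases "n = 0") auto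
    ultimately have "\<bar>\<phi>\<bar> \<ge> 2 * pi" by (simp add: abs_mult)
    then show False using range[OF nz] pi_gt_zero by linarith
  qed
  have "z = of_real (Re z)" using im by (simp add: complex_eq_iff)
  then have "(awy z) = of_real (root 3 (sinh (Re z) - Re z))" by (metis awy_of_real)
  then have "(root 3 (sinh (Re z) - Re z))\<^sup>2 = y0\<^sup>2"
    using eq by (metis of_real_eq_iff of_real_power)
  moreover have "root 3 (sinh (Re z) - Re z) > 0" using less_sinh[of "Re z"] z by (simp add: hstrip_def)
  ultimately show "root 3 (sinh (Re z) - Re z) = y0"
    using y0 by (simp add: power2_eq_iff)
qed

text \<open>The curve issuing from \<open>2\<pi>i\<close> on which \<open>awg\<close> is negative imaginary.\<close>

definition bcurve :: "real \<Rightarrow> real" where "bcurve x = 2 * pi - arccos (x / sinh x)"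

text \<open>The radicand is the modulus of \<open>awg\<close> on the curve, and
  \<open>awy = \<i> * eta x\<close> there (\<open>awy_curve\<close>).\<close>

definition eta :: "real \<Rightarrow> real" where "eta x = root 3 (bcurve x - cosh x * sin (bcurve x))"

context
  fixes x :: real assumes x: "x > 0"
begin

lemma x_div_sinh: "0 < x / sinh x" "x / sinh x < 1"
  using x less_sinh[OF x] by (simp_all add: divide_less_eq)

lemma bcurve_bounds: "3 * pi / 2 < bcurve x" "bcurve x < 2 * pi"
  using x_div_sinh arccos_lt_bounded[of "x / sinh x"] arccos_less_arccos[of 0 "x / sinh x"]
  by (auto simp: bcurve_def)

lemma sin_bcurve: "sin (bcurve x) < 0"
  using bcurve_bounds sin_lt_zero[of "bcurve x"] pi_gt_zero by linarith

lemma curve_in_hstrip: "Complex x (bcurve x) \<in> hstrip"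
  using x bcurve_bounds by (simp add: hstrip_def)

lemma awg_curve: "awg (Complex x (bcurve x)) = - \<i> * of_real (bcurve x - cosh x * sin (bcurve x))"
proof -
  have "cos (bcurve x) = x / sinh x" using x_div_sinh by (simp add: bcurve_def cos_diff)
  then show ?thesis using x by (simp add: complex_eq_iff Re_awg Im_awg)
qed

lemma eta_arg: "bcurve x - cosh x * sin (bcurve x) > 3 * pi / 2"
proof -
  have "cosh x * sin (bcurve x) < 0" using sin_bcurve by (simp add: mult_pos_neg)
  then show ?thesis using bcurve_bounds by linarith
qed

text \<open>A crude bound that is enough: it makes the powers of \<open>1 / eta x\<close> decrease
  and keeps the kernel regular in the unit disc.\<close>

lemma eta_gt_one: "eta x > 1"
  using eta_arg pi_gt3 by (simp add: eta_def)

text \<open>As \<open>awg\<close> is negative imaginary on the curve, its argument is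
  \<open>3 * pi / 2\<close> up to full turns. The range from 0 to \<open>2 * pi\<close> leaves only
  \<open>3 * pi / 2\<close> itself, a third of which is \<open>pi / 2\<close>.\<close>

lemma awy_curve: "awy (Complex x (bcurve x)) = \<i> * of_real (eta x)"
proof -
  define z where "z = Complex x (bcurve x)"
  define v where "v = bcurve x - cosh x * sin (bcurve x)"
  have v: "v > 0" using eta_arg pi_gt_zero unfolding v_def by linarith
  have z: "z \<in> hstrip" "Im z > 0" using curve_in_hstrip bcurve_bounds pi_gt_zero
    by (simp_all add: z_def)
  have e: "exp (awL z) = - \<i> * of_real v" using awL(1)[OF z(1)] awg_curve by (simp add: z_def v_def)
  have nrm: "exp (Re (awL z)) = v" using arg_cong[OF e, of norm] v by (simp add: norm_mult)
  have "Im (exp (awL z)) = - v" unfolding e by simp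
  then have "v * sin (Im (awL z)) = v * (- 1)" using nrm by (simp add: Im_exp)
  then have "sin (Im (awL z)) = - 1" using v by (metis mult_left_cancel order_less_irrefl)
  then have "cos (Im (awL z) - 3 / 2 * pi) = 1"
    using cos_3over2_pi sin_3over2_pi by (simp only: cos_diff)
  then obtain n :: int where n: "Im (awL z) - 3 / 2 * pi = of_int n * 2 * pi" using cos_one_2pi_int by auto
  have "\<bar>Im (awL z) - 3 / 2 * pi\<bar> < 2 * pi" using awL_arg_upper[OF z] by linarith
  then have "\<bar>of_int n\<bar> < (1 :: real)" unfolding n by (simp add: abs_mult)
  then have "n = 0" by linarith
  then have im: "Im (awL z) = 3 * pi / 2" using n by simp
  have "awy z = exp (awL z / 3)" by (rule awL(2)[OF z(1)])
  also have "\<dots> = of_real (exp (Re (awL z) / 3)) * cis (pi / 2)"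
  proof -
    have "Im (awL z / 3) = pi / 2" "Re (awL z / 3) = Re (awL z) / 3" using im by simp_all
    then show ?thesis unfolding exp_eq_polar by (simp only:)
  qed
  also have "exp (Re (awL z) / 3) = root 3 v"
    using exp_ln_third[of v] v nrm by (metis ln_exp)
  finally show ?thesis by (simp add: z_def v_def eta_def mult.commute)
qed

end


subsection \<open>The Stieltjes representation of \<open>dt/dy\<close>\<close>

text \<open>The distance from the origin to the ray that starts at 1 in direction
  \<open>\<tau>\<close>: if the ray points to the right, it is at least 1; otherwise it is at least
  the distance \<open>\<bar>sin \<tau>\<bar>\<close> to the full line.\<close>

lemma norm_one_plus_cis_ge:
  assumes x: "x \<ge> 0" and \<tau>: "\<bar>\<tau>\<bar> \<le> pi - \<delta>" and \<delta>: "0 < \<delta>" "\<delta> \<le> pi / 2"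
  shows "sin \<delta> \<le> norm (1 + of_real x * cis \<tau>)"
proof (cases "cos \<tau> \<ge> 0")
  case True
  have "sin \<delta> \<le> 1" by simp
  also have "1 \<le> Re (1 + of_real x * cis \<tau>)" using x True by simp
  also have "\<dots> \<le> norm (1 + of_real x * cis \<tau>)" by (rule complex_Re_le_cmod)
  finally show ?thesis .
next
  case False
  have "\<bar>\<tau>\<bar> > pi / 2"
  proof (rule ccontr)
    assume "\<not> \<bar>\<tau>\<bar> > pi / 2"
    then have "cos \<tau> \<ge> 0" by (intro cos_ge_zero) auto
    with False show False by simp
  qed
  then have "sin \<delta> \<le> sin (pi - \<bar>\<tau>\<bar>)"
    using \<tau> \<delta> by (intro sin_monotone_2pi_le) auto
  also have "\<dots> \<le> \<bar>sin \<tau>\<bar>" by (cases "\<tau> \<ge> 0") auto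
  finally have s: "sin \<delta> \<le> \<bar>sin \<tau>\<bar>" .
  have "(norm (1 + of_real x * cis \<tau>))\<^sup>2 = (1 + x * cos \<tau>)\<^sup>2 + (x * sin \<tau>)\<^sup>2"
    by (simp add: cmod_power2)
  \<comment> \<open>The last summand is zero; with it the equation is a polynomial identity that
    does not depend on the relation between sine and cosine.\<close>
  also have "\<dots> = (x + cos \<tau>)\<^sup>2 + (sin \<tau>)\<^sup>2 + (1 - x\<^sup>2) * (1 - ((sin \<tau>)\<^sup>2 + (cos \<tau>)\<^sup>2))"
    by algebra
  also have "\<dots> = (x + cos \<tau>)\<^sup>2 + (sin \<tau>)\<^sup>2"
    using sin_cos_squared_add[of \<tau>] by simp
  finally have "(norm (1 + of_real x * cis \<tau>))\<^sup>2 = (x + cos \<tau>)\<^sup>2 + (sin \<tau>)\<^sup>2" .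
  then have "\<bar>sin \<tau>\<bar>\<^sup>2 \<le> (norm (1 + of_real x * cis \<tau>))\<^sup>2"
    by (metis le_add_same_cancel2 power2_abs zero_le_power2)
  then have "\<bar>sin \<tau>\<bar> \<le> norm (1 + of_real x * cis \<tau>)"
    by (rule power2_le_imp_le) (rule norm_ge_zero)
  with s show ?thesis by simp
qed

lemma norm_one_plus_cis_ge_one:
  assumes "x \<ge> 0" "cos \<tau> \<ge> 0" shows "1 \<le> norm (1 + of_real x * cis \<tau>)"
proof -
  have "1 \<le> Re (1 + of_real x * cis \<tau>)" using assms by simp
  also have "\<dots> \<le> norm (1 + of_real x * cis \<tau>)" by (rule complex_Re_le_cmod)
  finally show ?thesis .
qed

lemma awy_nonzero: "z \<in> strip \<Longrightarrow> z \<noteq> 0 \<Longrightarrow> awy z \<noteq> 0"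
  by (simp add: awy_def)

lemma awy_has_derivative:
  assumes z: "z \<in> strip" "z \<noteq> 0"
  shows "(awy has_field_derivative (cosh z - 1) / (3 * (awy z)\<^sup>2)) (at z)"
proof -
  have d: "(awy has_field_derivative deriv awy z) (at z)"
    by (rule holomorphic_derivI[OF awy_holomorphic open_strip z(1)])
  have "((\<lambda>z. awy z ^ 3) has_field_derivative 3 * (awy z)\<^sup>2 * deriv awy z) (at z)"
    by (rule derivative_eq_intros d refl)+ simp
  moreover have "((\<lambda>z. awy z ^ 3) has_field_derivative cosh z - 1) (at z)"
    by (rule has_field_derivative_transform_within_open[OF awg_has_derivative open_strip z(1)]) (simp add: awy_cube)
  ultimately have "3 * (awy z)\<^sup>2 * deriv awy z = cosh z - 1" by (rule DERIV_unique)
  then have "deriv awy z = (cosh z - 1) / (3 * (awy z)\<^sup>2)"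
    using awy_nonzero[OF z] by (simp add: field_simps)
  with d show ?thesis by simp
qed

section \<open>The kernel \<open>awK\<close> and its simple pole on the positive axis\<close>

definition awg_root :: "real \<Rightarrow> real" where "awg_root t = root 3 (sinh t - t)"

lemma awg_root_pos: "t > 0 \<Longrightarrow> awg_root t > 0"
  using less_sinh[of t] by (simp add: awg_root_def)

lemma awg_root_inj: "s > 0 \<Longrightarrow> t > 0 \<Longrightarrow> awg_root s = awg_root t \<Longrightarrow> s = t"
  using sinh_minus_strict_mono[of s t] sinh_minus_strict_mono[of t s]
  by (cases s t rule: linorder_cases) (auto simp: awg_root_def)

text \<open>The sum of \<open>1 / (awy z - y)\<close> and \<open>1 / (awy z + y)\<close>, which is
  imaginary wherever \<open>awy z\<close> is.\<close>

definition awK :: "real \<Rightarrow> complex \<Rightarrow> complex" where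
  "awK y z = 2 * awy z / ((awy z)\<^sup>2 - of_real (y\<^sup>2))"

text \<open>The pole of \<open>awK\<close> at \<open>t\<close> is subtracted, so that a primitive exists on the convex half strip.\<close>

lemma awK_decomposition:
  assumes t: "t > 0"
  defines "y \<equiv> awg_root t" and "c \<equiv> 3 * (awg_root t)\<^sup>2 / (cosh t - 1)"
  obtains P where
    "\<And>z. z \<in> hstrip \<Longrightarrow> z \<noteq> of_real t \<Longrightarrow>
       (P has_field_derivative awK y z - of_real c / (z - of_real t)) (at z)"
    "continuous_on hstrip P" "\<And>x. x > 0 \<Longrightarrow> Im (P (of_real x)) = 0"
proof -
  define t' where "t' = complex_of_real t"
  have t': "t' \<in> hstrip" "t' \<in> strip" "t' \<noteq> 0" using t by (auto simp: t'_def hstrip_def strip_def)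
  have y: "y > 0" unfolding y_def by (rule awg_root_pos[OF t])
  have awyt: "awy t' = of_real y" by (simp add: t'_def awy_of_real y_def awg_root_def)
  have ch: "cosh t - 1 > 0" using cosh_gt_one[OF t] by simp
  have c: "c > 0" using y ch by (simp add: c_def y_def)
  have cosht: "cosh t' = of_real (cosh t)"
    unfolding t'_def cosh_def by (simp add: exp_of_real scaleR_conv_of_real flip: of_real_minus)
  have dawy: "(awy has_field_derivative of_real (1 / c)) (at t')"
    using awy_has_derivative[OF t'(2,3)] unfolding awyt c_def y_def[symmetric] cosht by simp
  define g where "g = (\<lambda>z. (awy z)\<^sup>2 - of_real (y\<^sup>2))"
  have gt: "g t' = 0" by (simp add: g_def awyt)
  have ghol: "g holomorphic_on hstrip"
    unfolding g_def by (intro holomorphic_intros holomorphic_on_subset[OF awy_holomorphic hstrip_subset])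
  have dg: "deriv g t' = of_real (2 * y / c)"
    unfolding g_def by (rule DERIV_imp_deriv) (auto intro!: derivative_eq_intros dawy simp: awyt)
  define D where "D = (\<lambda>z. if z = t' then deriv g t' else (g z - g t') / (z - t'))"
  have Dhol: "D holomorphic_on hstrip"
    unfolding D_def by (rule pole_lemma_open[OF ghol open_hstrip])
  have gnz: "g z \<noteq> 0" if "z \<in> hstrip" "z \<noteq> t'" for z
  proof
    assume "g z = 0"
    then have "(awy z)\<^sup>2 = of_real (y\<^sup>2)" by (simp add: g_def)
    from awy_eq_real_cases[OF that(1) y this] have im: "Im z = 0" and e: "awg_root (Re z) = awg_root t"
      by (simp_all add: awg_root_def y_def)
    have "Re z > 0" using that by (simp add: hstrip_def)
    then have "Re z = t" by (rule awg_root_inj[OF _ t e])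
    with im show False using that by (simp add: t'_def complex_eq_iff)
  qed
  have Dnz: "D z \<noteq> 0" if "z \<in> hstrip" for z
    using gnz[OF that] dg y c by (auto simp: D_def gt)
  \<comment> \<open>Here \<open>awK y z = h z / (z - t')\<close> with \<open>h\<close> holomorphic,
    so \<open>h t'\<close> is the residue, equal to \<open>c = dt/dy\<close>. The difference
    quotient \<open>H\<close> of \<open>h\<close> is then \<open>awK\<close> without its principal
    part.\<close>
  define h where "h = (\<lambda>z. 2 * awy z / D z)"
  have hhol: "h holomorphic_on hstrip"
    unfolding h_def
    by (intro holomorphic_intros holomorphic_on_subset[OF awy_holomorphic hstrip_subset] Dhol Dnz)
  have ht: "h t' = of_real c" using y c by (simp add: h_def D_def dg awyt)
  define H where "H = (\<lambda>z. if z = t' then deriv h t' else (h z - h t') / (z - t'))"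
  have Hhol: "H holomorphic_on hstrip"
    unfolding H_def by (rule pole_lemma_open[OF hhol open_hstrip])
  have Heq: "H z = awK y z - of_real c / (z - t')" if "z \<in> hstrip" "z \<noteq> t'" for z
  proof -
    have "H z = h z / (z - t') - of_real c / (z - t')" using that by (simp add: H_def ht diff_divide_distrib)
    also have "h z / (z - t') = 2 * awy z / g z" using that gnz[OF that] by (simp add: h_def D_def gt)
    finally show ?thesis by (simp add: awK_def g_def)
  qed
  obtain P where "\<And>z. z \<in> hstrip \<Longrightarrow> (P has_field_derivative H z) (at z within hstrip)"
    by (rule holomorphic_convex_primitive'[OF convex_hstrip open_hstrip Hhol]) blast
  then have P: "(P has_field_derivative H z) (at z)" if "z \<in> hstrip" for z
    using that at_within_open[OF _ open_hstrip] by metis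
  have Pcont: "continuous_on hstrip P"
    by (intro continuous_at_imp_continuous_on ballI) (rule DERIV_isCont[OF P])
  have hs: "complex_of_real x \<in> hstrip" if "x > 0" for x using that by (simp add: hstrip_def)
  \<comment> \<open>\<open>H\<close> is real on the positive axis except possibly at
    \<open>t\<close>, and continuity of \<open>P\<close> bridges that point. Subtracting the
    constant makes the primitive real on the axis.\<close>
  have "(\<lambda>x. Im (P (of_real x))) constant_on {0<..}"
  proof (rule DERIV_zero_connected_constant_on[where K = "{t}"])
    show "continuous_on {0<..} (\<lambda>x. Im (P (of_real x)))"
      by (intro continuous_intros continuous_on_compose2[OF Pcont]) (auto intro: hs)
    show "\<forall>x\<in>{0<..} - {t}. ((\<lambda>x. Im (P (complex_of_real x))) has_real_derivative 0) (at x)"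
    proof
      fix x assume x: "x \<in> {0<..} - {t}"
      have "Im (H (of_real x)) = 0"
      proof -
        have "awK y (of_real x) = of_real (2 * awg_root x / ((awg_root x)\<^sup>2 - y\<^sup>2))"
          by (simp add: awK_def awy_of_real awg_root_def)
        moreover have "of_real c / (of_real x - t') = complex_of_real (c / (x - t))" by (simp add: t'_def)
        moreover have "of_real x \<noteq> t'" using x by (auto simp: t'_def)
        ultimately have "H (of_real x) = of_real (2 * awg_root x / ((awg_root x)\<^sup>2 - y\<^sup>2) - c / (x - t))"
          using Heq[of "of_real x"] hs[of x] x by (simp del: of_real_divide)
        then show ?thesis by (simp only: Im_complex_of_real)
      qed
      moreover have "((P \<circ> of_real) has_vector_derivative 1 * H (of_real x)) (at x)"
      proof (rule field_vector_diff_chain_at)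
        show "(complex_of_real has_vector_derivative 1) (at x)"
          using has_vector_derivative_of_real[OF DERIV_ident] by force
        show "(P has_field_derivative H (complex_of_real x)) (at (complex_of_real x))"
          using x by (intro P hs) auto
      qed
      ultimately show "((\<lambda>x. Im (P (complex_of_real x))) has_real_derivative 0) (at x)"
        using has_field_derivative_Im by (fastforce simp: o_def)
    qed
  qed auto
  then obtain k where k: "\<And>x. x > 0 \<Longrightarrow> Im (P (of_real x)) = k"
    unfolding constant_on_def by auto
  show ?thesis
  proof
    show "((\<lambda>z. P z - \<i> * of_real k) has_field_derivative awK y z - of_real c / (z - of_real t)) (at z)"
      if "z \<in> hstrip" "z \<noteq> of_real t" for z
      using that P[OF that(1)] Heq[OF that(1)]
      by (auto intro!: derivative_eq_intros simp: t'_def)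
    show "continuous_on hstrip (\<lambda>z. P z - \<i> * of_real k)" by (intro continuous_intros Pcont)
  qed (auto simp: k)
qed

text \<open>If \<open>awy\<close> is at most \<open>y / 2\<close> in modulus, the denominator is
  bounded below by the triangle inequality. Otherwise \<open>awg\<close> is not small, while its
  real part is at most \<open>sinh x + x\<close>; so \<open>awg\<close> is nearly imaginary, its
  argument lies between \<open>pi / 3\<close> and \<open>5 * pi / 3\<close>, and
  \<open>(awy z)\<^sup>2\<close> points away from the positive axis.\<close>

lemma awK_bounded_near_axis:
  assumes y: "y > 0"
  obtains M x1 where "x1 > 0"
    "\<And>x s. 0 < x \<Longrightarrow> x < x1 \<Longrightarrow> 0 \<le> s \<Longrightarrow> s < 2 * pi \<Longrightarrow>
       (awy (Complex x s))\<^sup>2 \<noteq> of_real (y\<^sup>2) \<and> norm (awK y (Complex x s)) \<le> M"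
proof -
  have "((\<lambda>x::real. sinh x + x) \<longlongrightarrow> 0) (at_right 0)" by (auto intro!: tendsto_eq_intros)
  \<comment> \<open>The bound is half of \<open>(y / 2) ^ 3\<close>, so that the real part of
    \<open>awg\<close> is at most half its modulus in the second case.\<close>
  then have "eventually (\<lambda>x::real. sinh x + x < y ^ 3 / 16) (at_right 0)"
    using y by (intro order_tendstoD) auto
  then obtain x0 where x0: "x0 > 0" "\<And>x. 0 < x \<Longrightarrow> x < x0 \<Longrightarrow> sinh x + x < y ^ 3 / 16"
    by (auto simp: eventually_at_right_field)
  define x1 where "x1 = min x0 1"
  \<comment> \<open>Two thirds of the margin \<open>pi / 3\<close> for the argument of
    \<open>awg\<close>.\<close>
  define m where "m = sin (2 * pi / 9)"
  have m: "m > 0" unfolding m_def by (intro sin_gt_zero) auto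
  define B where "B = root 3 (cosh 1 + 1 + 2 * pi)"
  define M where "M = max (y / (3 / 4 * y\<^sup>2)) (2 * B / (y\<^sup>2 * m))"
  show ?thesis
  proof
    show "x1 > 0" using x0 by (simp add: x1_def)
    fix x s :: real assume xs: "0 < x" "x < x1" "0 \<le> s" "s < 2 * pi"
    define z where "z = Complex x s"
    have z: "z \<in> hstrip" "z \<in> strip" using xs by (simp_all add: z_def hstrip_def strip_def)
    define Y where "Y = norm (awy z)"
    have Y3: "Y ^ 3 = norm (awg z)" using awy_cube[OF z(2)] by (simp add: Y_def flip: norm_power)
    show "(awy (Complex x s))\<^sup>2 \<noteq> of_real (y\<^sup>2) \<and> norm (awK y (Complex x s)) \<le> M"
    proof (cases "Y \<le> y / 2")
      case True
      have "y\<^sup>2 * (3 / 4) = y\<^sup>2 - (y / 2)\<^sup>2" by (simp add: power2_eq_square)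
      also have "\<dots> \<le> y\<^sup>2 - Y\<^sup>2" using True by (simp add: Y_def power_mono del: power_divide)
      also have "\<dots> \<le> norm ((awy z)\<^sup>2 - of_real (y\<^sup>2))"
        using norm_triangle_ineq2[of "of_real (y\<^sup>2)" "(awy z)\<^sup>2"]
        by (simp add: Y_def norm_power norm_minus_commute)
      finally have *: "y\<^sup>2 * (3 / 4) \<le> norm ((awy z)\<^sup>2 - of_real (y\<^sup>2))" .
      then have "norm (awK y z) \<le> y / (3 / 4 * y\<^sup>2)"
        unfolding awK_def norm_divide using True y
        by (intro frac_le) (auto simp: norm_mult Y_def)
      moreover have "y\<^sup>2 * (3 / 4) > 0" using y by simp
      then have "(awy z)\<^sup>2 \<noteq> of_real (y\<^sup>2)" using * by auto
      ultimately show ?thesis by (simp add: M_def z_def)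
    next
      case False
      have "(y / 2) ^ 3 \<le> Y ^ 3" using False y by (intro power_mono) auto
      then have G: "y ^ 3 / 8 \<le> norm (awg z)" by (simp add: Y3 power_divide)
      have "\<bar>Re (awg z)\<bar> \<le> \<bar>sinh x * cos s\<bar> + \<bar>x\<bar>" unfolding Re_awg by (simp add: z_def)
      also have "\<dots> \<le> sinh x * 1 + x"
        using xs by (simp only: abs_mult) (intro add_mono mult_mono, auto)
      also have "\<dots> \<le> y ^ 3 / 16" using x0(2)[of x] xs by (simp add: x1_def)
      also have "\<dots> \<le> norm (awg z) / 2" using G by simp
      finally have Re: "\<bar>Re (awg z)\<bar> \<le> norm (awg z) / 2" .
      define \<phi> where "\<phi> = Im (awL z)"
      have "y ^ 3 / 8 > 0" using y by simp
      then have gpos: "norm (awg z) > 0" using G by linarith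
      have "Im z > 0"
      proof (rule ccontr)
        assume "\<not> Im z > 0"
        then have "Im (awg z) = 0" using xs by (simp add: Im_awg z_def)
        then have "norm (awg z) = \<bar>Re (awg z)\<bar>" by (simp add: cmod_eq_Re)
        then show False using Re gpos by simp
      qed
      then have \<phi>: "0 < \<phi>" "\<phi> < 2 * pi" using awL_arg_upper[OF z(1)] by (simp_all add: \<phi>_def)
      have "Re (awg z) = norm (awg z) * cos \<phi>"
        by (simp add: Re_exp \<phi>_def flip: awL(1)[OF z(1)])
      then have "norm (awg z) * \<bar>cos \<phi>\<bar> \<le> norm (awg z) * (1 / 2)" using Re by (simp add: abs_mult)
      then have cos: "\<bar>cos \<phi>\<bar> \<le> 1 / 2" using gpos by (simp only: mult_le_cancel_left_pos)
      have lo: "\<phi> \<ge> pi / 3"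
      proof (rule ccontr)
        assume "\<not> \<phi> \<ge> pi / 3"
        then have "cos (pi / 3) < cos \<phi>" using \<phi> by (intro cos_monotone_0_pi) auto
        then show False using cos by (simp add: cos_60)
      qed
      have hi: "\<phi> \<le> 5 * pi / 3"
      proof (rule ccontr)
        assume "\<not> \<phi> \<le> 5 * pi / 3"
        then have "cos (pi / 3) < cos (2 * pi - \<phi>)" using \<phi> by (intro cos_monotone_0_pi) auto
        then show False using cos by (simp add: cos_60 cos_diff)
      qed
      have pol: "(awy z)\<^sup>2 = of_real (Y\<^sup>2) * cis (2 * \<phi> / 3)"
      proof -
        have "awy z = of_real Y * cis (\<phi> / 3)"
          unfolding Y_def awL(2)[OF z(1)] \<phi>_def using exp_eq_polar[of "awL z / 3"] by (simp add: norm_mult)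
        moreover have "(cis (\<phi> / 3))\<^sup>2 = cis (2 * \<phi> / 3)" by (simp add: power2_eq_square cis_mult)
        ultimately show ?thesis by (simp only: power_mult_distrib of_real_power)
      qed
      have "cis (2 * \<phi> / 3 - pi) = - cis (2 * \<phi> / 3)" by (simp add: cis.ctr complex_eq_iff cos_diff sin_diff)
      moreover have "of_real (y\<^sup>2) * of_real ((Y / y)\<^sup>2) = complex_of_real (Y\<^sup>2)"
        using y by (simp add: power_divide)
      ultimately have "(awy z)\<^sup>2 - of_real (y\<^sup>2) = - of_real (y\<^sup>2) * (1 + of_real ((Y / y)\<^sup>2) * cis (2 * \<phi> / 3 - pi))"
        unfolding pol by (simp add: algebra_simps del: of_real_power)
      then have "norm ((awy z)\<^sup>2 - of_real (y\<^sup>2)) = y\<^sup>2 * norm (1 + of_real ((Y / y)\<^sup>2) * cis (2 * \<phi> / 3 - pi))"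
        by (simp only: norm_mult norm_minus_cancel norm_of_real) simp
      moreover have "m \<le> norm (1 + of_real ((Y / y)\<^sup>2) * cis (2 * \<phi> / 3 - pi))"
        unfolding m_def
      proof (rule norm_one_plus_cis_ge)
        show "\<bar>2 * \<phi> / 3 - pi\<bar> \<le> pi - 2 * pi / 9" using lo hi pi_gt_zero by linarith
      qed auto
      ultimately have *: "y\<^sup>2 * m \<le> norm ((awy z)\<^sup>2 - of_real (y\<^sup>2))"
        by (simp add: mult_left_mono)
      moreover have "y\<^sup>2 * m > 0" using y m by simp
      then have "(awy z)\<^sup>2 \<noteq> of_real (y\<^sup>2)" using * by auto
      moreover have "Y \<le> B"
      proof -
        have "norm (sinh z) \<le> cosh x"
        proof -
          have "norm (sinh z) \<le> (norm (exp z) + norm (exp (- z))) / 2"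
            unfolding sinh_def using norm_triangle_ineq4[of "exp z" "exp (- z)"] by simp
          also have "\<dots> = cosh x" by (simp add: cosh_def z_def)
          finally show ?thesis .
        qed
        moreover have "cosh x \<le> cosh 1" using xs cosh_real_nonneg_le_iff[of x 1] by (simp add: x1_def)
        moreover have "norm z \<le> x + s" using cmod_le[of z] xs by (simp add: z_def)
        moreover have "norm (awg z) \<le> norm (sinh z) + norm z" unfolding awg_def by (rule norm_triangle_ineq4)
        ultimately have "Y ^ 3 \<le> cosh 1 + 1 + 2 * pi" using xs unfolding Y3 x1_def by linarith
        then have "root 3 (Y ^ 3) \<le> B" unfolding B_def by (intro real_root_le_mono) auto
        then show ?thesis by (simp add: odd_real_root_power_cancel)
      qed
      moreover have "0 \<le> B"
        unfolding B_def by (intro real_root_ge_zero add_nonneg_nonneg cosh_real_nonneg) auto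
      moreover from calculation have "norm (awK y z) \<le> 2 * B / (y\<^sup>2 * m)"
        unfolding awK_def norm_divide using m y
        by (intro frac_le) (auto simp: norm_mult Y_def)
      ultimately show ?thesis by (simp add: M_def z_def)
    qed
  qed
qed


section \<open>Boundary behaviour of the kernel\<close>

lemma awK_isCont:
  assumes "z \<in> strip" "(awy z)\<^sup>2 \<noteq> of_real (y\<^sup>2)"
  shows "isCont (awK y) z"
proof -
  have "isCont awy z"
    using awy_holomorphic assms open_strip by (metis continuous_on_eq_continuous_at holomorphic_on_imp_continuous_on)
  then show ?thesis unfolding awK_def using assms by (intro continuous_intros) auto
qed

lemma awK_imaginary_axis:
  assumes y: "y > 0" and s: "0 \<le> s" "s < 2 * pi"
  shows "isCont (awK y) (Complex 0 s)" "Re (awK y (Complex 0 s)) = 0"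
proof -
  define r where "r = root 3 (s - sin s)"
  have "Complex 0 s = \<i> * of_real s" by (simp add: complex_eq_iff)
  then have a: "awy (Complex 0 s) = \<i> * of_real r" using awy_imaginary[OF s] by (simp add: r_def)
  have sq: "(awy (Complex 0 s))\<^sup>2 = of_real (- (r\<^sup>2))" by (simp add: a power_mult_distrib)
  have "y\<^sup>2 > 0" "r\<^sup>2 \<ge> 0" using y by simp_all
  then have "- (r\<^sup>2) \<noteq> y\<^sup>2" by linarith
  then show "isCont (awK y) (Complex 0 s)"
    using s unfolding sq by (intro awK_isCont) (auto simp: strip_def sq simp del: of_real_power of_real_minus)
  have "awK y (Complex 0 s) = \<i> * of_real (2 * r / (- (r\<^sup>2) - y\<^sup>2))"
    by (simp only: awK_def sq) (simp add: a)
  then show "Re (awK y (Complex 0 s)) = 0" by (simp del: of_real_divide)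
qed

lemma awK_curve:
  assumes y: "y > 0" and x: "x > 0"
  shows "awK y (Complex x (bcurve x)) = - \<i> * of_real (2 * eta x / ((eta x)\<^sup>2 + y\<^sup>2))"
proof -
  have sq: "(awy (Complex x (bcurve x)))\<^sup>2 = of_real (- ((eta x)\<^sup>2))"
    by (simp add: awy_curve[OF x] power_mult_distrib)
  have e: "- ((eta x)\<^sup>2) - y\<^sup>2 = - ((eta x)\<^sup>2 + y\<^sup>2)" by simp
  have "awK y (Complex x (bcurve x)) = \<i> * of_real (2 * eta x / (- ((eta x)\<^sup>2) - y\<^sup>2))"
    by (simp only: awK_def sq) (simp add: awy_curve[OF x])
  also have "2 * eta x / (- ((eta x)\<^sup>2) - y\<^sup>2) = - (2 * eta x / ((eta x)\<^sup>2 + y\<^sup>2))"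
    unfolding e by (rule divide_minus_right)
  finally show ?thesis by (simp only: of_real_minus mult_minus_left mult_minus_right)
qed

text \<open>Existence is all that matters, as the value of the derivative drops out in
  \<open>stieltjes_identity\<close>.\<close>

lemma bcurve_has_derivative: "x > 0 \<Longrightarrow> \<exists>d. (bcurve has_real_derivative d) (at x)"
proof -
  assume x: "x > 0"
  have "((\<lambda>x. x / sinh x) has_real_derivative (sinh x - x * cosh x) / (sinh x)\<^sup>2) (at x)"
    using x by (auto intro!: derivative_eq_intros simp: power2_eq_square)
  from DERIV_arccos[THEN DERIV_chain2, OF _ _ this] x_div_sinh[OF x]
  obtain d where "((\<lambda>x. arccos (x / sinh x)) has_real_derivative d) (at x)" by force
  then have "(bcurve has_real_derivative 0 - d) (at x)"
    unfolding bcurve_def[abs_def] by (intro DERIV_diff) auto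
  then show ?thesis by blast
qed

lemma bcurve_isCont: "x > 0 \<Longrightarrow> isCont bcurve x"
  using bcurve_has_derivative DERIV_isCont by blast

lemma eta_isCont: "x > 0 \<Longrightarrow> isCont eta x"
  unfolding eta_def[abs_def] by (intro continuous_intros bcurve_isCont) auto

lemma has_vector_derivative_Complex:
  "((\<lambda>s. Complex x s) has_vector_derivative \<i>) (at s within A)"
  unfolding has_vector_derivative_complex_iff by (auto intro!: derivative_eq_intros)

lemma isCont_Complex_vertical: "isCont (\<lambda>s. Complex x s) s"
  by (rule has_vector_derivative_continuous[OF has_vector_derivative_Complex])

text \<open>Extended by 0 to the fixed interval from 0 to \<open>2 * pi\<close>, the integrands are
  bounded and tend to 0, since the kernel is imaginary on the imaginary axis. At
  \<open>s = 2 * pi\<close>, where the limit point leaves the strip, every extended integrand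
  already has the value 0.\<close>

lemma awK_vertical_integral_at_right_zero:
  assumes y: "y > 0"
  shows "((\<lambda>x. integral {0..bcurve x} (\<lambda>s. Re (awK y (Complex x s)))) \<longlongrightarrow> 0) (at_right 0)"
proof -
  obtain M x1 where x1: "x1 > 0" and
    M: "\<And>x s. 0 < x \<Longrightarrow> x < x1 \<Longrightarrow> 0 \<le> s \<Longrightarrow> s < 2 * pi \<Longrightarrow>
       (awy (Complex x s))\<^sup>2 \<noteq> of_real (y\<^sup>2) \<and> norm (awK y (Complex x s)) \<le> M"
    by (rule awK_bounded_near_axis[OF y]) blast
  show ?thesis
  proof (rule tendsto_at_right_sequentially[OF x1])
    fix S :: "nat \<Rightarrow> real"
    assume S: "\<And>n. 0 < S n" "\<And>n. S n < x1" and lim: "S \<longlonglongrightarrow> 0"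
    define f where "f = (\<lambda>k s. if s \<in> {0..bcurve (S k)} then Re (awK y (Complex (S k) s)) else 0)"
    have sub: "{0..bcurve (S k)} \<subseteq> {0..2 * pi}" for k using bcurve_bounds(2)[OF S(1), of k] by auto
    have cont: "continuous_on {0..bcurve (S k)} (\<lambda>s. Re (awK y (Complex (S k) s)))" for k
    proof (intro continuous_at_imp_continuous_on ballI)
      fix s assume s: "s \<in> {0..bcurve (S k)}"
      then have s': "0 \<le> s" "s < 2 * pi" using bcurve_bounds(2)[OF S(1), of k] by auto
      have "isCont (awK y) (Complex (S k) s)"
        using M[OF S s'] s' by (intro awK_isCont) (auto simp: strip_def)
      then have "isCont (\<lambda>s. awK y (Complex (S k) s)) s"
        by (rule isCont_o2[OF isCont_Complex_vertical])
      then show "isCont (\<lambda>s. Re (awK y (Complex (S k) s))) s" by (rule continuous_Re)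
    qed
    have hi: "(f k has_integral integral {0..bcurve (S k)} (\<lambda>s. Re (awK y (Complex (S k) s)))) {0..2 * pi}" for k
      unfolding f_def has_integral_restrict[OF sub]
      by (rule integrable_integral[OF integrable_continuous_real[OF cont]])
    have "(\<lambda>k. integral {0..2 * pi} (f k)) \<longlonglongrightarrow> integral {0..2 * pi} (\<lambda>_. 0 :: real)"
    proof (rule dominated_convergence(2)[where h = "\<lambda>_. \<bar>M\<bar>"])
      show "f k integrable_on {0..2 * pi}" for k using hi by (rule has_integral_integrable)
      show "norm (f k s) \<le> \<bar>M\<bar>" if "s \<in> {0..2 * pi}" for k s
      proof (cases "s \<in> {0..bcurve (S k)}")
        case True
        then have "norm (awK y (Complex (S k) s)) \<le> M"
          using M[OF S, of s] bcurve_bounds(2)[OF S(1), of k] by auto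
        then have "\<bar>Re (awK y (Complex (S k) s))\<bar> \<le> M"
          using abs_Re_le_cmod order.trans by blast
        then show ?thesis using True by (simp add: f_def)
      next
        case False
        then have "f k s = 0" unfolding f_def by (rule if_not_P)
        then show ?thesis by simp
      qed
      show "(\<lambda>k. f k s) \<longlonglongrightarrow> 0" if s: "s \<in> {0..2 * pi}" for s
      proof (cases "s < 2 * pi")
        case True
        have "(\<lambda>k. Complex (S k) s) \<longlonglongrightarrow> Complex 0 s"
          by (intro tendsto_Complex lim tendsto_const)
        then have "(\<lambda>k. Re (awK y (Complex (S k) s))) \<longlonglongrightarrow> Re (awK y (Complex 0 s))"
          using awK_imaginary_axis(1)[OF y, of s] s True
          by (intro tendsto_Re isCont_tendsto_compose[of _ "awK y"]) auto
        then have "(\<lambda>k. Re (awK y (Complex (S k) s))) \<longlonglongrightarrow> 0"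
          using awK_imaginary_axis(2)[OF y, of s] s True by simp
        then show ?thesis
          by (rule Lim_null_comparison[rotated, OF tendsto_rabs_zero]) (auto simp: f_def)
      next
        case False
        then have "f k s = 0" for k using bcurve_bounds(2)[OF S(1), of k] by (simp add: f_def)
        then show ?thesis by simp
      qed
    qed auto
    then show "(\<lambda>k. integral {0..bcurve (S k)} (\<lambda>s. Re (awK y (Complex (S k) s)))) \<longlonglongrightarrow> 0"
      by (simp add: integral_unique[OF hi])
  qed
qed

lemma norm_sinh_ge: "sinh \<bar>Re z\<bar> \<le> norm (sinh z)" for z :: complex
proof -
  have "\<bar>norm (exp z) - norm (exp (- z))\<bar> / 2 \<le> norm (sinh z)"
    unfolding sinh_def using norm_triangle_ineq3[of "exp z" "exp (- z)"] by simp
  moreover have "sinh \<bar>Re z\<bar> = \<bar>norm (exp z) - norm (exp (- z))\<bar> / 2"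
    by (cases "Re z \<ge> 0") (auto simp: sinh_def)
  ultimately show ?thesis by simp
qed

text \<open>With \<open>Y = norm (awy z) \<ge> 2 * y\<close> the denominator is at least
  \<open>3/4 * Y\<^sup>2\<close>, so the kernel is at most \<open>8 / (3 * Y)\<close>, rounded up to
  \<open>3 / Y\<close>. The lower bound for \<open>Y\<close> comes from the growth of
  \<open>sinh\<close>.\<close>

lemma awK_bound_far:
  assumes y: "y > 0" and x: "x > 0" "root 3 (sinh x - x - 2 * pi) \<ge> 2 * y" and s: "0 \<le> s" "s < 2 * pi"
  shows "norm (awK y (Complex x s)) \<le> 3 / root 3 (sinh x - x - 2 * pi)"
proof -
  define z where "z = Complex x s"
  define Y where "Y = norm (awy z)"
  define r where "r = root 3 (sinh x - x - 2 * pi)"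
  have z: "z \<in> strip" using s by (simp add: z_def strip_def)
  have "norm z \<le> x + 2 * pi" using cmod_le[of z] s x by (simp add: z_def)
  moreover have "norm (sinh z) - norm z \<le> norm (awg z)" unfolding awg_def by (rule norm_triangle_ineq2)
  moreover have "sinh x \<le> norm (sinh z)" using norm_sinh_ge[of z] x by (simp add: z_def)
  ultimately have "sinh x - x - 2 * pi \<le> Y ^ 3"
    using awy_cube[OF z] by (simp add: Y_def flip: norm_power)
  then have "r \<le> root 3 (Y ^ 3)" unfolding r_def by (intro real_root_le_mono) auto
  then have rY: "r \<le> Y" by (simp add: odd_real_root_power_cancel)
  have r2: "2 * y \<le> r" using x by (simp add: r_def)
  then have "y\<^sup>2 \<le> (Y / 2)\<^sup>2" using rY y by (intro power_mono) auto
  moreover have Y0: "Y * Y > 0" using rY r2 y by simp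
  ultimately have "Y * Y * (3 / 4) \<le> Y\<^sup>2 - y\<^sup>2" by (simp add: power2_eq_square)
  also have "\<dots> \<le> norm ((awy z)\<^sup>2 - of_real (y\<^sup>2))"
    using norm_triangle_ineq2[of "(awy z)\<^sup>2" "of_real (y\<^sup>2)"] by (simp add: Y_def norm_power)
  finally have "norm (awK y z) \<le> 2 * Y / (Y * Y * (3 / 4))"
    unfolding awK_def norm_divide using Y0 by (intro frac_le) (auto simp: norm_mult Y_def)
  also have "\<dots> \<le> 3 / Y" using rY r2 y by (simp add: field_simps)
  also have "\<dots> \<le> 3 / r" using rY r2 y by (intro divide_left_mono) auto
  finally show ?thesis by (simp add: z_def r_def)
qed

text \<open>A primitive \<open>Psi\<close> of the kernel replaces the closed contour. On the real
  axis \<open>Im Psi\<close> is \<open>c * pi\<close> to the left of \<open>t\<close> and 0 to the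
  right. The vertical integrals vanish in the limit at both ends, so on the curve
  \<open>Im Psi\<close> runs from \<open>c * pi\<close> to 0, and the integral of its derivative is
  the claim.\<close>

theorem stieltjes_identity:
  assumes t: "t > 0"
  defines "y \<equiv> awg_root t" and "c \<equiv> 3 * (awg_root t)\<^sup>2 / (cosh t - 1)"
  shows "set_integrable lborel {0<..} (\<lambda>x. 2 * eta x / ((eta x)\<^sup>2 + y\<^sup>2))"
    and "(LINT x:{0<..}|lborel. 2 * eta x / ((eta x)\<^sup>2 + y\<^sup>2)) = pi * c"
proof -
  have y: "y > 0" unfolding y_def by (rule awg_root_pos[OF t])
  obtain P where
    P: "\<And>z. z \<in> hstrip \<Longrightarrow> z \<noteq> of_real t \<Longrightarrow>
       (P has_field_derivative awK y z - of_real c / (z - of_real t)) (at z)"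
    and Pre: "\<And>x. x > 0 \<Longrightarrow> Im (P (of_real x)) = 0"
    unfolding y_def c_def by (rule awK_decomposition[OF t]) blast
  \<comment> \<open>The factor \<open>- \<i>\<close> turns the cut of the logarithm to the ray going
    down from \<open>t\<close>, away from the closed upper half-plane; adding
    \<open>\<i> * pi / 2\<close> restores the branch of the logarithm of \<open>z - t\<close> that
    is real for real \<open>z > t\<close>.\<close>
  define Psi where "Psi = (\<lambda>z. of_real c * (Ln (- \<i> * (z - of_real t)) + \<i> * of_real (pi / 2)) + P z)"
  have dPsi: "(Psi has_field_derivative awK y z) (at z)"
    if z: "z \<in> hstrip" "Im z \<ge> 0" "z \<noteq> of_real t" for z
  proof -
    have nn: "- \<i> * (z - of_real t) \<notin> \<real>\<^sub>\<le>\<^sub>0"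
    proof
      assume "- \<i> * (z - of_real t) \<in> \<real>\<^sub>\<le>\<^sub>0"
      then have "Im z \<le> 0" "Re z = t" by (auto simp: complex_nonpos_Reals_iff)
      then show False using z by (simp add: complex_eq_iff)
    qed
    have "((\<lambda>z. Ln (- \<i> * (z - of_real t))) has_field_derivative
            inverse (- \<i> * (z - of_real t)) * (- \<i> * (1 - 0))) (at z)"
      by (rule DERIV_chain2[where f = Ln and g = "\<lambda>z. - \<i> * (z - of_real t)", OF has_field_derivative_Ln[OF nn]])
        (intro DERIV_cmult DERIV_diff DERIV_ident DERIV_const)
    moreover have "inverse (- \<i> * (z - of_real t)) * (- \<i> * (1 - 0)) = 1 / (z - of_real t)"
      using z by (simp add: field_simps)
    ultimately have "((\<lambda>z. Ln (- \<i> * (z - of_real t))) has_field_derivative 1 / (z - of_real t)) (at z)"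
      by simp
    then have "(Psi has_field_derivative (of_real c * (1 / (z - of_real t) + 0) + (awK y z - of_real c / (z - of_real t)))) (at z)"
      unfolding Psi_def by (intro DERIV_add DERIV_cmult P DERIV_const z)
    then show ?thesis by simp
  qed
  have Psi_real: "Im (Psi (of_real x)) = (if x < t then c * pi else 0)" if "x > 0" "x \<noteq> t" for x
  proof -
    have "- \<i> * (of_real x - of_real t) = \<i> * complex_of_real (t - x)" by (simp add: algebra_simps)
    moreover have "Im (Ln (\<i> * complex_of_real (t - x))) = (if x < t then pi / 2 else - (pi / 2))"
    proof (cases "x < t")
      case True
      have "Ln (of_real (t - x) * \<i>) = of_real (ln (t - x)) + Ln \<i>"
        using Ln_times_of_real[of "t - x" \<i>] Ln_of_real[of "t - x"] True by simp
      then show ?thesis using True by (simp add: mult.commute)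
    next
      case False
      have "\<i> * complex_of_real (t - x) = of_real (x - t) * (- \<i>)" by (simp add: algebra_simps)
      moreover have "Ln (of_real (x - t) * (- \<i>)) = of_real (ln (x - t)) + Ln (- \<i>)"
        using Ln_times_of_real[of "x - t" "- \<i>"] Ln_of_real[of "x - t"] False that by simp
      ultimately show ?thesis using False by (simp del: mult_minus_right)
    qed
    ultimately show ?thesis using Pre[OF that(1)] by (simp add: Psi_def)
  qed
  have on_line: "Complex x s \<in> hstrip" "Im (Complex x s) \<ge> 0"
    if "x > 0" "s \<in> {0..bcurve x}" for x s
    using that bcurve_bounds(2)[OF that(1)] by (auto simp: hstrip_def)
  have vertical: "((\<lambda>s. Re (awK y (Complex x s))) has_integral
      (Im (Psi (Complex x (bcurve x))) - (if x < t then c * pi else 0))) {0..bcurve x}"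
    if x: "x > 0" "x \<noteq> t" for x
  proof -
    have b: "0 \<le> bcurve x" using bcurve_bounds(1)[OF x(1)] pi_gt_zero by linarith
    have "((\<lambda>s. Re (awK y (Complex x s))) has_integral
       (Im (Psi (Complex x (bcurve x))) - Im (Psi (Complex x 0)))) {0..bcurve x}"
    proof (rule fundamental_theorem_of_calculus[OF b])
      fix s assume s: "s \<in> {0..bcurve x}"
      have "((Psi \<circ> Complex x) has_vector_derivative \<i> * awK y (Complex x s)) (at s)"
        using x on_line[OF x(1) s]
        by (intro field_vector_diff_chain_at[OF has_vector_derivative_Complex] dPsi) (auto simp: complex_eq_iff)
      from has_field_derivative_Im[OF this]
      show "((\<lambda>s. Im (Psi (Complex x s))) has_vector_derivative Re (awK y (Complex x s))) (at s within {0..bcurve x})"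
        by (simp add: o_def has_real_derivative_iff_has_vector_derivative has_vector_derivative_at_within)
    qed
    moreover have "Complex x 0 = of_real x" by (simp add: complex_of_real_def)
    ultimately show ?thesis using Psi_real[OF x] by simp
  qed
  define F where "F = (\<lambda>x. - Im (Psi (Complex x (bcurve x))))"
  define f where "f = (\<lambda>x. 2 * eta x / ((eta x)\<^sup>2 + y\<^sup>2))"
  have F_eq: "F x = - (if x < t then c * pi else 0) - integral {0..bcurve x} (\<lambda>s. Re (awK y (Complex x s)))"
    if "x > 0" "x \<noteq> t" for x
    using integral_unique[OF vertical[OF that]] by (simp add: F_def)
  have ypos: "(eta x)\<^sup>2 + y\<^sup>2 > 0" for x using y by (simp add: add_nonneg_pos)
  \<comment> \<open>With \<open>awK = - \<i> * f x\<close> on the curve, the imaginary part of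
    \<open>(1 + \<i> * d) * awK\<close> is \<open>- f x\<close> whatever the slope \<open>d\<close>
    is.\<close>
  have dF: "(F has_real_derivative f x) (at x)" if x: "x > 0" for x
  proof -
    obtain d where d: "(bcurve has_real_derivative d) (at x)" using bcurve_has_derivative[OF x] by blast
    have b: "0 < bcurve x" using bcurve_bounds(1)[OF x] pi_gt_zero by linarith
    have g: "((\<lambda>x. Complex x (bcurve x)) has_vector_derivative Complex 1 d) (at x)"
      unfolding has_vector_derivative_complex_iff using d by simp
    have "((Psi \<circ> (\<lambda>x. Complex x (bcurve x))) has_vector_derivative Complex 1 d * awK y (Complex x (bcurve x))) (at x)"
      using b on_line[OF x, of "bcurve x"]
      by (intro field_vector_diff_chain_at[OF g] dPsi) (auto simp: complex_eq_iff)
    from DERIV_minus[OF has_field_derivative_Im[OF this]]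
    show ?thesis by (simp add: F_def f_def o_def awK_curve[OF y x] del: of_real_divide)
  qed
  have lim0: "(F \<longlongrightarrow> - (c * pi)) (at_right 0)"
  proof -
    have "((\<lambda>x. - (c * pi) - integral {0..bcurve x} (\<lambda>s. Re (awK y (Complex x s)))) \<longlongrightarrow> - (c * pi) - 0) (at_right 0)"
      by (intro tendsto_intros awK_vertical_integral_at_right_zero[OF y])
    moreover have "eventually (\<lambda>x. x \<in> {0<..<t}) (at_right 0)" using t by (rule eventually_at_right_real)
    then have "eventually (\<lambda>x. - (c * pi) - integral {0..bcurve x} (\<lambda>s. Re (awK y (Complex x s))) = F x) (at_right 0)"
      by eventually_elim (simp add: F_eq)
    ultimately show ?thesis by (simp add: Lim_transform_eventually)
  qed
  have rtop: "filterlim (\<lambda>x. root 3 (sinh x - x - 2 * pi)) at_top at_top" by real_asymp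
  have liminf: "(F \<longlongrightarrow> 0) at_top"
  proof (rule Lim_null_comparison)
    have "((\<lambda>x. 3 / root 3 (sinh x - x - 2 * pi)) \<longlongrightarrow> 0) at_top"
      by (rule real_tendsto_divide_at_top[OF tendsto_const rtop])
    then show "((\<lambda>x. 3 / root 3 (sinh x - x - 2 * pi) * (2 * pi)) \<longlongrightarrow> 0) at_top"
      by (rule tendsto_mult_left_zero)
    have "eventually (\<lambda>x. root 3 (sinh x - x - 2 * pi) \<ge> 2 * y) at_top"
      using rtop by (simp add: filterlim_at_top)
    moreover have "eventually (\<lambda>x. x > t) at_top" by (rule eventually_gt_at_top)
    ultimately show "eventually (\<lambda>x. norm (F x) \<le> 3 / root 3 (sinh x - x - 2 * pi) * (2 * pi)) at_top"
    proof eventually_elim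
      case (elim x)
      define r where "r = 3 / root 3 (sinh x - x - 2 * pi)"
      have x: "x > 0" using elim t by simp
      have "root 3 (sinh x - x - 2 * pi) > 0" using elim y by linarith
      then have r: "r \<ge> 0" unfolding r_def by (simp only: divide_nonneg_pos)
      have b: "0 \<le> bcurve x" using bcurve_bounds(1)[OF x] pi_gt_zero by linarith
      have "((\<lambda>s. Re (awK y (Complex x s))) has_integral - F x) {0..bcurve x}"
        using vertical[OF x] elim by (simp add: F_def)
      then have "norm (- F x) \<le> r * measure lborel {0..bcurve x}"
      proof (rule has_integral_bound_real[OF r finite.emptyI])
        fix s assume s: "s \<in> {0..bcurve x} - {}"
        then have "norm (awK y (Complex x s)) \<le> r"
          unfolding r_def using elim bcurve_bounds(2)[OF x] by (intro awK_bound_far y x) auto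
        then show "norm (Re (awK y (Complex x s))) \<le> r"
          using abs_Re_le_cmod[of "awK y (Complex x s)"] by simp
      qed
      then have "norm (F x) \<le> r * bcurve x" using b by simp
      also have "\<dots> \<le> r * (2 * pi)" using bcurve_bounds(2)[OF x] r by (intro mult_left_mono) auto
      finally show ?case by (simp only: r_def)
    qed
  qed
  have fcont: "isCont f x" if "x > 0" for x
    unfolding f_def using ypos[of x] by (intro continuous_intros eta_isCont that) auto
  have fpos: "0 \<le> f x" if "x > 0" for x
    unfolding f_def using ypos[of x] eta_gt_one[OF that] by (intro divide_nonneg_pos) auto
  \<comment> \<open>As the integrand is nonnegative, the two limits of \<open>F\<close> give
    integrability together with the value.\<close>
  have "((F \<circ> real_of_ereal) \<longlongrightarrow> - (c * pi)) (at_right 0)"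
    unfolding zero_ereal_def ereal_tendsto_simps by (rule lim0)
  moreover have "((F \<circ> real_of_ereal) \<longlongrightarrow> 0) (at_left \<infinity>)"
    unfolding ereal_tendsto_simps by (rule liminf)
  ultimately have "set_integrable lborel (einterval 0 \<infinity>) f" "(LBINT x=0..\<infinity>. f x) = 0 - (- (c * pi))"
    using dF fcont fpos interval_integral_FTC_nonneg[of 0 \<infinity> F f "- (c * pi)" 0] by auto
  then show "set_integrable lborel {0<..} (\<lambda>x. 2 * eta x / ((eta x)\<^sup>2 + y\<^sup>2))"
    and "(LINT x:{0<..}|lborel. 2 * eta x / ((eta x)\<^sup>2 + y\<^sup>2)) = pi * c"
    unfolding f_def by (simp_all add: zero_ereal_def interval_lebesgue_integral_0_infty[unfolded zero_ereal_def])
qed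


subsection \<open>Taylor expansion of \<open>dt/dy\<close>\<close>

text \<open>A restricted space, not an indicator factor: pointwise hypotheses such as those of
  \<open>holomorphic_on_parametric_integral\<close> then concern positive \<open>x\<close>
  only.\<close>

definition pos_lborel :: "real measure" where "pos_lborel = restrict_space lborel {0<..}"

lemma space_pos_lborel [simp]: "space pos_lborel = {0<..}"
  by (simp add: pos_lborel_def space_restrict_space)

lemma integrable_pos_lborel_iff:
  "integrable pos_lborel f \<longleftrightarrow> set_integrable lborel {0<..} f"
  for f :: "real \<Rightarrow> 'b :: {banach, second_countable_topology}"
  by (simp add: pos_lborel_def integrable_restrict_space set_integrable_def)

lemma integral_pos_lborel:
  "integral\<^sup>L pos_lborel f = (LINT x:{0<..}|lborel. f x)"
  for f :: "real \<Rightarrow> 'b :: {banach, second_countable_topology}"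
  by (simp add: pos_lborel_def integral_restrict_space set_lebesgue_integral_def)

lemma borel_measurable_pos_lborel:
  "continuous_on {0<..} f \<Longrightarrow> f \<in> borel_measurable pos_lborel"
  for f :: "real \<Rightarrow> 'b :: topological_space"
  unfolding pos_lborel_def
  by (subst measurable_cong_sets[OF sets_restrict_space_cong[OF sets_lborel] refl])
    (rule borel_measurable_continuous_on_restrict)

text \<open>Equality would force the positive difference to vanish almost everywhere on a space of
  nonzero measure. This provides the strict inequalities for \<Xi>.\<close>

lemma integral_pos_lborel_less:
  fixes f g :: "real \<Rightarrow> real"
  assumes "integrable pos_lborel f" "integrable pos_lborel g" "\<And>x. x > 0 \<Longrightarrow> f x < g x"
  shows "integral\<^sup>L pos_lborel f < integral\<^sup>L pos_lborel g"
proof -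
  have "emeasure pos_lborel (space pos_lborel) = emeasure lborel {0::real<..}"
    by (simp add: pos_lborel_def emeasure_restrict_space space_restrict_space)
  moreover have "emeasure lborel {0::real<..<1} \<le> emeasure lborel {0::real<..}"
    by (intro emeasure_mono) auto
  ultimately have nz: "emeasure pos_lborel (space pos_lborel) \<noteq> 0" by auto
  have int: "integrable pos_lborel (\<lambda>x. g x - f x)" using assms by simp
  have "integral\<^sup>L pos_lborel (\<lambda>x. g x - f x) \<noteq> 0"
  proof
    assume "integral\<^sup>L pos_lborel (\<lambda>x. g x - f x) = 0"
    then have "AE x in pos_lborel. g x - f x = 0"
      using assms(3) by (subst (asm) integral_nonneg_eq_0_iff_AE[OF int]) (auto intro!: AE_I2 less_imp_le)
    moreover have "AE x in pos_lborel. g x - f x \<noteq> 0"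
      using assms(3) by (intro AE_I2) force
    ultimately have "AE x in pos_lborel. \<not> True" by eventually_elim simp
    then have "emeasure pos_lborel {x \<in> space pos_lborel. True} = 0" by (rule emeasure_eq_0_AE)
    with nz show False by (simp add: greaterThan_def)
  qed
  moreover have "integral\<^sup>L pos_lborel (\<lambda>x. g x - f x) \<ge> 0"
    using assms(3) by (intro integral_nonneg_AE AE_I2) (auto intro: less_imp_le)
  ultimately show ?thesis using assms by simp
qed

lemma eta_continuous_on: "continuous_on {0<..} eta"
  by (intro continuous_at_imp_continuous_on) (auto intro: eta_isCont)

text \<open>One instance of the Stieltjes integral, at \<open>t = 1\<close>, serves as majorant:
  \<open>eta x > 1\<close> gives \<open>(eta x)\<^sup>2 + y\<^sup>2 \<le> (1 + y\<^sup>2) * (eta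
  x)\<^sup>2\<close>.\<close>

lemma integrable_inverse_eta: "integrable pos_lborel (\<lambda>x. 1 / eta x ^ Suc k)"
proof (rule Bochner_Integration.integrable_bound)
  define y where "y = awg_root 1"
  have y: "y > 0" unfolding y_def by (rule awg_root_pos) simp
  show "integrable pos_lborel (\<lambda>x. (1 + y\<^sup>2) / 2 * (2 * eta x / ((eta x)\<^sup>2 + y\<^sup>2)))"
    using stieltjes_identity(1)[of 1]
    unfolding y_def by (intro integrable_mult_right) (simp add: integrable_pos_lborel_iff)
  show "(\<lambda>x. 1 / eta x ^ Suc k) \<in> borel_measurable pos_lborel"
    using eta_gt_one by (intro borel_measurable_pos_lborel continuous_intros eta_continuous_on) force
  show "AE x in pos_lborel. norm (1 / eta x ^ Suc k) \<le> norm ((1 + y\<^sup>2) / 2 * (2 * eta x / ((eta x)\<^sup>2 + y\<^sup>2)))"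
  proof (rule AE_I2)
    fix x assume "x \<in> space pos_lborel"
    then have e: "eta x > 1" using eta_gt_one by simp
    have "eta x ^ 1 \<le> eta x ^ Suc k" using e by (intro power_increasing) auto
    then have "1 / eta x ^ Suc k \<le> 1 / eta x" using e by (intro divide_left_mono) auto
    also have "\<dots> = (1 + y\<^sup>2) / 2 * (2 * eta x / ((1 + y\<^sup>2) * (eta x)\<^sup>2))"
    proof -
      define d where "d = 1 + y\<^sup>2"
      have "d > 0" unfolding d_def by (simp add: add_pos_nonneg)
      then show ?thesis unfolding d_def[symmetric] using e by (simp add: field_simps power2_eq_square)
    qed
    also have "\<dots> \<le> (1 + y\<^sup>2) / 2 * (2 * eta x / ((eta x)\<^sup>2 + y\<^sup>2))"
    proof (intro mult_left_mono divide_left_mono)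
      have "y\<^sup>2 * 1 \<le> y\<^sup>2 * (eta x)\<^sup>2" using e by (intro mult_left_mono one_le_power) auto
      then show "(eta x)\<^sup>2 + y\<^sup>2 \<le> (1 + y\<^sup>2) * (eta x)\<^sup>2" by (simp add: algebra_simps)
      show "0 < ((1 + y\<^sup>2) * (eta x)\<^sup>2) * ((eta x)\<^sup>2 + y\<^sup>2)"
        using e by (intro mult_pos_pos add_pos_nonneg) auto
    qed (use e in auto)
    finally show "norm (1 / eta x ^ Suc k) \<le> norm ((1 + y\<^sup>2) / 2 * (2 * eta x / ((eta x)\<^sup>2 + y\<^sup>2)))"
      using e by simp
  qed
qed

section \<open>Moments of \<open>eta\<close> and the Taylor remainders of dt/dy\<close>

text \<open>The absolute value of the coefficient, as \<open>aw_coeff_eq\<close> will show.\<close>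

definition aw_moment :: "nat \<Rightarrow> real" where
  "aw_moment n = 2 / pi * (\<integral>x. 1 / eta x ^ (2 * n + 1) \<partial>pos_lborel)"

abbreviation awJ_kernel :: "nat \<Rightarrow> complex \<Rightarrow> real \<Rightarrow> complex" where
  "awJ_kernel k z x \<equiv> 1 / of_real (eta x ^ k) / (1 + (z / of_real (eta x))\<^sup>2)"

text \<open>\<open>awJ 0\<close> is \<open>dt/dy\<close> as a function of \<open>y\<close>; \<open>(-1)^n z\<^bsup>2n\<^esup> awJ n z\<close> is its Taylor remainder.\<close>

definition awJ :: "nat \<Rightarrow> complex \<Rightarrow> complex" where
  "awJ n z = of_real (2 / pi) *
     (\<integral>x. awJ_kernel (2 * n + 1) z x \<partial>pos_lborel)"

text \<open>The half-plane contains the rays of integration, the disc the neighbourhood of 0 for the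
  Taylor expansion; the kernel has no pole in either.\<close>

definition awdom :: "complex set" where "awdom = {z. 0 < Re z} \<union> ball 0 1"

lemma open_awdom: "open awdom"
  unfolding awdom_def by (intro open_Un open_halfspace_Re_gt open_ball)

text \<open>The point is uniformity in \<open>x\<close>. In the disc, \<open>z / eta x\<close> is no
  larger than \<open>z\<close>. In the half-plane, dividing by \<open>eta x\<close> keeps the
  argument, which by compactness of the closed disc stays away from \<open>pi / 2\<close> in
  modulus, so that its double stays away from \<open>pi\<close>.\<close>

lemma awdom_local_bound:
  assumes "z0 \<in> awdom"
  obtains r \<kappa> where "r > 0" "\<kappa> > 0" "cball z0 r \<subseteq> awdom"
    "\<And>z x. z \<in> cball z0 r \<Longrightarrow> x > 0 \<Longrightarrow> \<kappa> \<le> norm (1 + (z / of_real (eta x))\<^sup>2)"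
proof (cases "z0 \<in> ball 0 1")
  case True
  define r where "r = (1 - norm z0) / 2"
  have r: "r > 0" using True by (simp add: r_def)
  have b: "norm z \<le> 1 - r" if "z \<in> cball z0 r" for z
  proof -
    have "norm (z - z0) \<le> r" using that by (simp add: dist_norm norm_minus_commute)
    then have "norm z \<le> norm z0 + r" using norm_triangle_sub[of z z0] by simp
    then show ?thesis by (simp add: r_def field_simps)
  qed
  have r1: "r \<le> 1" proof -
    have "0 \<le> norm z0" by (rule norm_ge_zero)
    then have "- 1 \<le> norm z0" by (rule order.trans[rotated]) simp
    then show ?thesis unfolding r_def by simp
  qed
  show ?thesis
  proof (rule that[of r r])
    show "cball z0 r \<subseteq> awdom" using b r by (force simp: awdom_def)
    fix z x assume z: "z \<in> cball z0 r" and x: "(x::real) > 0"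
    have e: "eta x > 1" by (rule eta_gt_one[OF x])
    define w where "w = z / of_real (eta x)"
    have "norm w \<le> norm z / 1" unfolding w_def norm_divide using e by (intro divide_left_mono) auto
    also have "\<dots> \<le> 1 - r" using b[OF z] by simp
    finally have w: "norm w \<le> 1 - r" .
    have "norm w * norm w \<le> (1 - r) * 1" using w r r1 by (intro mult_mono) auto
    then have "r \<le> norm (1 :: complex) - norm (w\<^sup>2)" by (simp add: norm_mult power2_eq_square)
    also have "\<dots> \<le> norm (1 + w\<^sup>2)" by (rule norm_diff_ineq)
    finally show "r \<le> norm (1 + (z / of_real (eta x))\<^sup>2)" by (simp add: w_def)
  qed (use r in auto)
next
  case False
  then have "z0 \<in> {z. 0 < Re z}" using assms by (simp add: awdom_def)
  then obtain r where r: "r > 0" "cball z0 r \<subseteq> {z. 0 < Re z}"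
    using open_halfspace_Re_gt open_contains_cball_eq by blast
  have "\<exists>z\<in>cball z0 r. \<forall>z'\<in>cball z0 r. \<bar>Im (Ln z')\<bar> \<le> \<bar>Im (Ln z)\<bar>"
    using r by (intro continuous_attains_sup continuous_intros) (auto simp: complex_nonpos_Reals_iff)
  then obtain z1 where z1: "z1 \<in> cball z0 r" "\<And>z. z \<in> cball z0 r \<Longrightarrow> \<bar>Im (Ln z)\<bar> \<le> \<bar>Im (Ln z1)\<bar>" by blast
  define \<delta> where "\<delta> = min (pi - 2 * \<bar>Im (Ln z1)\<bar>) (pi / 2)"
  have "\<bar>Im (Ln z1)\<bar> < pi / 2" using z1(1) r(2) by (intro Re_Ln_pos_lt_imp) auto
  then have \<delta>: "0 < \<delta>" "\<delta> \<le> pi / 2" by (auto simp: \<delta>_def min_def)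
  show ?thesis
  proof (rule that[of r "sin \<delta>"])
    show "cball z0 r \<subseteq> awdom" using r by (auto simp: awdom_def)
    fix z x assume z: "z \<in> cball z0 r"
    then have "0 < Re z" using r(2) by blast
    then have "z \<noteq> 0" by auto
    then have "z = of_real (norm z) * cis (Im (Ln z))" using exp_eq_polar[of "Ln z"] by simp
    then have "(z / of_real (eta x))\<^sup>2 = (of_real (norm z / eta x) * cis (Im (Ln z)))\<^sup>2" by simp
    also have "\<dots> = of_real ((norm z / eta x)\<^sup>2) * cis (2 * Im (Ln z))"
      unfolding power_mult_distrib by (simp add: power2_eq_square cis_mult)
    finally have e: "(z / of_real (eta x))\<^sup>2 = of_real ((norm z / eta x)\<^sup>2) * cis (2 * Im (Ln z))" .
    show "sin \<delta> \<le> norm (1 + (z / of_real (eta x))\<^sup>2)"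
      unfolding e
    proof (rule norm_one_plus_cis_ge)
      show "\<bar>2 * Im (Ln z)\<bar> \<le> pi - \<delta>" using z1(2)[OF z] by (simp add: \<delta>_def abs_mult min_def)
    qed (use \<delta> in auto)
  qed (use r \<delta> in \<open>auto intro: sin_gt_zero\<close>)
qed

lemma awJ_integrand_nonzero:
  assumes "z \<in> awdom" "x > 0" shows "1 + (z / of_real (eta x))\<^sup>2 \<noteq> 0"
  using awdom_local_bound[OF assms(1)] assms(2)
  by (metis centre_in_cball less_imp_le norm_zero not_less)

lemma awJ_integrand_measurable:
  assumes "z \<in> awdom"
  shows "(\<lambda>x. awJ_kernel k z x) \<in> borel_measurable pos_lborel"
  using eta_gt_one awJ_integrand_nonzero[OF assms]
  by (intro borel_measurable_pos_lborel continuous_intros eta_continuous_on) force+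

lemma awJ_integrand_bound:
  assumes "\<kappa> > 0" "x > 0" "\<kappa> \<le> norm (1 + (z / of_real (eta x))\<^sup>2)"
  shows "norm (awJ_kernel k z x) \<le> 1 / \<kappa> * (1 / eta x ^ k)"
proof -
  have e: "eta x > 1" by (rule eta_gt_one[OF assms(2)])
  have "norm (awJ_kernel k z x)
      = (1 / eta x ^ k) / norm (1 + (z / of_real (eta x))\<^sup>2)"
    using e by (simp add: norm_divide norm_power norm_mult)
  also have "\<dots> \<le> (1 / eta x ^ k) / \<kappa>"
    using assms e by (intro divide_left_mono mult_pos_pos) auto
  finally show ?thesis by (simp only: divide_divide_eq_left mult.commute times_divide_eq_right mult_1_right)
qed

lemma integrable_awJ_majorant: "integrable pos_lborel (\<lambda>x. C * (1 / eta x ^ (2 * n + 1)))"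
  by (intro integrable_mult_right) (use integrable_inverse_eta[of "2 * n"] in simp)

lemma awJ_integrable:
  assumes "z \<in> awdom"
  shows "integrable pos_lborel (awJ_kernel (2 * n + 1) z)"
proof -
  obtain r \<kappa> where \<kappa>: "r > 0" "\<kappa> > 0"
    "\<And>z' x. z' \<in> cball z r \<Longrightarrow> x > 0 \<Longrightarrow> \<kappa> \<le> norm (1 + (z' / of_real (eta x))\<^sup>2)"
    by (rule awdom_local_bound[OF assms]) blast
  show ?thesis
  proof (rule Bochner_Integration.integrable_bound[OF integrable_awJ_majorant])
    show "AE x in pos_lborel. norm (awJ_kernel (2 * n + 1) z x) \<le> norm (1 / \<kappa> * (1 / eta x ^ (2 * n + 1)))"
    proof (rule AE_I2)
      fix x assume "x \<in> space pos_lborel"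
      then show "norm (awJ_kernel (2 * n + 1) z x) \<le> norm (1 / \<kappa> * (1 / eta x ^ (2 * n + 1)))"
        using \<kappa> by (intro order.trans[OF awJ_integrand_bound[OF \<kappa>(2)]])
          (auto simp only: real_norm_def abs_ge_self space_pos_lborel greaterThan_iff centre_in_cball less_imp_le)
    qed
  qed (rule awJ_integrand_measurable[OF assms])
qed

lemma awJ_holomorphic: "awJ n holomorphic_on awdom"
proof -
  have "(\<lambda>z. \<integral>x. awJ_kernel (2 * n + 1) z x \<partial>pos_lborel) holomorphic_on awdom"
  proof (rule holomorphic_on_parametric_integral[OF open_awdom])
    fix x assume "x \<in> space pos_lborel"
    then have x: "x > 0" by simp
    then show "(\<lambda>z. awJ_kernel (2 * n + 1) z x) holomorphic_on awdom"
      using awJ_integrand_nonzero[OF _ x] eta_gt_one[OF x] by (intro holomorphic_intros) auto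
  next
    fix z0 assume "z0 \<in> awdom"
    then obtain r \<kappa> where \<kappa>: "r > 0" "\<kappa> > 0" "cball z0 r \<subseteq> awdom"
      "\<And>z x. z \<in> cball z0 r \<Longrightarrow> x > 0 \<Longrightarrow> \<kappa> \<le> norm (1 + (z / of_real (eta x))\<^sup>2)"
      by (rule awdom_local_bound) blast
    have "integrable pos_lborel (\<lambda>x. 1 / \<kappa> * (1 / eta x ^ (2 * n + 1)))"
      by (rule integrable_awJ_majorant)
    moreover have "\<forall>z\<in>cball z0 r. \<forall>x\<in>space pos_lborel.
        norm (awJ_kernel (2 * n + 1) z x) \<le> 1 / \<kappa> * (1 / eta x ^ (2 * n + 1))"
      using \<kappa> by (intro ballI awJ_integrand_bound) auto
    ultimately show "\<exists>r>0. \<exists>G. cball z0 r \<subseteq> awdom \<and> integrable pos_lborel G \<and>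
        (\<forall>z\<in>cball z0 r. \<forall>x\<in>space pos_lborel.
           norm (awJ_kernel (2 * n + 1) z x) \<le> G x)"
      using \<kappa>(1,3) by blast
  qed (rule awJ_integrand_measurable)
  then show ?thesis unfolding awJ_def[abs_def] by (intro holomorphic_intros)
qed

lemma norm_awJ_le:
  assumes z: "z \<in> awdom" and \<kappa>: "\<kappa> > 0" "\<And>x. x > 0 \<Longrightarrow> \<kappa> \<le> norm (1 + (z / of_real (eta x))\<^sup>2)"
  shows "norm (awJ n z) \<le> aw_moment n / \<kappa>"
proof -
  have "norm (awJ n z) = 2 / pi * norm (\<integral>x. awJ_kernel (2 * n + 1) z x \<partial>pos_lborel)"
    unfolding awJ_def norm_mult norm_of_real by simp
  also have "norm (\<integral>x. awJ_kernel (2 * n + 1) z x \<partial>pos_lborel)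
     \<le> (\<integral>x. 1 / \<kappa> * (1 / eta x ^ (2 * n + 1)) \<partial>pos_lborel)"
  proof (rule Bochner_Integration.integral_norm_bound_integral)
    show "integrable pos_lborel (\<lambda>x. 1 / \<kappa> * (1 / eta x ^ (2 * n + 1)))"
      by (rule integrable_awJ_majorant)
    show "norm (awJ_kernel (2 * n + 1) z x) \<le> 1 / \<kappa> * (1 / eta x ^ (2 * n + 1))"
      if "x \<in> space pos_lborel" for x
      using that \<kappa> by (intro awJ_integrand_bound) auto
  qed (rule awJ_integrable[OF z])
  also have "2 / pi * (\<integral>x. 1 / \<kappa> * (1 / eta x ^ (2 * n + 1)) \<partial>pos_lborel) = aw_moment n / \<kappa>"
    unfolding integral_mult_right_zero by (simp add: aw_moment_def)
  finally show ?thesis by (simp add: divide_right_mono)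
qed

lemma aw_moment_pos: "aw_moment n > 0"
proof -
  have "integral\<^sup>L pos_lborel (\<lambda>x. 0) < integral\<^sup>L pos_lborel (\<lambda>x. 1 / eta x ^ (2 * n + 1))"
  proof (rule integral_pos_lborel_less)
    show "0 < 1 / eta x ^ (2 * n + 1)" if "x > 0" for x
      using eta_gt_one[OF that] by (intro divide_pos_pos zero_less_power) auto
  qed (use integrable_inverse_eta[of "2 * n"] in auto)
  then show ?thesis by (simp add: aw_moment_def)
qed

text \<open>For real \<open>y\<close> the factor \<open>1 / (1 + (y / eta x)\<^sup>2)\<close> lies
  strictly between 0 and 1; this is the source of \<open>0 < \<Xi> < 1\<close>.\<close>

lemma awJ_real:
  assumes y: "y > 0"
  shows "awJ n (of_real y) = of_real (Re (awJ n (of_real y)))"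
    "0 < Re (awJ n (of_real y))" "Re (awJ n (of_real y)) < aw_moment n"
proof -
  define h where "h = (\<lambda>x. 1 / eta x ^ (2 * n + 1) / (1 + (y / eta x)\<^sup>2))"
  have e: "awJ_kernel (2 * n + 1) (of_real y) x = of_real (h x)" for x
    by (simp add: h_def)
  have eq: "awJ n (of_real y) = of_real (2 / pi * integral\<^sup>L pos_lborel h)"
    unfolding awJ_def e by simp
  then show "awJ n (of_real y) = of_real (Re (awJ n (of_real y)))" by simp
  have "of_real y \<in> awdom" using y by (simp add: awdom_def)
  from awJ_integrable[OF this, of n] have int: "integrable pos_lborel h"
    unfolding e complex_of_real_integrable_eq .
  have p: "1 + (y / eta x)\<^sup>2 > 1" if "x > 0" for x using y eta_gt_one[OF that] by simp
  have "integral\<^sup>L pos_lborel (\<lambda>x. 0) < integral\<^sup>L pos_lborel h"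
  proof (rule integral_pos_lborel_less[OF _ int])
    fix x :: real assume x: "x > 0"
    have "0 < 1 + (y / eta x)\<^sup>2" using p[OF x] by linarith
    then show "0 < h x" unfolding h_def using eta_gt_one[OF x]
      by (intro divide_pos_pos zero_less_power) auto
  qed auto
  then show "0 < Re (awJ n (of_real y))" by (simp add: eq)
  have "integral\<^sup>L pos_lborel h < integral\<^sup>L pos_lborel (\<lambda>x. 1 / eta x ^ (2 * n + 1))"
  proof (rule integral_pos_lborel_less[OF int])
    fix x :: real assume x: "x > 0"
    have "1 / eta x ^ (2 * n + 1) / (1 + (y / eta x)\<^sup>2) < 1 / eta x ^ (2 * n + 1) / 1"
      using p[OF x] order.strict_trans[OF zero_less_one p[OF x]] eta_gt_one[OF x]
      by (intro divide_strict_left_mono mult_pos_pos) auto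
    then show "h x < 1 / eta x ^ (2 * n + 1)" by (simp add: h_def)
  qed (use integrable_inverse_eta[of "2 * n"] in auto)
  then show "Re (awJ n (of_real y)) < aw_moment n" by (simp add: eq aw_moment_def divide_strict_right_mono)
qed

text \<open>One step of the geometric series: \<open>1 / (1 + q) = 1 - q / (1 + q)\<close> with
  \<open>q = (z / eta x)\<^sup>2\<close>, integrated.\<close>

lemma awJ_Suc:
  assumes "z \<in> awdom"
  shows "awJ n z = of_real (aw_moment n) - z\<^sup>2 * awJ (Suc n) z"
proof -
  define A where "A = (\<lambda>x. awJ_kernel (2 * n + 1) z x)"
  define B where "B = (\<lambda>x. awJ_kernel (2 * Suc n + 1) z x)"
  have AB: "integrable pos_lborel A" "integrable pos_lborel B"
    unfolding A_def B_def by (rule awJ_integrable[OF assms])+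
  have pt: "complex_of_real (1 / eta x ^ (2 * n + 1)) = A x + z\<^sup>2 * B x" if x: "x > 0" for x
  proof -
    define e where "e = complex_of_real (eta x)"
    have e: "e \<noteq> 0" using eta_gt_one[OF x] by (simp add: e_def)
    have nz: "1 + (z / e)\<^sup>2 \<noteq> 0" using awJ_integrand_nonzero[OF assms x] by (simp add: e_def)
    have "A x + z\<^sup>2 * B x = 1 / e ^ (2 * n + 1) / (1 + (z / e)\<^sup>2) * (1 + (z / e)\<^sup>2)"
    proof -
      have "1 / e ^ (2 * Suc n + 1) = 1 / e ^ (2 * n + 1) * (1 / e\<^sup>2)"
        using e by (simp add: power2_eq_square)
      then have "B x = 1 / e ^ (2 * n + 1) / (1 + (z / e)\<^sup>2) * (1 / e\<^sup>2)"
        by (simp only: B_def of_real_power e_def[symmetric]) (simp add: divide_simps)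
      moreover have "A x = 1 / e ^ (2 * n + 1) / (1 + (z / e)\<^sup>2)"
        by (simp only: A_def of_real_power e_def[symmetric])
      ultimately have "A x + z\<^sup>2 * B x = 1 / e ^ (2 * n + 1) / (1 + (z / e)\<^sup>2) * (1 + z\<^sup>2 * (1 / e\<^sup>2))"
        by (simp only: distrib_left mult_1_right) (simp only: mult_ac)
      then show ?thesis by (simp add: power_divide)
    qed
    also have "\<dots> = 1 / e ^ (2 * n + 1)" by (rule nonzero_eq_divide_eq[THEN iffD1, OF nz refl])
    finally show ?thesis by (simp add: e_def)
  qed
  have "complex_of_real (\<integral>x. 1 / eta x ^ (2 * n + 1) \<partial>pos_lborel) = (\<integral>x. A x + z\<^sup>2 * B x \<partial>pos_lborel)"
    unfolding integral_complex_of_real[symmetric]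
    by (rule Bochner_Integration.integral_cong) (auto simp only: space_pos_lborel greaterThan_iff pt)
  also have "\<dots> = integral\<^sup>L pos_lborel A + z\<^sup>2 * integral\<^sup>L pos_lborel B"
    using AB by simp
  finally have m: "complex_of_real (\<integral>x. 1 / eta x ^ (2 * n + 1) \<partial>pos_lborel) = integral\<^sup>L pos_lborel A + z\<^sup>2 * integral\<^sup>L pos_lborel B" .
  have "of_real (aw_moment n) = of_real (2 / pi) * (integral\<^sup>L pos_lborel A + z\<^sup>2 * integral\<^sup>L pos_lborel B)"
    unfolding m[symmetric] by (simp add: aw_moment_def)
  then show ?thesis unfolding awJ_def A_def[symmetric] B_def[symmetric] by (simp add: algebra_simps)
qed

lemma awJ_expansion:
  assumes "z \<in> awdom"
  shows "awJ 0 z = (\<Sum>n<N. of_real ((-1) ^ n * aw_moment n) * z ^ (2 * n)) + (-1) ^ N * z ^ (2 * N) * awJ N z"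
proof (induction N)
  case (Suc N)
  have "(-1) ^ N * z ^ (2 * N) * awJ N z
     = of_real ((-1) ^ N * aw_moment N) * z ^ (2 * N) + (-1) ^ Suc N * z ^ (2 * Suc N) * awJ (Suc N) z"
    unfolding awJ_Suc[OF assms, of N] by (simp add: algebra_simps power2_eq_square)
  with Suc show ?case by simp
qed simp

text \<open>The kernel for \<open>n = 0\<close> is half the integrand of
  \<open>stieltjes_identity\<close>. The value is the reciprocal of the derivative of
  \<open>awg_root\<close> at \<open>t\<close>, that is dt/dy.\<close>

lemma awJ_cuberoot:
  assumes t: "t > 0"
  shows "awJ 0 (of_real (awg_root t)) = of_real (3 * (awg_root t)\<^sup>2 / (cosh t - 1))"
proof -
  define y where "y = awg_root t"
  define c where "c = 3 * y\<^sup>2 / (cosh t - 1)"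
  have pt: "awJ_kernel (2 * 0 + 1) (of_real y) x
     = of_real (1 / 2 * (2 * eta x / ((eta x)\<^sup>2 + y\<^sup>2)))" if x: "x > 0" for x
  proof -
    have e: "eta x > 1" by (rule eta_gt_one[OF x])
    then have "(eta x)\<^sup>2 + y\<^sup>2 > 0" by (simp add: add_pos_nonneg)
    then have "1 / eta x / (1 + (y / eta x)\<^sup>2) = 1 / 2 * (2 * eta x / ((eta x)\<^sup>2 + y\<^sup>2))"
      using e by (simp add: field_simps power2_eq_square)
    then have "complex_of_real (1 / eta x / (1 + (y / eta x)\<^sup>2)) = of_real (1 / 2 * (2 * eta x / ((eta x)\<^sup>2 + y\<^sup>2)))"
      by (rule arg_cong)
    then show ?thesis by simp
  qed
  have "(\<integral>x. awJ_kernel (2 * 0 + 1) (of_real y) x \<partial>pos_lborel)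
     = (\<integral>x. complex_of_real (1 / 2 * (2 * eta x / ((eta x)\<^sup>2 + y\<^sup>2))) \<partial>pos_lborel)"
    by (rule Bochner_Integration.integral_cong) (auto simp only: space_pos_lborel greaterThan_iff pt)
  also have "\<dots> = of_real (1 / 2 * (\<integral>x. 2 * eta x / ((eta x)\<^sup>2 + y\<^sup>2) \<partial>pos_lborel))"
    unfolding integral_complex_of_real integral_mult_right_zero ..
  also have "\<dots> = of_real (pi * c / 2)"
    using stieltjes_identity(2)[OF t] by (simp add: integral_pos_lborel y_def c_def)
  finally have "awJ 0 (of_real y) = of_real (2 / pi * (pi * c / 2))"
    unfolding awJ_def by (simp only: of_real_mult)
  moreover have "2 / pi * (pi * c / 2) = c" by simp
  ultimately show ?thesis by (simp only: y_def c_def)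
qed


section \<open>Lagrange inversion\<close>

text \<open>A bridge from the real derivatives that define the coefficients to the complex ones in
  Cauchy's formula. Agreement on a whole interval is carried through the induction, since it has to
  be differentiated again.\<close>

lemma higher_deriv_of_real:
  fixes f :: "complex \<Rightarrow> complex" and u :: "real \<Rightarrow> real"
  assumes hol: "f holomorphic_on ball 0 r"
    and eq: "\<And>t. \<bar>t\<bar> < r \<Longrightarrow> f (of_real t) = of_real (u t)"
    and t: "\<bar>t\<bar> < r"
  shows "(deriv ^^ n) f (of_real t) = of_real ((deriv ^^ n) u t)"
  using t
proof (induction n arbitrary: t)
  case 0
  then show ?case using eq by simp
next
  case (Suc n)
  let ?F = "(deriv ^^ n) f" and ?U = "(deriv ^^ n) u"
  define D where "D = deriv ?F (of_real t)"
  have "?F holomorphic_on ball 0 r" by (intro holomorphic_higher_deriv hol open_ball)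
  then have "(?F has_field_derivative D) (at (of_real t))"
    unfolding D_def using Suc.prems by (intro holomorphic_derivI[of _ "ball 0 r"]) auto
  moreover have "(complex_of_real has_vector_derivative 1) (at t)"
    using has_vector_derivative_of_real[OF DERIV_ident] by force
  ultimately have "((?F \<circ> of_real) has_vector_derivative 1 * D) (at t)"
    by (intro field_vector_diff_chain_at)
  then have "((\<lambda>s. ?F (of_real s)) has_vector_derivative D) (at t)" by (simp add: o_def)
  then have "((\<lambda>s. complex_of_real (?U s)) has_vector_derivative D) (at t)"
  proof (rule has_vector_derivative_transform_within_open[where S = "{-r<..<r}"])
    show "?F (of_real s) = complex_of_real (?U s)" if "s \<in> {-r<..<r}" for s
      using that by (intro Suc.IH) auto
  qed (use Suc.prems in auto)
  then have Re: "(?U has_real_derivative Re D) (at t)" and Im: "((\<lambda>s. 0) has_real_derivative Im D) (at t)"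
    unfolding has_vector_derivative_complex_iff by simp_all
  have "Im D = 0" using DERIV_unique[OF Im DERIV_const] .
  then have "D = of_real (Re D)" by (simp add: complex_eq_iff)
  also have "Re D = deriv ?U t" using DERIV_imp_deriv[OF Re] by simp
  finally show ?case by (simp add: D_def)
qed

text \<open>The relation \<open>f(y) * dy/dt = 1\<close>, known for positive \<open>t\<close> from
  \<open>awJ_cuberoot\<close>, extends by the identity theorem. It is first multiplied by
  \<open>3 * (awy z)\<^sup>2\<close>, which makes \<open>G\<close> holomorphic at the origin, a
  limit point of the positive reals.\<close>

lemma awJ_awy_near_zero:
  obtains \<epsilon> where "\<epsilon> > 0" "ball 0 \<epsilon> \<subseteq> strip" "\<And>z. z \<in> ball 0 \<epsilon> \<Longrightarrow> awy z \<in> ball 0 1"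
    "\<And>z. z \<in> ball 0 \<epsilon> \<Longrightarrow> z \<noteq> 0 \<Longrightarrow> awJ 0 (awy z) * deriv awy z = 1"
proof -
  have "0 \<in> strip" by (simp add: strip_def)
  have "isCont awy 0"
    using awy_holomorphic \<open>0 \<in> strip\<close> open_strip
    by (metis continuous_on_eq_continuous_at holomorphic_on_imp_continuous_on)
  then have "\<exists>d>0. awy ` ball 0 d \<subseteq> ball (awy 0) 1"
    unfolding continuous_at_ball by (metis zero_less_one)
  moreover have "awy 0 = 0" by (simp add: awy_def)
  ultimately obtain e where e: "e > 0" "ball 0 e \<subseteq> awy -` ball 0 1"
    by (metis image_subset_iff_subset_vimage)
  obtain d where d: "d > 0" "ball 0 d \<subseteq> strip" using open_strip \<open>0 \<in> strip\<close> open_contains_ball by blast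
  define \<epsilon> where "\<epsilon> = min e d"
  have eps: "\<epsilon> > 0" "ball 0 \<epsilon> \<subseteq> strip" using d e by (auto simp: \<epsilon>_def)
  have small: "awy z \<in> ball 0 1" if "z \<in> ball 0 \<epsilon>" for z using that e by (auto simp: \<epsilon>_def)
  define G where "G = (\<lambda>z. awJ 0 (awy z) * (cosh z - 1) - 3 * (awy z)\<^sup>2)"
  have G0: "G z = 0" if z: "z \<in> ball 0 \<epsilon>" for z
  proof (rule analytic_continuation[of G "ball 0 \<epsilon>" "of_real ` {0<..<\<epsilon>}" 0])
    have a: "awy holomorphic_on ball 0 \<epsilon>" by (rule holomorphic_on_subset[OF awy_holomorphic eps(2)])
    have j: "(awJ 0 \<circ> awy) holomorphic_on ball 0 \<epsilon>"
      using small by (intro holomorphic_on_compose_gen[OF a awJ_holomorphic]) (auto simp: awdom_def)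
    have "(\<lambda>z. (exp z + exp (- z)) / 2 :: complex) holomorphic_on ball 0 \<epsilon>"
      by (intro holomorphic_intros) auto
    then have c: "cosh holomorphic_on ball 0 \<epsilon>"
      by (rule holomorphic_transform) (simp add: cosh_def scaleR_conv_of_real)
    show "G holomorphic_on ball 0 \<epsilon>"
      unfolding G_def using j by (intro holomorphic_intros a c) (simp add: o_def)
    show "of_real ` {0<..<\<epsilon>} \<subseteq> ball (0::complex) \<epsilon>" by auto
    show "(0::complex) islimpt of_real ` {0<..<\<epsilon>}"
      unfolding islimpt_approachable
    proof (intro allI impI)
      fix \<delta> :: real assume "\<delta> > 0"
      define m where "m = min \<delta> \<epsilon> / 2"
      have m: "0 < m" "m < \<epsilon>" "m < \<delta>" using eps \<open>\<delta> > 0\<close> by (auto simp: m_def min_def)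
      show "\<exists>x'\<in>complex_of_real ` {0<..<\<epsilon>}. x' \<noteq> 0 \<and> dist x' 0 < \<delta>"
      proof (rule bexI)
        show "complex_of_real m \<noteq> 0 \<and> dist (complex_of_real m) 0 < \<delta>" using m by simp
        show "complex_of_real m \<in> complex_of_real ` {0<..<\<epsilon>}" using m by (intro imageI) simp
      qed
    qed
    show "G x = 0" if "x \<in> of_real ` {0<..<\<epsilon>}" for x
    proof -
      obtain t where t: "t > 0" "x = of_real t" using \<open>x \<in> _\<close> by auto
      have "cosh x = of_real (cosh t)"
        unfolding t cosh_def by (simp add: exp_of_real scaleR_conv_of_real flip: of_real_minus)
      moreover have "awy x = of_real (awg_root t)" by (simp add: t awy_of_real awg_root_def)
      ultimately show ?thesis
        using awJ_cuberoot[OF t(1)] cosh_gt_one[OF t(1)] t(1) by (simp add: G_def)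
    qed
  qed (use eps z in auto)
  show ?thesis
  proof (rule that[OF eps small])
    fix z :: complex assume z: "z \<in> ball 0 \<epsilon>" "z \<noteq> 0"
    have zs: "z \<in> strip" using z eps by blast
    have nz: "awy z \<noteq> 0" by (rule awy_nonzero[OF zs z(2)])
    have "deriv awy z = (cosh z - 1) / (3 * (awy z)\<^sup>2)"
      by (rule DERIV_imp_deriv[OF awy_has_derivative[OF zs z(2)]])
    then show "awJ 0 (awy z) * deriv awy z = 1"
      using G0[OF z(1)] nz by (simp add: G_def)
  qed
qed

text \<open>On the real axis \<open>sinh_quotient\<close> is \<open>1 / awq\<close>, so its positive
  power with exponent \<open>(2 * N + 1) / 3\<close> is the exponential of the corresponding
  multiple of \<open>- awl\<close>.\<close>

lemma aw_coeff_eq_higher_deriv: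
  "of_real (aw_coeff N) = (deriv ^^ (2 * N)) (\<lambda>z. exp (- (of_nat (2 * N + 1) * awl z / 3))) 0 / fact (2 * N)"
proof -
  define h where "h = (\<lambda>z. exp (- (of_nat (2 * N + 1) * awl z / 3)))"
  have hol: "h holomorphic_on strip" unfolding h_def by (intro holomorphic_intros awl) auto
  have sub: "ball 0 1 \<subseteq> strip"
  proof
    fix z :: complex assume "z \<in> ball 0 1"
    then have "\<bar>Im z\<bar> < 1" using abs_Im_le_cmod[of z] by simp
    then show "z \<in> strip" using pi_gt3 by (simp add: strip_def)
  qed
  have "h (of_real t) = of_real (sinh_quotient t powr (real (2 * N + 1) / 3))" for t
  proof -
    have "\<exists>\<rho>>0. awq (of_real t) = of_real \<rho> \<and> sinh_quotient t = 1 / \<rho>"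
    proof (cases "t = 0")
      case True
      then show ?thesis using awq(3) by (intro exI[of _ "1 / 6"]) (simp add: sinh_quotient_def)
    next
      case False
      then show ?thesis using awq_of_real[OF False] sinh_quot_pos[OF False]
        by (intro exI[of _ "(sinh t - t) / t ^ 3"]) (simp add: sinh_quotient_def)
    qed
    then obtain \<rho> where \<rho>: "\<rho> > 0" "awq (of_real t) = of_real \<rho>" "sinh_quotient t = 1 / \<rho>" by blast
    have "h (of_real t) = of_real (exp (- (real (2 * N + 1) * ln \<rho> / 3)))"
      unfolding h_def awl_of_real \<rho>(2) by (simp flip: exp_of_real)
    also have "exp (- (real (2 * N + 1) * ln \<rho> / 3)) = sinh_quotient t powr (real (2 * N + 1) / 3)"
      using \<rho>(1) by (simp add: \<rho>(3) powr_def ln_div)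
    finally show ?thesis .
  qed
  then have "(deriv ^^ (2 * N)) h (of_real 0)
      = of_real ((deriv ^^ (2 * N)) (\<lambda>t. sinh_quotient t powr (real (2 * N + 1) / 3)) 0)"
    by (intro higher_deriv_of_real[of h 1] holomorphic_on_subset[OF hol sub]) auto
  then show ?thesis by (simp add: aw_coeff_def h_def)
qed

text \<open>Lagrange inversion: \<open>1 / awy\<^bsup>2N+1\<^esup>\<close> is multiplied by \<open>awJ 0 (awy z) * awy' z = 1\<close>
  and all terms but \<open>awy' / awy\<close> have primitives.\<close>

theorem aw_coeff_eq: "aw_coeff N = (-1) ^ N * aw_moment N"
proof -
  define m where "m = (\<lambda>n. (-1) ^ n * aw_moment n)"
  obtain \<epsilon> where \<epsilon>: "\<epsilon> > 0" "ball 0 \<epsilon> \<subseteq> strip" and small: "\<And>z. z \<in> ball 0 \<epsilon> \<Longrightarrow> awy z \<in> ball 0 1"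
    and inv: "\<And>z. z \<in> ball 0 \<epsilon> \<Longrightarrow> z \<noteq> 0 \<Longrightarrow> awJ 0 (awy z) * deriv awy z = 1"
    by (rule awJ_awy_near_zero) blast
  define \<gamma> where "\<gamma> = circlepath 0 (\<epsilon> / 2)"
  define h where "h = (\<lambda>z. exp (- (of_nat (2 * N + 1) * awl z / 3)))"
  define S where "S = ball 0 \<epsilon> - {0 :: complex}"
  have \<gamma>: "valid_path \<gamma>" "pathfinish \<gamma> = pathstart \<gamma>" "path_image \<gamma> \<subseteq> S"
    using \<epsilon> by (auto simp: \<gamma>_def S_def)
  have \<gamma>ball: "path_image \<gamma> \<subseteq> ball 0 \<epsilon>" using \<gamma>(3) by (auto simp: S_def)
  have openS: "open S" by (simp add: S_def open_delete)
  have nz: "awy z \<noteq> 0" if "z \<in> S" for z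
  proof -
    have "z \<in> strip" "z \<noteq> 0" using that \<epsilon>(2) by (auto simp: S_def)
    then show ?thesis by (rule awy_nonzero)
  qed
  have ahol: "awy holomorphic_on ball 0 \<epsilon>" by (rule holomorphic_on_subset[OF awy_holomorphic \<epsilon>(2)])
  have da: "(awy has_field_derivative deriv awy z) (at z)" if "z \<in> ball 0 \<epsilon>" for z
    using that by (rule holomorphic_derivI[OF ahol open_ball])
  have lhol: "awl holomorphic_on ball 0 \<epsilon>" by (rule holomorphic_on_subset[OF awl(1) \<epsilon>(2)])
  have hhol: "h holomorphic_on ball 0 \<epsilon>" unfolding h_def by (intro holomorphic_intros lhol) auto
  define D where "D = (deriv ^^ (2 * N)) h 0"
  have sub: "cball 0 (\<epsilon> / 2) \<subseteq> ball (0 :: complex) \<epsilon>" using \<epsilon> by auto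
  have I0: "((\<lambda>u. h u / (u - 0) ^ Suc (2 * N)) has_contour_integral (2 * pi * \<i>) / fact (2 * N) * D) \<gamma>"
    unfolding D_def \<gamma>_def
  proof (rule Cauchy_has_contour_integral_higher_derivative_circlepath)
    show "continuous_on (cball 0 (\<epsilon> / 2)) h"
      by (intro holomorphic_on_imp_continuous_on holomorphic_on_subset[OF hhol sub])
    show "h holomorphic_on ball 0 (\<epsilon> / 2)"
      using sub ball_subset_cball by (intro holomorphic_on_subset[OF hhol]) blast
  qed (use \<epsilon> in auto)
  define T1 where "T1 = (\<lambda>n z. of_real (m n) * (deriv awy z / awy z ^ Suc (2 * (N - n))))"
  have I1: "(T1 n has_contour_integral of_real (m n) * 0) \<gamma>" if n: "n < N" for n
  proof -
    define k where "k = 2 * (N - n)"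
    have k: "k > 0" using n by (simp add: k_def)
    have "((\<lambda>z. deriv awy z / awy z ^ Suc k) has_contour_integral 0) \<gamma>"
    proof (rule Cauchy_theorem_primitive[OF _ \<gamma>(1,3,2)])
      fix z assume z: "z \<in> S"
      then have zb: "z \<in> ball 0 \<epsilon>" by (simp add: S_def)
      obtain k' where k': "k = Suc k'" using k by (cases k) auto
      have "((\<lambda>z. - (1 / of_nat k) * inverse (awy z ^ k)) has_field_derivative
          - (1 / of_nat k) * (- (inverse (awy z ^ k) * (of_nat k * awy z ^ (k - 1) * deriv awy z) * inverse (awy z ^ k)))) (at z)"
        using nz[OF z] by (auto intro!: derivative_eq_intros da[OF zb])
      also have "- (1 / of_nat k) * (- (inverse (awy z ^ k) * (of_nat k * awy z ^ (k - 1) * deriv awy z) * inverse (awy z ^ k)))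
          = deriv awy z / awy z ^ Suc k"
        using nz[OF z] k' by (simp add: field_simps del: of_nat_Suc)
      finally show "((\<lambda>z. - (1 / of_nat k) * inverse (awy z ^ k)) has_field_derivative deriv awy z / awy z ^ Suc k) (at z within S)"
        by (rule has_field_derivative_at_within)
    qed
    then show ?thesis unfolding T1_def k_def by (rule has_contour_integral_lmul)
  qed
  \<comment> \<open>The term \<open>n = N\<close> carries the logarithmic derivative of
    \<open>awy z = z * exp (awl z / 3)\<close>; only its part \<open>1 / z\<close> has a nonzero
    integral.\<close>
  define T2 where "T2 = (\<lambda>z. of_real (m N) * (1 / (z - 0) + deriv awl z / 3))"
  have I2: "(T2 has_contour_integral of_real (m N) * (2 * pi * \<i> + 0)) \<gamma>"
    unfolding T2_def
  proof (intro has_contour_integral_lmul has_contour_integral_add)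
    show "((\<lambda>z. 1 / (z - 0)) has_contour_integral 2 * pi * \<i>) \<gamma>"
      using Cauchy_integral_circlepath_simple[of "\<lambda>_. 1" 0 "\<epsilon> / 2" 0] \<epsilon> by (simp add: \<gamma>_def)
    show "((\<lambda>z. deriv awl z / 3) has_contour_integral 0) \<gamma>"
      by (rule Cauchy_theorem_disc_simple[OF _ \<gamma>(1) \<gamma>ball \<gamma>(2)])
        (intro holomorphic_intros holomorphic_deriv lhol open_ball, simp)
  qed
  \<comment> \<open>Expanding to order \<open>Suc N\<close> leaves the remainder with
    \<open>awy ^ (2 * N + 2) / awy ^ (2 * N + 1) = awy\<close>, hence without a pole.\<close>
  define T3 where "T3 = (\<lambda>z. (-1) ^ Suc N * (awy z * awJ (Suc N) (awy z) * deriv awy z))"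
  have I3: "(T3 has_contour_integral 0) \<gamma>"
  proof (rule Cauchy_theorem_disc_simple[OF _ \<gamma>(1) \<gamma>ball \<gamma>(2)])
    have "(awJ (Suc N) \<circ> awy) holomorphic_on ball 0 \<epsilon>"
      using small by (intro holomorphic_on_compose_gen[OF ahol awJ_holomorphic]) (auto simp: awdom_def)
    then show "T3 holomorphic_on ball 0 \<epsilon>"
      unfolding T3_def by (intro holomorphic_intros ahol holomorphic_deriv open_ball) (simp add: o_def)
  qed
  have "((\<lambda>z. (\<Sum>n<N. T1 n z) + (T2 z + T3 z)) has_contour_integral
      ((\<Sum>n<N. of_real (m n) * 0) + (of_real (m N) * (2 * pi * \<i> + 0) + 0))) \<gamma>"
    by (intro has_contour_integral_add has_contour_integral_sum I1 I2 I3) auto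
  moreover have "(\<Sum>n<N. T1 n z) + (T2 z + T3 z) = h z / (z - 0) ^ Suc (2 * N)" if "z \<in> path_image \<gamma>" for z
  proof -
    have z: "z \<in> S" "z \<in> ball 0 \<epsilon>" "z \<noteq> 0" using that \<gamma> by (auto simp: S_def)
    define y where "y = awy z"
    define d where "d = deriv awy z"
    have y: "y \<noteq> 0" using nz[OF z(1)] by (simp add: y_def)
    have "y \<in> awdom" using small[OF z(2)] by (simp add: y_def awdom_def)
    from awJ_expansion[OF this, of "Suc N"]
    have J: "awJ 0 y = (\<Sum>n<N. of_real (m n) * y ^ (2 * n)) + of_real (m N) * y ^ (2 * N)
       + (-1) ^ Suc N * y ^ (2 * Suc N) * awJ (Suc N) y" by (simp add: m_def)
    have "h z / (z - 0) ^ Suc (2 * N) = 1 / y ^ Suc (2 * N)"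
    proof -
      have "y ^ Suc (2 * N) = z ^ Suc (2 * N) * exp (of_nat (2 * N + 1) * awl z / 3)"
        by (simp only: y_def awy_def power_mult_distrib exp_of_nat_mult[symmetric]) simp
      then show ?thesis by (simp add: h_def exp_minus field_simps)
    qed
    also have "\<dots> = awJ 0 y * d / y ^ Suc (2 * N)"
      using inv[OF z(2,3)] by (simp add: y_def d_def)
    also have "\<dots> = (\<Sum>n<N. of_real (m n) * y ^ (2 * n)) * d / y ^ Suc (2 * N)
       + of_real (m N) * y ^ (2 * N) * d / y ^ Suc (2 * N)
       + (-1) ^ Suc N * y ^ (2 * Suc N) * awJ (Suc N) y * d / y ^ Suc (2 * N)"
      unfolding J by (simp only: distrib_right add_divide_distrib)
    also have "(\<Sum>n<N. of_real (m n) * y ^ (2 * n)) * d / y ^ Suc (2 * N) = (\<Sum>n<N. T1 n z)"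
      unfolding sum_distrib_right sum_divide_distrib
    proof (rule sum.cong[OF refl])
      fix n assume "n \<in> {..<N}"
      then have "Suc (2 * N) = 2 * n + Suc (2 * (N - n))" by simp
      then have e: "y ^ Suc (2 * N) = y ^ (2 * n) * y ^ Suc (2 * (N - n))" by (metis power_add)
      show "of_real (m n) * y ^ (2 * n) * d / y ^ Suc (2 * N) = T1 n z"
        unfolding e T1_def y_def[symmetric] d_def[symmetric] using y by (simp add: field_simps)
    qed
    also have "of_real (m N) * y ^ (2 * N) * d / y ^ Suc (2 * N) = of_real (m N) * (d / y)"
      using y by simp
    also have "d / y = 1 / (z - 0) + deriv awl z / 3"
    proof -
      have "(awl has_field_derivative deriv awl z) (at z)" by (rule holomorphic_derivI[OF lhol open_ball z(2)])
      then have "(awy has_field_derivative exp (awl z / 3) + z * (exp (awl z / 3) * (deriv awl z / 3))) (at z)"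
        unfolding awy_def[abs_def] by (auto intro!: derivative_eq_intros)
      then have "d = exp (awl z / 3) + z * (exp (awl z / 3) * (deriv awl z / 3))"
        unfolding d_def by (rule DERIV_imp_deriv)
      then show ?thesis using z(3) by (simp add: y_def awy_def field_simps)
    qed
    also have "of_real (m N) * (1 / (z - 0) + deriv awl z / 3) = T2 z"
      by (simp only: T2_def)
    also have "(-1) ^ Suc N * y ^ (2 * Suc N) * awJ (Suc N) y * d / y ^ Suc (2 * N) = T3 z"
      unfolding T3_def y_def[symmetric] d_def[symmetric] using y by (simp add: field_simps)
    finally show ?thesis by simp
  qed
  ultimately have "((\<lambda>u. h u / (u - 0) ^ Suc (2 * N)) has_contour_integral
      of_real (m N) * (2 * pi * \<i>)) \<gamma>"
    by (simp add: has_contour_integral_eq)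
  then have "of_real (m N) * (2 * pi * \<i>) = (2 * pi * \<i>) / fact (2 * N) * D"
    using I0 by (rule has_contour_integral_unique)
  then have "complex_of_real (m N) = D / fact (2 * N)" by (simp add: field_simps)
  also have "\<dots> = of_real (aw_coeff N)" unfolding aw_coeff_eq_higher_deriv D_def h_def ..
  finally show ?thesis unfolding m_def using of_real_eq_iff by metis
qed


subsection \<open>Laplace integrals\<close>

lemma has_bochner_integral_pos_lborel:
  "has_bochner_integral pos_lborel f I \<longleftrightarrow> has_bochner_integral lborel (\<lambda>x. indicator {0<..} x *\<^sub>R f x) I"
  for f :: "real \<Rightarrow> 'b :: {banach, second_countable_topology}"
  by (simp add: has_bochner_integral_iff pos_lborel_def integrable_restrict_space integral_restrict_space)

lemma Gamma_pos_lborel: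
  assumes p: "p > 0"
  shows "has_bochner_integral pos_lborel (\<lambda>t. t powr (p - 1) * exp (- t)) (Gamma p)"
proof -
  define h where "h = (\<lambda>t::real. indicator {0<..} t *\<^sub>R (t powr (p - 1) * exp (- t)))"
  have "((\<lambda>t. if t \<in> {0..} then t powr (p - 1) / exp t else 0) has_integral Gamma p) UNIV"
    unfolding has_integral_restrict_UNIV by (rule Gamma_integral_real[OF p])
  also have "(\<lambda>t. if t \<in> {0..} then t powr (p - 1) / exp t else 0) = h"
    by (auto simp: h_def fun_eq_iff exp_minus field_simps indicator_def)
  finally have I: "(h has_integral Gamma p) UNIV" .
  have meas: "h \<in> borel_measurable borel" unfolding h_def by measurable
  have nn: "0 \<le> h t" for t by (simp add: h_def indicator_def)
  have "integral\<^sup>N lborel h = Gamma p" by (rule nn_integral_has_integral_lborel[OF meas nn I])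
  then have "has_bochner_integral lborel h (Gamma p)"
    using meas nn Gamma_real_pos[OF p] by (intro has_bochner_integral_nn_integral) auto
  then show ?thesis unfolding has_bochner_integral_pos_lborel h_def .
qed

lemma integrable_exp_minus: "integrable pos_lborel (\<lambda>x. exp (- x))"
proof -
  have "integrable pos_lborel (\<lambda>t::real. t powr (1 - 1) * exp (- t))"
    using Gamma_pos_lborel[of 1] by (simp add: has_bochner_integral_iff)
  then show ?thesis
    by (rule Bochner_Integration.integrable_cong[THEN iffD1, rotated -1]) auto
qed

text \<open>The substitution \<open>u = c * s ^ 3\<close>, of which \<open>g\<close> in the proof is
  the inverse, reduces this to the Gamma integral.\<close>

lemma integral_cubic_exp:
  assumes c: "c > 0"
  shows "has_bochner_integral pos_lborel (\<lambda>s. s ^ k * exp (- c * s ^ 3))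
    (Gamma (real (k + 1) / 3) / (3 * c powr (real (k + 1) / 3)))"
proof -
  define p where "p = real (k + 1) / 3"
  have p: "p > 0" by (simp add: p_def)
  define f where "f = (\<lambda>s. s ^ k * exp (- c * s ^ 3))"
  define g where "g = (\<lambda>u. (u / c) powr (1 / 3))"
  define g' where "g' = (\<lambda>u. 1 / 3 * (u / c) powr (1 / 3 - 1) * (1 / c))"
  have eq: "f (g u) * g' u = 1 / (3 * c powr p) * (u powr (p - 1) * exp (- u))" if u: "u > 0" for u
  proof -
    have "((u / c) powr (1 / 3)) ^ 3 = u / c" using u c by (subst powr_power) auto
    moreover have "((u / c) powr (1 / 3)) ^ k = (u / c) powr (real k / 3)"
      using u c by (subst powr_power) auto
    ultimately have "f (g u) * g' u = 1 / (3 * c) * ((u / c) powr (real k / 3) * (u / c) powr (1 / 3 - 1)) * exp (- u)"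
      using c by (simp add: f_def g_def g'_def)
    also have "(u / c) powr (real k / 3) * (u / c) powr (1 / 3 - 1) = (u / c) powr (p - 1)"
      by (simp add: p_def add_divide_distrib flip: powr_add)
    also have "\<dots> = u powr (p - 1) / c powr (p - 1)" using u c by (simp add: powr_divide)
    also have "c powr (p - 1) = c powr p / c" using c by (simp add: powr_diff)
    finally show ?thesis using c by (simp add: field_simps)
  qed
  have G: "integrable pos_lborel (\<lambda>u. f (g u) * g' u)"
    "integral\<^sup>L pos_lborel (\<lambda>u. f (g u) * g' u) = 1 / (3 * c powr p) * Gamma p"
  proof -
    have "has_bochner_integral pos_lborel (\<lambda>u. 1 / (3 * c powr p) * (u powr (p - 1) * exp (- u))) (1 / (3 * c powr p) * Gamma p)"
      by (intro has_bochner_integral_mult_right Gamma_pos_lborel p)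
    then have "has_bochner_integral pos_lborel (\<lambda>u. f (g u) * g' u) (1 / (3 * c powr p) * Gamma p)"
      by (rule has_bochner_integral_cong[THEN iffD1, rotated -1]) (auto simp: eq)
    then show "integrable pos_lborel (\<lambda>u. f (g u) * g' u)"
      "integral\<^sup>L pos_lborel (\<lambda>u. f (g u) * g' u) = 1 / (3 * c powr p) * Gamma p"
      by (simp_all add: has_bochner_integral_iff)
  qed
  have zero: "(0 :: ereal) = ereal 0" by (simp add: zero_ereal_def)
  have fcont: "isCont f x" for x unfolding f_def by (intro continuous_intros)
  have dg: "(g has_real_derivative g' u) (at u)" if "u > 0" for u
    unfolding g_def g'_def using that c by (auto intro!: derivative_eq_intros)
  have g'cont: "isCont g' u" if "u > 0" for u
    unfolding g'_def using that c by (intro continuous_intros) auto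
  have fpos: "0 \<le> f (g u)" for u unfolding f_def g_def by simp
  have g'pos: "0 \<le> g' u" for u unfolding g'_def using c by simp
  have lim0: "((ereal \<circ> g \<circ> real_of_ereal) \<longlongrightarrow> 0) (at_right 0)"
    unfolding zero ereal_tendsto_simps g_def using c by real_asymp
  have liminf: "((ereal \<circ> g \<circ> real_of_ereal) \<longlongrightarrow> \<infinity>) (at_left \<infinity>)"
    unfolding ereal_tendsto_simps g_def using c by real_asymp
  have int: "set_integrable lborel (einterval 0 \<infinity>) (\<lambda>x. f (g x) * g' x)"
    using G(1) by (simp add: integrable_pos_lborel_iff zero_ereal_def)
  have "set_integrable lborel (einterval 0 \<infinity>) f" "(LBINT x=0..\<infinity>. f x) = (LBINT x=0..\<infinity>. f (g x) * g' x)"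
    using interval_integral_substitution_nonneg[of 0 \<infinity> g g' f 0 \<infinity>] dg fcont g'cont fpos g'pos lim0 liminf int
    by auto
  then show ?thesis
    using G(2) unfolding has_bochner_integral_iff f_def[symmetric] p_def[symmetric]
    by (simp add: integrable_pos_lborel_iff integral_pos_lborel interval_lebesgue_integral_0_infty) (simp add: zero_ereal_def)
qed

lemma cube_le_sinh_minus: "t ^ 3 / 6 \<le> sinh t - t" if "t \<ge> 0" for t :: real
proof -
  have nn: "0 \<le> sinh y - y" if "y \<ge> 0" for y :: real
    using less_sinh[of y] that by (cases "y = 0") auto
  have "0 \<le> cosh y - 1 - y\<^sup>2 / 2" if "y \<ge> 0" for y :: real
  proof -
    have "cosh 0 - 1 - 0\<^sup>2 / 2 \<le> cosh y - 1 - y\<^sup>2 / 2"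
      by (rule DERIV_nonneg_imp_le[where f = "\<lambda>x. cosh x - 1 - x\<^sup>2 / 2" and f' = "\<lambda>x. sinh x - x"])
        (use that nn in \<open>auto intro!: derivative_eq_intros\<close>)
    then show ?thesis by simp
  qed
  then have "sinh 0 - 0 - 0 ^ 3 / 6 \<le> sinh t - t - t ^ 3 / 6"
    by (intro DERIV_nonneg_imp_le[where f = "\<lambda>x. sinh x - x - x ^ 3 / 6" and f' = "\<lambda>x. cosh x - 1 - x\<^sup>2 / 2"])
      (use that in \<open>auto intro!: derivative_eq_intros\<close>)
  then show ?thesis by simp
qed

lemma norm_exp_mult_real: "norm (exp (- \<nu> * of_real x)) = exp (- Re \<nu> * x)"
  by simp

lemma integrable_exp_awg:
  assumes "Re \<nu> > 0"
  shows "integrable pos_lborel (\<lambda>t. exp (- \<nu> * of_real (sinh t - t)))"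
proof (rule Bochner_Integration.integrable_bound)
  show "integrable pos_lborel (\<lambda>t. exp (- (Re \<nu> / 6) * t ^ 3))"
    using integral_cubic_exp[of "Re \<nu> / 6" 0] assms by (simp add: has_bochner_integral_iff)
  show "(\<lambda>t. exp (- \<nu> * of_real (sinh t - t))) \<in> borel_measurable pos_lborel"
    by (intro borel_measurable_pos_lborel continuous_intros)
  show "AE t in pos_lborel. norm (exp (- \<nu> * of_real (sinh t - t))) \<le> norm (exp (- (Re \<nu> / 6) * t ^ 3))"
  proof (rule AE_I2)
    fix t assume "t \<in> space pos_lborel"
    then have "t ^ 3 / 6 \<le> sinh t - t" by (intro cube_le_sinh_minus) simp
    then have "Re \<nu> * (t ^ 3 / 6) \<le> Re \<nu> * (sinh t - t)" using assms by (intro mult_left_mono) auto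
    then show "norm (exp (- \<nu> * of_real (sinh t - t))) \<le> norm (exp (- (Re \<nu> / 6) * t ^ 3))"
      unfolding norm_exp_mult_real by simp
  qed
qed

lemma Re_in_awdom: "Re z > 0 \<Longrightarrow> z \<in> awdom" by (simp add: awdom_def)

lemma awJ_of_real_isCont: "y > 0 \<Longrightarrow> isCont (\<lambda>y. awJ n (of_real y)) y"
proof -
  assume "y > 0"
  then have "isCont (awJ n) (of_real y)"
    using awJ_holomorphic[of n] open_awdom Re_in_awdom[of "of_real y"]
    by (metis Re_complex_of_real continuous_on_eq_continuous_at holomorphic_on_imp_continuous_on)
  then show ?thesis by (intro isCont_o2[OF isCont_of_real[OF continuous_ident]])
qed

lemma awJ_of_real_continuous: "continuous_on {0<..} (\<lambda>y. awJ n (of_real y))"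
  by (intro continuous_at_imp_continuous_on) (auto intro: awJ_of_real_isCont)

lemma norm_awJ_of_real_le:
  assumes "y > 0" shows "norm (awJ n (of_real y)) \<le> aw_moment n"
proof -
  have "norm (awJ n (of_real y)) = Re (awJ n (of_real y))"
    using awJ_real(2)[OF assms, of n] by (subst awJ_real(1)[OF assms]) (simp only: norm_of_real abs_of_pos)
  then show ?thesis using awJ_real(3)[OF assms, of n] by simp
qed

lemma integrable_laplace_cubic:
  assumes \<nu>: "Re \<nu> > 0" and h: "continuous_on {0<..} h" "\<And>s. s > 0 \<Longrightarrow> norm (h s) \<le> C * s ^ k"
  shows "integrable pos_lborel (\<lambda>s. exp (- \<nu> * of_real (s ^ 3)) * h s)"
proof (rule Bochner_Integration.integrable_bound)
  show "integrable pos_lborel (\<lambda>s. C * (s ^ k * exp (- Re \<nu> * s ^ 3)))"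
    using integral_cubic_exp[OF \<nu>, of k] by (intro integrable_mult_right) (simp add: has_bochner_integral_iff)
  show "(\<lambda>s. exp (- \<nu> * of_real (s ^ 3)) * h s) \<in> borel_measurable pos_lborel"
    by (intro borel_measurable_pos_lborel continuous_intros h)
  show "AE s in pos_lborel. norm (exp (- \<nu> * of_real (s ^ 3)) * h s) \<le> norm (C * (s ^ k * exp (- Re \<nu> * s ^ 3)))"
  proof (rule AE_I2)
    fix s assume "s \<in> space pos_lborel"
    then have "norm (exp (- \<nu> * of_real (s ^ 3)) * h s) \<le> exp (- Re \<nu> * s ^ 3) * (C * s ^ k)"
      unfolding norm_mult norm_exp_mult_real using h(2)[of s] by (intro mult_left_mono) auto
    also have "\<dots> \<le> norm (C * (s ^ k * exp (- Re \<nu> * s ^ 3)))" by (simp add: mult_ac)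
    finally show "norm (exp (- \<nu> * of_real (s ^ 3)) * h s) \<le> norm (C * (s ^ k * exp (- Re \<nu> * s ^ 3)))" .
  qed
qed

lemma Re_exp_pos: "\<bar>Im w\<bar> < pi / 2 \<Longrightarrow> Re (exp w) > 0"
  by (auto simp: Re_exp intro!: mult_pos_pos cos_gt_zero_pi)

text \<open>On a closed disc inside the strip \<open>Re (exp w)\<close> attains a positive minimum
  \<open>c\<close>, and a cubic exponential with rate \<open>c\<close> majorises all
  integrands.\<close>

lemma laplace_cubic_holomorphic:
  fixes h :: "real \<Rightarrow> complex"
  assumes h: "continuous_on {0<..} h" "\<And>s. s > 0 \<Longrightarrow> norm (h s) \<le> C * s ^ k"
  shows "(\<lambda>w. \<integral>s. exp (- exp w * of_real (s ^ 3)) * h s \<partial>pos_lborel) holomorphic_on {w. \<bar>Im w\<bar> < pi / 2}"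
proof (rule holomorphic_on_parametric_integral)
  have C: "C \<ge> 0" using h(2)[of 1] order.trans[OF norm_ge_zero] by force
  show op: "open {w. \<bar>Im w\<bar> < pi / 2}" by (intro open_Collect_less continuous_intros)
  show "(\<lambda>w. exp (- exp w * of_real (s ^ 3)) * h s) holomorphic_on {w. \<bar>Im w\<bar> < pi / 2}" for s
    by (intro holomorphic_intros)
  show "(\<lambda>s. exp (- exp w * of_real (s ^ 3)) * h s) \<in> borel_measurable pos_lborel" for w
    by (intro borel_measurable_pos_lborel continuous_intros h)
  fix w0 :: complex assume w0: "w0 \<in> {w. \<bar>Im w\<bar> < pi / 2}"
  obtain r where r: "r > 0" "cball w0 r \<subseteq> {w. \<bar>Im w\<bar> < pi / 2}"
    using op w0 open_contains_cball_eq by blast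
  have "\<exists>x\<in>cball w0 r. \<forall>y\<in>cball w0 r. Re (exp x) \<le> Re (exp y)"
    using r by (intro continuous_attains_inf continuous_intros) auto
  then obtain x where x: "x \<in> cball w0 r" "\<And>y. y \<in> cball w0 r \<Longrightarrow> Re (exp x) \<le> Re (exp y)" by blast
  define c where "c = Re (exp x)"
  have c: "c > 0" unfolding c_def using x(1) r(2) by (intro Re_exp_pos) blast
  have "norm (exp (- exp w * of_real (s ^ 3)) * h s) \<le> C * (s ^ k * exp (- c * s ^ 3))"
    if w: "w \<in> cball w0 r" and s: "s \<in> space pos_lborel" for w s
  proof -
    have "c * s ^ 3 \<le> Re (exp w) * s ^ 3" using x(2)[OF w] s by (intro mult_right_mono) (auto simp: c_def)
    then have "norm (exp (- exp w * of_real (s ^ 3)) * h s) \<le> exp (- c * s ^ 3) * (C * s ^ k)"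
      unfolding norm_mult norm_exp_mult_real using h(2)[of s] s by (intro mult_mono) auto
    then show ?thesis by (simp add: mult_ac)
  qed
  moreover have "integrable pos_lborel (\<lambda>s. C * (s ^ k * exp (- c * s ^ 3)))"
    using integral_cubic_exp[OF c, of k] by (intro integrable_mult_right) (simp add: has_bochner_integral_iff)
  ultimately show "\<exists>r>0. \<exists>G. cball w0 r \<subseteq> {w. \<bar>Im w\<bar> < pi / 2} \<and> integrable pos_lborel G \<and>
      (\<forall>w\<in>cball w0 r. \<forall>s\<in>space pos_lborel. norm (exp (- exp w * of_real (s ^ 3)) * h s) \<le> G s)"
    using r by blast
qed

text \<open>The identity theorem in the form used throughout. Agreement is asked for on the left
  half of the central line only, because \<open>aw_entire_real_neg\<close> supplies no more.\<close>

lemma holomorphic_eq_on_strip: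
  assumes "F holomorphic_on {w. \<bar>Im w - a\<bar> < b}" "G holomorphic_on {w. \<bar>Im w - a\<bar> < b}"
    and eq: "\<And>u. u < 0 \<Longrightarrow> F (Complex u a) = G (Complex u a)" and w: "\<bar>Im w - a\<bar> < b"
  shows "F w = G w"
proof -
  let ?S = "{w. \<bar>Im w - a\<bar> < b}"
  have S: "?S = {w. Im w < a + b} \<inter> {w. Im w > a - b}" by auto
  have op: "open ?S" by (intro open_Collect_less continuous_intros)
  have conn: "connected ?S"
    unfolding S by (intro convex_connected convex_Int convex_halfspace_Im_lt convex_halfspace_Im_gt)
  have lim: "Complex (- 1) a islimpt (\<lambda>u. Complex u a) ` {..<0}"
    unfolding islimpt_approachable
  proof (intro allI impI)
    fix e :: real assume "e > 0"
    moreover have "Complex (- 1 - e / 2) a - Complex (- 1) a = of_real (- (e / 2))" by (simp add: complex_eq_iff)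
    ultimately have "dist (Complex (- 1 - e / 2) a) (Complex (- 1) a) < e"
      unfolding dist_norm by (simp only: norm_of_real)
    moreover have "Complex (- 1 - e / 2) a \<noteq> Complex (- 1) a" using \<open>e > 0\<close> by simp
    moreover have "Complex (- 1 - e / 2) a \<in> (\<lambda>u. Complex u a) ` {..<0}" using \<open>e > 0\<close> by (intro imageI) simp
    ultimately show "\<exists>x'\<in>(\<lambda>u. Complex u a) ` {..<0}. x' \<noteq> Complex (- 1) a \<and> dist x' (Complex (- 1) a) < e"
      by (intro bexI conjI)
  qed
  have sub: "(\<lambda>u. Complex u a) ` {..<0} \<subseteq> ?S" using w by auto
  have mem: "Complex (- 1) a \<in> ?S" "w \<in> ?S" using w by auto
  have zero: "F z - G z = 0" if z: "z \<in> (\<lambda>u. Complex u a) ` {..<0}" for z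
  proof -
    obtain u where "u < 0" "z = Complex u a" using z by blast
    then show ?thesis using eq by simp
  qed
  have "F w - G w = 0"
    by (rule analytic_continuation[OF _ op conn sub mem(1) lim zero mem(2)])
      (intro holomorphic_on_diff assms(1,2))
  then show ?thesis by simp
qed

text \<open>For real \<open>w\<close> this is \<open>integral_cubic_exp\<close> with rate
  \<open>exp w\<close>; the complex case follows by the identity theorem instead of a rotation of
  the path.\<close>

lemma cubic_gamma_complex:
  assumes "\<bar>Im w\<bar> < pi / 2"
  shows "(\<integral>s. exp (- exp w * of_real (s ^ 3)) * of_real (s ^ k) \<partial>pos_lborel)
     = of_real (Gamma (real (k + 1) / 3) / 3) * exp (- (of_real (real (k + 1) / 3) * w))"
proof (rule holomorphic_eq_on_strip[where a = 0 and b = "pi / 2"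
      and F = "\<lambda>w. \<integral>s. exp (- exp w * of_real (s ^ 3)) * of_real (s ^ k) \<partial>pos_lborel"
      and G = "\<lambda>w. of_real (Gamma (real (k + 1) / 3) / 3) * exp (- (of_real (real (k + 1) / 3) * w))"])
  show "(\<lambda>w. \<integral>s. exp (- exp w * of_real (s ^ 3)) * of_real (s ^ k) \<partial>pos_lborel) holomorphic_on {w. \<bar>Im w - 0\<bar> < pi / 2}"
    using laplace_cubic_holomorphic[of "\<lambda>s. of_real (s ^ k)" 1 k]
    by (simp add: continuous_intros norm_power)
  show "(\<lambda>w. of_real (Gamma (real (k + 1) / 3) / 3) * exp (- (of_real (real (k + 1) / 3) * w))) holomorphic_on {w. \<bar>Im w - 0\<bar> < pi / 2}"
    by (intro holomorphic_intros)
  fix u :: real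
  define p where "p = real (k + 1) / 3"
  have u: "Complex u 0 = of_real u" by (simp add: complex_eq_iff)
  have "(\<integral>s. exp (- exp (Complex u 0) * of_real (s ^ 3)) * of_real (s ^ k) \<partial>pos_lborel)
      = (\<integral>s. complex_of_real (s ^ k * exp (- exp u * s ^ 3)) \<partial>pos_lborel)"
    unfolding u by (intro Bochner_Integration.integral_cong refl) (simp flip: exp_of_real add: mult.commute)
  also have "\<dots> = of_real (Gamma p / (3 * exp u powr p))"
    using integral_cubic_exp[of "exp u" k] unfolding integral_complex_of_real p_def
    by (simp add: has_bochner_integral_iff)
  also have "Gamma p / (3 * exp u powr p) = Gamma p / 3 * exp (- (p * u))"
    by (simp add: powr_def exp_minus field_simps)
  also have "of_real (Gamma p / 3 * exp (- (p * u))) = of_real (Gamma p / 3) * exp (- (of_real p * Complex u 0))"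
    unfolding u by (simp flip: exp_of_real)
  finally show "(\<integral>s. exp (- exp (Complex u 0) * of_real (s ^ 3)) * of_real (s ^ k) \<partial>pos_lborel)
     = of_real (Gamma (real (k + 1) / 3) / 3) * exp (- (of_real (real (k + 1) / 3) * Complex u 0))"
    by (simp only: p_def)
qed (use assms in simp)


section \<open>The change of variables from t to y\<close>

lemma awg_root_cube: "awg_root t ^ 3 = sinh t - t"
  by (simp add: awg_root_def odd_real_root_pow)

lemma awg_root_has_derivative:
  assumes t: "t > 0"
  shows "(awg_root has_real_derivative (cosh t - 1) / (3 * (awg_root t)\<^sup>2)) (at t)"
proof -
  have p: "sinh t - t > 0" using less_sinh[OF t] by simp
  have "((\<lambda>t. root 3 (sinh t - t)) has_real_derivative
     inverse (real 3 * root 3 (sinh t - t) ^ (3 - Suc 0)) * (cosh t - 1)) (at t)"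
    by (rule DERIV_chain2[OF DERIV_real_root]) (use p in \<open>auto intro!: derivative_eq_intros\<close>)
  then show ?thesis unfolding awg_root_def[abs_def] by (simp add: field_simps)
qed

text \<open>With \<open>y = awg_root t\<close> the Jacobian \<open>g' t\<close> cancels against
  \<open>awJ 0 y\<close>, which is its reciprocal by \<open>awJ_cuberoot\<close>.\<close>

lemma laplace_substitution:
  assumes \<nu>: "Re \<nu> > 0"
  shows "(\<integral>t. exp (- \<nu> * of_real (sinh t - t)) \<partial>pos_lborel)
     = (\<integral>y. exp (- \<nu> * of_real (y ^ 3)) * awJ 0 (of_real y) \<partial>pos_lborel)"
proof -
  define f where "f = (\<lambda>y. exp (- \<nu> * of_real (y ^ 3)) * awJ 0 (of_real y))"
  define g' where "g' = (\<lambda>t. (cosh t - 1) / (3 * (awg_root t)\<^sup>2))"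
  have eq: "g' t *\<^sub>R f (awg_root t) = exp (- \<nu> * of_real (sinh t - t))" if t: "t > 0" for t
  proof -
    have "awJ 0 (of_real (awg_root t)) = of_real (1 / g' t)"
      unfolding awJ_cuberoot[OF t] g'_def by simp
    moreover have "g' t > 0"
      unfolding g'_def using awg_root_pos[OF t] cosh_gt_one[OF t] by simp
    ultimately show ?thesis unfolding f_def awg_root_cube scaleR_conv_of_real by simp
  qed
  have fcont: "isCont f y" if "y > 0" for y
    unfolding f_def by (intro continuous_intros awJ_of_real_isCont that)
  have fint: "integrable pos_lborel f"
    unfolding f_def
  proof (rule integrable_laplace_cubic[OF \<nu>])
    show "norm (awJ 0 (complex_of_real s)) \<le> aw_moment 0 * s ^ 0" if "s > 0" for s
      using norm_awJ_of_real_le[OF that] by simp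
  qed (rule awJ_of_real_continuous)
  have gint: "integrable pos_lborel (\<lambda>t. g' t *\<^sub>R f (awg_root t))"
    using integrable_exp_awg[OF \<nu>]
    by (rule Bochner_Integration.integrable_cong[THEN iffD1, rotated -1]) (auto simp: eq)
  have zero: "(0 :: ereal) = ereal 0" by (simp add: zero_ereal_def)
  have lim0: "((ereal \<circ> awg_root \<circ> real_of_ereal) \<longlongrightarrow> 0) (at_right 0)"
    unfolding zero ereal_tendsto_simps awg_root_def[abs_def] by (auto intro!: tendsto_eq_intros)
  have liminf: "((ereal \<circ> awg_root \<circ> real_of_ereal) \<longlongrightarrow> \<infinity>) (at_left \<infinity>)"
    unfolding ereal_tendsto_simps awg_root_def[abs_def] by real_asymp
  have "(LBINT y=0..\<infinity>. f y) = (LBINT t=0..\<infinity>. g' t *\<^sub>R f (awg_root t))"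
  proof (rule interval_integral_substitution_integrable)
    show "(awg_root has_real_derivative g' x) (at x)" if "0 < ereal x" for x
      unfolding g'_def using that by (intro awg_root_has_derivative) simp
    show "isCont f (awg_root x)" if "0 < ereal x" for x
      using that by (intro fcont awg_root_pos) simp
    show "isCont g' x" if "0 < ereal x" for x
    proof -
      have x: "x > 0" using that by simp
      have "isCont awg_root x" by (rule DERIV_isCont[OF awg_root_has_derivative[OF x]])
      then show ?thesis unfolding g'_def using awg_root_pos[OF x] by (intro continuous_intros) auto
    qed
    show "0 \<le> g' x" for x
      unfolding g'_def using cosh_real_ge_1[of x] by (intro divide_nonneg_nonneg) auto
    show "set_integrable lborel (einterval 0 \<infinity>) (\<lambda>x. g' x *\<^sub>R f (awg_root x))"
      using gint by (simp add: integrable_pos_lborel_iff zero_ereal_def)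
    show "set_integrable lborel (einterval 0 \<infinity>) f"
      using fint by (simp add: integrable_pos_lborel_iff zero_ereal_def)
  qed (auto intro: lim0 liminf)
  then have "integral\<^sup>L pos_lborel f = integral\<^sup>L pos_lborel (\<lambda>t. g' t *\<^sub>R f (awg_root t))"
    by (simp add: interval_lebesgue_integral_0_infty integral_pos_lborel)
  also have "\<dots> = integral\<^sup>L pos_lborel (\<lambda>t. exp (- \<nu> * of_real (sinh t - t)))"
    by (rule Bochner_Integration.integral_cong) (auto simp: eq)
  finally show ?thesis by (simp add: f_def)
qed

lemma anger_weber_eq:
  "anger_weber (- \<nu>) \<nu> = 1 / of_real pi * (\<integral>t. exp (- \<nu> * of_real (sinh t - t)) \<partial>pos_lborel)"
proof -
  have [measurable]: "(sinh :: real \<Rightarrow> real) \<in> borel_measurable borel"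
    by (intro borel_measurable_continuous_onI continuous_intros)
  have s: "sinh (complex_of_real t) = of_real (sinh t)" for t
    by (simp add: sinh_def exp_of_real scaleR_conv_of_real flip: of_real_minus)
  have "(LINT t:{0..}|lborel. exp (- (- \<nu>) * of_real t - \<nu> * sinh (of_real t)))
      = (LINT t:{0<..}|lborel. exp (- \<nu> * of_real (sinh t - t)))"
    unfolding set_lebesgue_integral_def s
  proof (rule integral_cong_AE)
    show "AE t in lborel. indicator {0..} t *\<^sub>R exp (- (- \<nu>) * complex_of_real t - \<nu> * of_real (sinh t))
       = indicator {0<..} t *\<^sub>R exp (- \<nu> * of_real (sinh t - t))"
      using AE_lborel_singleton[of 0]
      by eventually_elim (auto simp: indicator_def algebra_simps)
  qed measurable
  then show ?thesis by (simp add: anger_weber_def integral_pos_lborel)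
qed

subsection \<open>Analytic continuation to the Riemann surface of the logarithm\<close>

text \<open>Equal to \<open>exp (- exp w * awg (\<tau> - w))\<close>, but multiplied out: the
  dominating term \<open>- exp \<tau> / 2\<close> no longer involves \<open>w\<close>, so the
  integral over real \<tau> converges for every \<open>w\<close>, whatever the argument of
  \<nu>.\<close>

definition awM :: "complex \<Rightarrow> complex \<Rightarrow> complex" where
  "awM w \<tau> = exp (- exp \<tau> / 2 + exp (2 * w - \<tau>) / 2 + exp w * (\<tau> - w))"

lemma awM_eq: "awM w \<tau> = exp (- exp w * awg (\<tau> - w))"
proof -
  have "exp w * exp (\<tau> - w) = exp \<tau>" "exp w * exp (- (\<tau> - w)) = exp (2 * w - \<tau>)"
    by (simp_all flip: exp_add)
  moreover have "awg (\<tau> - w) = (exp (\<tau> - w) - exp (- (\<tau> - w))) / 2 - (\<tau> - w)"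
    by (simp add: awg_def sinh_def scaleR_conv_of_real)
  moreover have "- e * ((b - c) / 2 - d) = - (e * b) / 2 + (e * c) / 2 + e * d" for e b c d :: complex
    by (simp add: field_simps)
  ultimately have "- exp w * awg (\<tau> - w) = - exp \<tau> / 2 + exp (2 * w - \<tau>) / 2 + exp w * (\<tau> - w)"
    by (simp only:)
  then show ?thesis by (simp add: awM_def)
qed

text \<open>The substitution \<open>t = \<tau> - w\<close> moves the path into a fixed half-line: the integral from \<open>w\<close> to
  \<open>\<infinity>\<close> is split at \<open>0\<close>.\<close>

definition aw_entire :: "complex \<Rightarrow> complex" where
  "aw_entire w = 1 / of_real pi * ((\<integral>\<tau>. awM w (of_real \<tau>) \<partial>pos_lborel)
     - w * (\<integral>u. awM w (w * of_real u) \<partial>restrict_space lborel {0<..<1}))"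

lemma continuous_awM [continuous_intros]:
  "continuous_on A f \<Longrightarrow> continuous_on A g \<Longrightarrow> continuous_on A (\<lambda>x. awM (f x) (g x))"
  unfolding awM_def by (intro continuous_intros) auto

lemma holomorphic_awM [holomorphic_intros]:
  "f holomorphic_on A \<Longrightarrow> g holomorphic_on A \<Longrightarrow> (\<lambda>x. awM (f x) (g x)) holomorphic_on A"
  unfolding awM_def by (intro holomorphic_intros) auto

lemma norm_awM_le:
  assumes "norm w \<le> R" "\<tau> > 0"
  shows "norm (awM w (of_real \<tau>)) \<le> exp (- exp \<tau> / 2 + exp (2 * R) / 2 + exp R * (\<tau> + R))"
proof -
  have wR: "Re w \<le> R" using complex_Re_le_cmod[of w] assms by simp
  have "Re (exp (2 * w - of_real \<tau>)) \<le> norm (exp (2 * w - of_real \<tau>))" by (rule complex_Re_le_cmod)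
  also have "\<dots> \<le> exp (2 * R)" using wR assms by simp
  finally have 1: "Re (exp (2 * w - of_real \<tau>)) \<le> exp (2 * R)" .
  have "Re (exp w * (of_real \<tau> - w)) \<le> norm (exp w * (of_real \<tau> - w))" by (rule complex_Re_le_cmod)
  also have "\<dots> \<le> exp R * (\<tau> + R)"
  proof -
    have "norm (of_real \<tau> - w) \<le> \<tau> + R" using norm_triangle_ineq4[of "of_real \<tau>" w] assms by simp
    then show ?thesis unfolding norm_mult using wR by (intro mult_mono) auto
  qed
  finally have 2: "Re (exp w * (of_real \<tau> - w)) \<le> exp R * (\<tau> + R)" .
  have 3: "Re (exp (of_real \<tau>)) = exp \<tau>" by (simp add: Re_exp)
  show ?thesis
    unfolding awM_def norm_exp_eq_Re using 1 2 3 by simp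
qed

lemma integrable_awM_bound:
  "integrable pos_lborel (\<lambda>\<tau>. exp (- exp \<tau> / 2 + b + a * (\<tau> + c)))" if a: "a \<ge> 0" for a b c :: real
proof (rule Bochner_Integration.integrable_bound)
  \<comment> \<open>The tangent of \<open>exp\<close> at \<open>ln k\<close> bounds
    \<open>exp \<tau> / 2\<close> below by a line of slope \<open>a + 1\<close>, which beats
    \<open>a * \<tau>\<close> and leaves \<open>exp (- \<tau>)\<close>.\<close>
  define k where "k = 2 * (a + 1)"
  define C where "C = b + a * c + k / 2 * ln k"
  show "integrable pos_lborel (\<lambda>\<tau>. exp C * exp (- \<tau>))"
    by (intro integrable_mult_right integrable_exp_minus)
  show "(\<lambda>\<tau>. exp (- exp \<tau> / 2 + b + a * (\<tau> + c))) \<in> borel_measurable pos_lborel"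
    by (intro borel_measurable_pos_lborel continuous_intros) auto
  show "AE \<tau> in pos_lborel. norm (exp (- exp \<tau> / 2 + b + a * (\<tau> + c))) \<le> norm (exp C * exp (- \<tau>))"
  proof (rule AE_I2)
    fix \<tau> assume "\<tau> \<in> space pos_lborel"
    have k: "k > 0" using a by (simp add: k_def)
    have "1 + (\<tau> - ln k) \<le> exp (\<tau> - ln k)" by (rule exp_ge_add_one_self)
    then have "k * (1 + (\<tau> - ln k)) \<le> k * exp (\<tau> - ln k)" using k by (intro mult_left_mono) auto
    also have "\<dots> = exp \<tau>" using k by (simp add: exp_diff)
    finally have "k / 2 * (1 + (\<tau> - ln k)) \<le> exp \<tau> / 2" by simp
    moreover have "k / 2 * (1 + (\<tau> - ln k)) = k / 2 + k / 2 * \<tau> - k / 2 * ln k" by (simp only: algebra_simps)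
    moreover have "k / 2 * \<tau> = a * \<tau> + \<tau>" by (simp add: k_def field_simps)
    moreover have "a * (\<tau> + c) = a * \<tau> + a * c" by (simp only: algebra_simps)
    ultimately have "- exp \<tau> / 2 + b + a * (\<tau> + c) \<le> C - \<tau>" using k unfolding C_def by linarith
    then show "norm (exp (- exp \<tau> / 2 + b + a * (\<tau> + c))) \<le> norm (exp C * exp (- \<tau>))"
      by (simp flip: exp_add)
  qed
qed

lemma aw_entire_holomorphic: "aw_entire holomorphic_on UNIV"
proof -
  have 1: "(\<lambda>w. \<integral>\<tau>. awM w (of_real \<tau>) \<partial>pos_lborel) holomorphic_on UNIV"
  proof (rule holomorphic_on_parametric_integral)
    show "(\<lambda>\<tau>. awM w (of_real \<tau>)) \<in> borel_measurable pos_lborel" for w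
      by (intro borel_measurable_pos_lborel continuous_intros)
    fix w0 :: complex
    define R where "R = norm w0 + 1"
    have "norm (awM w (of_real \<tau>)) \<le> exp (- exp \<tau> / 2 + exp (2 * R) / 2 + exp R * (\<tau> + R))"
      if "w \<in> cball w0 1" "\<tau> \<in> space pos_lborel" for w \<tau>
    proof (rule norm_awM_le)
      show "norm w \<le> R" using that norm_triangle_sub[of w w0] by (simp add: R_def dist_norm norm_minus_commute)
    qed (use that in simp)
    then show "\<exists>r>0. \<exists>G. cball w0 r \<subseteq> UNIV \<and> integrable pos_lborel G \<and>
        (\<forall>w\<in>cball w0 r. \<forall>\<tau>\<in>space pos_lborel. norm (awM w (of_real \<tau>)) \<le> G \<tau>)"
      using integrable_awM_bound[of "exp R" "exp (2 * R) / 2" R]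
      by (intro exI[of _ 1] conjI exI[of _ "\<lambda>\<tau>. exp (- exp \<tau> / 2 + exp (2 * R) / 2 + exp R * (\<tau> + R))"]) auto
  qed (auto intro!: holomorphic_intros)
  let ?M = "restrict_space lborel {0<..<1::real}"
  have 2: "(\<lambda>w. \<integral>u. awM w (w * of_real u) \<partial>?M) holomorphic_on UNIV"
  proof (rule holomorphic_on_parametric_integral)
    show "(\<lambda>u. awM w (w * of_real u)) \<in> borel_measurable ?M" for w
      by (subst measurable_cong_sets[OF sets_restrict_space_cong[OF sets_lborel] refl])
        (intro borel_measurable_continuous_on_restrict continuous_intros)
    fix w0 :: complex
    have "compact ((\<lambda>(w, u). awM w (w * of_real u)) ` (cball w0 1 \<times> {0..1}))"
      by (intro compact_continuous_image compact_Times) (auto simp: case_prod_unfold intro!: continuous_intros)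
    then obtain B where B: "\<And>w u. w \<in> cball w0 1 \<Longrightarrow> u \<in> {0..1} \<Longrightarrow> norm (awM w (w * of_real u)) \<le> B"
      using compact_imp_bounded[THEN bounded_iff[THEN iffD1]] by fastforce
    have "integrable ?M (\<lambda>_. B)"
      by (subst integrable_restrict_space) auto
    then show "\<exists>r>0. \<exists>G. cball w0 r \<subseteq> UNIV \<and> integrable ?M G \<and>
        (\<forall>w\<in>cball w0 r. \<forall>u\<in>space ?M. norm (awM w (w * of_real u)) \<le> G u)"
      using B by (intro exI[of _ 1] conjI exI[of _ "\<lambda>_. B"]) (auto simp: space_restrict_space)
  qed (auto intro!: holomorphic_intros)
  show ?thesis unfolding aw_entire_def[abs_def] by (intro holomorphic_intros 1 2)
qed

text \<open>For \<open>u < 0\<close> the origin lies inside the path from \<open>u\<close> to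
  \<infinity>. With \<open>t = \<tau> - u\<close> the two parts of \<open>aw_entire\<close> become
  the integrals over \<open>t > - u\<close> and \<open>0 < t < - u\<close>, which add up.\<close>

lemma aw_entire_real_neg:
  assumes u: "u < 0"
  shows "aw_entire (of_real u) = 1 / of_real pi * (\<integral>t. exp (- exp (of_real u) * of_real (sinh t - t)) \<partial>pos_lborel)"
proof -
  define \<psi> where "\<psi> = (\<lambda>t. exp (- exp (complex_of_real u) * of_real (sinh t - t)))"
  define a where "a = - u"
  have a: "a > 0" using u by (simp add: a_def)
  have int: "integrable lborel (\<lambda>t. indicator {0<..} t *\<^sub>R \<psi> t)"
    using integrable_exp_awg[of "exp (of_real u)"]
    by (simp add: integrable_pos_lborel_iff set_integrable_def \<psi>_def Re_exp)
  have "{0<..<a} \<subseteq> {0<..}" by auto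
  then have int1: "integrable lborel (\<lambda>t. indicator {a<..} t *\<^sub>R \<psi> t)"
    "integrable lborel (\<lambda>t. indicator {0<..<a} t *\<^sub>R \<psi> t)"
    using set_integrable_subset[of lborel "{0<..}" \<psi> "{a<..}"] set_integrable_subset[of lborel "{0<..}" \<psi> "{0<..<a}"] int a
    by (auto simp: set_integrable_def)
  have M: "awM (of_real u) (of_real x) = \<psi> (x + a)" for x
    unfolding awM_eq \<psi>_def a_def by (simp flip: of_real_diff add: awg_of_real)
  have "(\<integral>\<tau>. awM (of_real u) (of_real \<tau>) \<partial>pos_lborel) = (\<integral>t. indicator {a<..} t *\<^sub>R \<psi> t \<partial>lborel)"
  proof -
    have "(\<integral>t. indicator {a<..} t *\<^sub>R \<psi> t \<partial>lborel) = (\<integral>x. indicator {a<..} (a + 1 * x) *\<^sub>R \<psi> (a + 1 * x) \<partial>lborel)"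
      by (subst lborel_integral_real_affine[of 1 _ a]) auto
    also have "\<dots> = (\<integral>x. indicator {0<..} x *\<^sub>R awM (of_real u) (of_real x) \<partial>lborel)"
      by (intro Bochner_Integration.integral_cong refl) (simp add: M indicator_def add.commute)
    finally show ?thesis by (simp add: integral_pos_lborel set_lebesgue_integral_def)
  qed
  moreover have "- of_real u * (\<integral>x. awM (of_real u) (of_real u * of_real x) \<partial>restrict_space lborel {0<..<1})
      = (\<integral>t. indicator {0<..<a} t *\<^sub>R \<psi> t \<partial>lborel)"
  proof -
    have "(\<integral>t. indicator {0<..<a} t *\<^sub>R \<psi> t \<partial>lborel)
        = \<bar>- a\<bar> *\<^sub>R (\<integral>x. indicator {0<..<a} (a + (- a) * x) *\<^sub>R \<psi> (a + (- a) * x) \<partial>lborel)"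
      using a by (intro lborel_integral_real_affine) simp
    also have "(\<integral>x. indicator {0<..<a} (a + (- a) * x) *\<^sub>R \<psi> (a + (- a) * x) \<partial>lborel)
        = (\<integral>x. indicator {0<..<1} x *\<^sub>R awM (of_real u) (of_real u * of_real x) \<partial>lborel)"
    proof (intro Bochner_Integration.integral_cong refl)
      fix x :: real
      have "indicator {0<..<a} (a + (- a) * x) = (indicator {0<..<1} x :: real)"
        using a by (auto simp: indicator_def mult_less_cancel_left2 zero_less_mult_iff)
      moreover have "awM (of_real u) (of_real u * of_real x) = \<psi> (a + (- a) * x)"
        using M[of "u * x"] by (simp add: a_def add.commute)
      ultimately show "indicator {0<..<a} (a + (- a) * x) *\<^sub>R \<psi> (a + (- a) * x)
          = indicator {0<..<1} x *\<^sub>R awM (of_real u) (of_real u * of_real x)" by simp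
    qed
    finally show ?thesis using a
      by (simp add: integral_restrict_space scaleR_conv_of_real a_def)
  qed
  ultimately have "aw_entire (of_real u) = 1 / of_real pi *
      ((\<integral>t. indicator {a<..} t *\<^sub>R \<psi> t \<partial>lborel) + (\<integral>t. indicator {0<..<a} t *\<^sub>R \<psi> t \<partial>lborel))"
    unfolding aw_entire_def by simp
  also have "(\<integral>t. indicator {a<..} t *\<^sub>R \<psi> t \<partial>lborel) + (\<integral>t. indicator {0<..<a} t *\<^sub>R \<psi> t \<partial>lborel)
      = (\<integral>t. indicator {a<..} t *\<^sub>R \<psi> t + indicator {0<..<a} t *\<^sub>R \<psi> t \<partial>lborel)"
    using int1 by simp
  also have "\<dots> = (\<integral>t. indicator {0<..} t *\<^sub>R \<psi> t \<partial>lborel)"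
  proof (rule integral_cong_AE)
    show "AE t in lborel. indicator {a<..} t *\<^sub>R \<psi> t + indicator {0<..<a} t *\<^sub>R \<psi> t = indicator {0<..} t *\<^sub>R \<psi> t"
      using AE_lborel_singleton[of a] by eventually_elim (use a in \<open>auto simp: indicator_def\<close>)
  qed (use int int1 in auto)
  finally show ?thesis by (simp add: integral_pos_lborel set_lebesgue_integral_def \<psi>_def)
qed

theorem aw_entire_eq_laplace:
  assumes "\<bar>Im w\<bar> < pi / 2"
  shows "aw_entire w = 1 / of_real pi * (\<integral>y. exp (- exp w * of_real (y ^ 3)) * awJ 0 (of_real y) \<partial>pos_lborel)"
proof (rule holomorphic_eq_on_strip[where a = 0 and b = "pi / 2" and F = aw_entire
      and G = "\<lambda>w. 1 / of_real pi * (\<integral>y. exp (- exp w * of_real (y ^ 3)) * awJ 0 (of_real y) \<partial>pos_lborel)"])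
  show "aw_entire holomorphic_on {w. \<bar>Im w - 0\<bar> < pi / 2}"
    by (rule holomorphic_on_subset[OF aw_entire_holomorphic]) simp
  have "(\<lambda>w. \<integral>y. exp (- exp w * of_real (y ^ 3)) * awJ 0 (of_real y) \<partial>pos_lborel) holomorphic_on {w. \<bar>Im w\<bar> < pi / 2}"
  proof (rule laplace_cubic_holomorphic)
    show "norm (awJ 0 (complex_of_real s)) \<le> aw_moment 0 * s ^ 0" if "s > 0" for s
      using norm_awJ_of_real_le[OF that] by simp
  qed (rule awJ_of_real_continuous)
  then show "(\<lambda>w. 1 / of_real pi * (\<integral>y. exp (- exp w * of_real (y ^ 3)) * awJ 0 (of_real y) \<partial>pos_lborel))
      holomorphic_on {w. \<bar>Im w - 0\<bar> < pi / 2}"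
    by (intro holomorphic_intros) simp
  fix u :: real assume u: "u < 0"
  have c: "Complex u 0 = of_real u" by (simp add: complex_eq_iff)
  have "Re (exp (complex_of_real u)) > 0" by (simp add: Re_exp)
  from laplace_substitution[OF this]
  show "aw_entire (Complex u 0) = 1 / of_real pi * (\<integral>y. exp (- exp (Complex u 0) * of_real (y ^ 3)) * awJ 0 (of_real y) \<partial>pos_lborel)"
    unfolding c aw_entire_real_neg[OF u] by simp
qed (use assms in simp)

text \<open>Existence and uniqueness behind the definite description. For uniqueness at a given
  \<open>w\<close> the identity theorem is used on a strip about the real axis wide enough to
  contain \<open>w\<close>.\<close>

lemma anger_weber_diag_eq: "anger_weber_diag = aw_entire"
  unfolding anger_weber_diag_def
proof (rule the_equality)
  have aw: "aw_entire w = anger_weber (- exp w) (exp w)" if "\<bar>Im w\<bar> < pi / 2" for w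
    unfolding aw_entire_eq_laplace[OF that] anger_weber_eq laplace_substitution[OF Re_exp_pos[OF that]] ..
  then show "aw_entire holomorphic_on UNIV \<and>
     (\<forall>w. \<bar>Im w\<bar> < pi / 2 \<longrightarrow> aw_entire w = anger_weber (- exp w) (exp w))"
    using aw_entire_holomorphic by blast
  fix F assume F: "F holomorphic_on UNIV \<and>
     (\<forall>w. \<bar>Im w\<bar> < pi / 2 \<longrightarrow> F w = anger_weber (- exp w) (exp w))"
  show "F = aw_entire"
  proof
    fix w
    show "F w = aw_entire w"
    proof (rule holomorphic_eq_on_strip[where F = F and G = aw_entire and a = 0 and b = "\<bar>Im w\<bar> + 1"])
      show "F (Complex u 0) = aw_entire (Complex u 0)" for u
        using F aw[of "Complex u 0"] by simp
    qed (use F aw_entire_holomorphic in \<open>auto intro: holomorphic_on_subset\<close>)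
  qed
qed


subsection \<open>Bounds for the remainder\<close>

lemma integral_pos_lborel_scale:
  fixes f :: "real \<Rightarrow> 'b :: {banach, second_countable_topology}"
  assumes "c > 0"
  shows "integral\<^sup>L pos_lborel f = c *\<^sub>R (\<integral>x. f (c * x) \<partial>pos_lborel)"
proof -
  have "(\<integral>x. indicator {0<..} x *\<^sub>R f x \<partial>lborel)
      = \<bar>c\<bar> *\<^sub>R (\<integral>x. indicator {0<..} (0 + c * x) *\<^sub>R f (0 + c * x) \<partial>lborel)"
    using assms by (intro lborel_integral_real_affine) simp
  also have "(\<integral>x. indicator {0<..} (0 + c * x) *\<^sub>R f (0 + c * x) \<partial>lborel)
      = (\<integral>x. indicator {0<..} x *\<^sub>R f (c * x) \<partial>lborel)"
    using assms by (intro Bochner_Integration.integral_cong refl) (simp add: indicator_def zero_less_mult_iff)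
  finally show ?thesis using assms by (simp add: integral_pos_lborel set_lebesgue_integral_def)
qed

text \<open>\<open>awJ_expansion\<close> is integrated against the exponential: by
  \<open>aw_coeff_eq\<close> and \<open>cubic_gamma_complex\<close> the polynomial part gives
  precisely the subtracted sum, so the rest is an exact formula.\<close>

lemma remainder_laplace:
  assumes w: "\<bar>Im w\<bar> < pi / 2"
  shows "aw_remainder N w = (-1) ^ N / of_real pi *
     (\<integral>s. exp (- exp w * of_real (s ^ 3)) * (of_real (s ^ (2 * N)) * awJ N (of_real s)) \<partial>pos_lborel)"
proof -
  define e where "e = (\<lambda>s. exp (- exp w * complex_of_real (s ^ 3)))"
  define h where "h = (\<lambda>s. complex_of_real (s ^ (2 * N)) * awJ N (of_real s))"
  have \<nu>: "Re (exp w) > 0" by (rule Re_exp_pos[OF w])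
  have I1: "integrable pos_lborel (\<lambda>s. e s * of_real (s ^ (2 * n)))" for n
    unfolding e_def
    by (rule integrable_laplace_cubic[OF \<nu>, where C = 1 and k = "2 * n"]) (auto intro!: continuous_intros simp: norm_power)
  have I2: "integrable pos_lborel (\<lambda>s. e s * h s)"
    unfolding e_def h_def
  proof (rule integrable_laplace_cubic[OF \<nu>, where C = "aw_moment N" and k = "2 * N"])
    show "continuous_on {0<..} (\<lambda>s. complex_of_real (s ^ (2 * N)) * awJ N (of_real s))"
      by (intro continuous_on_mult awJ_of_real_continuous continuous_intros)
    fix s :: real assume s: "s > 0"
    have "norm (of_real (s ^ (2 * N)) * awJ N (of_real s)) = s ^ (2 * N) * norm (awJ N (of_real s))"
      using s by (simp add: norm_mult norm_power)
    also have "\<dots> \<le> s ^ (2 * N) * aw_moment N"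
      using s norm_awJ_of_real_le[OF s] by (intro mult_left_mono) auto
    finally show "norm (of_real (s ^ (2 * N)) * awJ N (of_real s)) \<le> aw_moment N * s ^ (2 * N)"
      by (simp add: mult.commute)
  qed
  have G: "(\<integral>s. e s * of_real (s ^ (2 * n)) \<partial>pos_lborel)
      = of_real (Gamma (real (2 * n + 1) / 3) / 3) / exp (of_real (real (2 * n + 1) / 3) * w)" for n
    unfolding e_def by (simp only: cubic_gamma_complex[OF w] exp_minus divide_inverse)
  have "(\<integral>s. e s * awJ 0 (of_real s) \<partial>pos_lborel)
     = (\<integral>s. (\<Sum>n<N. of_real (aw_coeff n) * (e s * of_real (s ^ (2 * n))))
          + (-1) ^ N * (e s * h s) \<partial>pos_lborel)"
  proof (rule Bochner_Integration.integral_cong[OF refl])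
    fix s assume "s \<in> space pos_lborel"
    then have "complex_of_real s \<in> awdom" by (intro Re_in_awdom) simp
    from awJ_expansion[OF this, of N]
    show "e s * awJ 0 (of_real s) = (\<Sum>n<N. of_real (aw_coeff n) * (e s * of_real (s ^ (2 * n))))
          + (-1) ^ N * (e s * h s)"
      by (simp add: aw_coeff_eq distrib_left sum_distrib_left mult_ac h_def)
  qed
  also have "\<dots> = (\<Sum>n<N. of_real (aw_coeff n) * (\<integral>s. e s * of_real (s ^ (2 * n)) \<partial>pos_lborel))
          + (-1) ^ N * (\<integral>s. e s * h s \<partial>pos_lborel)"
    using I1 I2 by (subst Bochner_Integration.integral_add) auto
  finally have E: "(\<integral>s. e s * awJ 0 (of_real s) \<partial>pos_lborel)
     = (\<Sum>n<N. of_real (aw_coeff n) * (\<integral>s. e s * of_real (s ^ (2 * n)) \<partial>pos_lborel))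
          + (-1) ^ N * (\<integral>s. e s * h s \<partial>pos_lborel)" .
  have es: "exp (- exp w * complex_of_real (s ^ 3)) = e s" for s by (simp only: e_def)
  have "aw_entire w = 1 / of_real pi *
      ((\<Sum>n<N. of_real (aw_coeff n) * (of_real (Gamma (real (2 * n + 1) / 3) / 3) / exp (of_real (real (2 * n + 1) / 3) * w)))
          + (-1) ^ N * (\<integral>s. e s * h s \<partial>pos_lborel))"
    by (simp only: aw_entire_eq_laplace[OF w] es E G)
  also have "\<dots> = 1 / (3 * of_real pi) * (\<Sum>n<N. of_real (aw_coeff n) * of_real (Gamma (real (2 * n + 1) / 3))
                 / exp (of_real (real (2 * n + 1) / 3) * w))
       + (-1) ^ N / of_real pi * (\<integral>s. e s * h s \<partial>pos_lborel)"
  proof -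
    have "(\<Sum>n<N. of_real (aw_coeff n) * (of_real (Gamma (real (2 * n + 1) / 3) / 3) / exp (of_real (real (2 * n + 1) / 3) * w)))
       = 1 / 3 * (\<Sum>n<N. of_real (aw_coeff n) * of_real (Gamma (real (2 * n + 1) / 3))
                 / exp (of_real (real (2 * n + 1) / 3) * w))"
      unfolding sum_distrib_left by (intro sum.cong refl) simp
    moreover have "1 / of_real pi * (1 / 3 * X + (-1) ^ N * Y) = 1 / (3 * of_real pi) * X + (-1) ^ N / of_real pi * Y"
      for X Y :: complex by (simp add: field_simps)
    ultimately show ?thesis by (simp only:)
  qed
  finally show ?thesis unfolding aw_remainder_def anger_weber_diag_eq es by (simp only: add_diff_cancel_left' h_def)
qed

section \<open>Rotated rays of integration\<close>

text \<open>The origin of \<open>3 * pi / 2\<close> and of the angle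
  \<open>2 / 3 * \<theta>\<close>: a third of the argument must stay below \<open>pi / 2\<close> for
  the ray to lie in the half-plane, and the kernel contains the square.\<close>

lemma awJ_ray:
  assumes \<zeta>: "\<bar>Im \<zeta>\<bar> < 3 * pi / 2" and s: "s > 0"
  shows "of_real s * exp (- \<zeta> / 3) \<in> awdom"
    and "1 + (of_real s * exp (- \<zeta> / 3) / of_real (eta x))\<^sup>2
       = 1 + of_real ((s * exp (- Re \<zeta> / 3) / eta x)\<^sup>2) * cis (- (2 / 3 * Im \<zeta>))"
proof -
  have pol: "exp (- \<zeta> / 3) = of_real (exp (- Re \<zeta> / 3)) * cis (- Im \<zeta> / 3)"
    using exp_eq_polar[of "- \<zeta> / 3"] by simp
  have "cos (- Im \<zeta> / 3) > 0" using \<zeta> by (intro cos_gt_zero_pi) (auto simp: abs_less_iff)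
  then show "of_real s * exp (- \<zeta> / 3) \<in> awdom"
    unfolding pol using s by (intro Re_in_awdom) simp
  have "(cis (- Im \<zeta> / 3))\<^sup>2 = cis (- (2 / 3 * Im \<zeta>))" by (simp add: power2_eq_square cis_mult)
  then show "1 + (of_real s * exp (- \<zeta> / 3) / of_real (eta x))\<^sup>2
       = 1 + of_real ((s * exp (- Re \<zeta> / 3) / eta x)\<^sup>2) * cis (- (2 / 3 * Im \<zeta>))"
    unfolding pol by (simp add: power_mult_distrib power_divide)
qed

lemma norm_awJ_ray:
  assumes \<zeta>: "\<bar>Im \<zeta>\<bar> < 3 * pi / 2" and s: "s > 0" and \<kappa>: "\<kappa> > 0"
    "\<And>x. x \<ge> 0 \<Longrightarrow> \<kappa> \<le> norm (1 + of_real x * cis (- (2 / 3 * Im \<zeta>)))"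
  shows "norm (awJ N (of_real s * exp (- \<zeta> / 3))) \<le> aw_moment N / \<kappa>"
proof (rule norm_awJ_le[OF awJ_ray(1)[OF \<zeta> s] \<kappa>(1)])
  show "\<kappa> \<le> norm (1 + (of_real s * exp (- \<zeta> / 3) / of_real (eta x))\<^sup>2)" for x
    unfolding awJ_ray(2)[OF \<zeta> s] by (rule \<kappa>(2)) simp
qed

text \<open>The result of putting \<open>y = s * exp (- (w - \<i> * \<phi>) / 3)\<close>, for which
  \<open>exp w * y ^ 3 = cis \<phi> * s ^ 3\<close>. The exponential then depends on \<phi> alone,
  and all dependence on \<open>w\<close> sits in the argument of \<open>awJ\<close>, which permits
  \<open>\<bar>Im w - \<phi>\<bar> < 3 * pi / 2\<close>.\<close>

definition rot_integrand :: "nat \<Rightarrow> real \<Rightarrow> complex \<Rightarrow> real \<Rightarrow> complex" where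
  "rot_integrand N \<phi> w s = exp (- cis \<phi> * of_real (s ^ 3)) *
     (of_real (s ^ (2 * N)) * awJ N (of_real s * exp (- (w - \<i> * of_real \<phi>) / 3)))"

lemma norm_rot_integrand_le:
  assumes w: "\<bar>Im w - \<phi>\<bar> < 3 * pi / 2" and s: "s > 0" and \<kappa>: "\<kappa> > 0"
    "\<And>x. x \<ge> 0 \<Longrightarrow> \<kappa> \<le> norm (1 + of_real x * cis (- (2 / 3 * (Im w - \<phi>))))"
  shows "norm (rot_integrand N \<phi> w s) \<le> aw_moment N / \<kappa> * (s ^ (2 * N) * exp (- cos \<phi> * s ^ 3))"
proof -
  have "norm (awJ N (of_real s * exp (- (w - \<i> * of_real \<phi>) / 3))) \<le> aw_moment N / \<kappa>"
    using w s \<kappa> by (intro norm_awJ_ray) auto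
  then have "norm (rot_integrand N \<phi> w s) \<le> exp (- cos \<phi> * s ^ 3) * (s ^ (2 * N) * (aw_moment N / \<kappa>))"
    unfolding rot_integrand_def norm_mult norm_exp_mult_real
    using s by (intro mult_mono mult_nonneg_nonneg) (auto simp: norm_power)
  then show ?thesis by (simp add: mult_ac)
qed

lemma rot_integrand_measurable:
  assumes w: "\<bar>Im w - \<phi>\<bar> < 3 * pi / 2"
  shows "rot_integrand N \<phi> w \<in> borel_measurable pos_lborel"
proof -
  have "continuous_on {0<..} (\<lambda>s. awJ N (of_real s * exp (- (w - \<i> * of_real \<phi>) / 3)))"
    using awJ_ray(1)[of "w - \<i> * of_real \<phi>"] w
    by (intro continuous_on_compose2[OF holomorphic_on_imp_continuous_on[OF awJ_holomorphic]] continuous_intros) auto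
  then show ?thesis
    unfolding rot_integrand_def[abs_def] by (intro borel_measurable_pos_lborel continuous_intros)
qed

lemma rotated_integral_holomorphic:
  assumes \<phi>: "\<bar>\<phi>\<bar> < pi / 2"
  shows "(\<lambda>w. \<integral>s. rot_integrand N \<phi> w s \<partial>pos_lborel) holomorphic_on {w. \<bar>Im w - \<phi>\<bar> < 3 * pi / 2}"
proof (rule holomorphic_on_parametric_integral)
  show "open {w. \<bar>Im w - \<phi>\<bar> < 3 * pi / 2}" by (intro open_Collect_less continuous_intros)
  fix s assume "s \<in> space pos_lborel"
  then have s: "s > 0" by simp
  have "(\<lambda>w. of_real s * exp (- (w - \<i> * of_real \<phi>) / 3)) holomorphic_on {w. \<bar>Im w - \<phi>\<bar> < 3 * pi / 2}"
    by (intro holomorphic_intros) auto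
  then have "(awJ N \<circ> (\<lambda>w. of_real s * exp (- (w - \<i> * of_real \<phi>) / 3))) holomorphic_on {w. \<bar>Im w - \<phi>\<bar> < 3 * pi / 2}"
  proof (rule holomorphic_on_compose_gen[OF _ awJ_holomorphic])
    show "(\<lambda>w. of_real s * exp (- (w - \<i> * of_real \<phi>) / 3)) ` {w. \<bar>Im w - \<phi>\<bar> < 3 * pi / 2} \<subseteq> awdom"
    proof (rule image_subsetI)
      fix w assume "w \<in> {w. \<bar>Im w - \<phi>\<bar> < 3 * pi / 2}"
      then show "of_real s * exp (- (w - \<i> * of_real \<phi>) / 3) \<in> awdom"
        by (intro awJ_ray(1) s) simp
    qed
  qed
  then show "(\<lambda>w. rot_integrand N \<phi> w s) holomorphic_on {w. \<bar>Im w - \<phi>\<bar> < 3 * pi / 2}"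
    unfolding rot_integrand_def by (intro holomorphic_intros) (simp add: o_def)
next
  fix w0 assume w0: "w0 \<in> {w. \<bar>Im w - \<phi>\<bar> < 3 * pi / 2}"
  define d where "d = 3 * pi / 2 - \<bar>Im w0 - \<phi>\<bar>"
  have d: "d > 0" "d \<le> 3 * pi / 2" using w0 by (auto simp: d_def)
  have im: "\<bar>Im w - \<phi>\<bar> \<le> 3 * pi / 2 - d / 2" if "w \<in> cball w0 (d / 2)" for w
  proof -
    have "\<bar>Im (w0 - w)\<bar> \<le> d / 2" using that abs_Im_le_cmod[of "w0 - w"] by (simp add: dist_norm)
    moreover have "Im (w0 - w) = Im w0 - Im w" by simp
    moreover have "\<bar>Im w0 - \<phi>\<bar> = 3 * pi / 2 - d" by (simp add: d_def)
    ultimately show ?thesis by linarith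
  qed
  \<comment> \<open>Two thirds of the distance \<open>d / 2\<close> that is kept from
    \<open>3 * pi / 2\<close>.\<close>
  define \<kappa> where "\<kappa> = sin (d / 3)"
  have \<kappa>: "\<kappa> > 0" unfolding \<kappa>_def using d by (intro sin_gt_zero) auto
  have c: "cos \<phi> > 0" using \<phi> by (intro cos_gt_zero_pi) auto
  have "norm (rot_integrand N \<phi> w s) \<le> aw_moment N / \<kappa> * (s ^ (2 * N) * exp (- cos \<phi> * s ^ 3))"
    if w: "w \<in> cball w0 (d / 2)" and s: "s \<in> space pos_lborel" for w s
  proof (rule norm_rot_integrand_le[OF _ _ \<kappa>])
    show "\<bar>Im w - \<phi>\<bar> < 3 * pi / 2" using im[OF w] d by linarith
    show "\<kappa> \<le> norm (1 + of_real x * cis (- (2 / 3 * (Im w - \<phi>))))" if "x \<ge> 0" for x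
      unfolding \<kappa>_def
    proof (rule norm_one_plus_cis_ge[OF that])
      have "\<bar>- (2 / 3 * (Im w - \<phi>))\<bar> = 2 / 3 * \<bar>Im w - \<phi>\<bar>" by (simp only: abs_minus_cancel abs_mult)
      then show "\<bar>- (2 / 3 * (Im w - \<phi>))\<bar> \<le> pi - d / 3" using im[OF w] by (simp add: field_simps)
    qed (use d in auto)
  qed (use s in simp)
  moreover have "integrable pos_lborel (\<lambda>s. aw_moment N / \<kappa> * (s ^ (2 * N) * exp (- cos \<phi> * s ^ 3)))"
    using integral_cubic_exp[OF c, of "2 * N"] by (intro integrable_mult_right) (simp add: has_bochner_integral_iff)
  moreover have "cball w0 (d / 2) \<subseteq> {w. \<bar>Im w - \<phi>\<bar> < 3 * pi / 2}" using im d by force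
  ultimately show "\<exists>r>0. \<exists>G. cball w0 r \<subseteq> {w. \<bar>Im w - \<phi>\<bar> < 3 * pi / 2} \<and> integrable pos_lborel G \<and>
      (\<forall>w\<in>cball w0 r. \<forall>s\<in>space pos_lborel. norm (rot_integrand N \<phi> w s) \<le> G s)"
    using d by (intro exI[of _ "d / 2"] conjI exI[of _ "\<lambda>s. aw_moment N / \<kappa> * (s ^ (2 * N) * exp (- cos \<phi> * s ^ 3))"]) auto
qed (auto intro: rot_integrand_measurable)

lemma aw_remainder_holomorphic: "aw_remainder N holomorphic_on A"
  unfolding aw_remainder_def[abs_def] anger_weber_diag_eq
  by (intro holomorphic_intros holomorphic_on_subset[OF aw_entire_holomorphic]) auto

text \<open>On the line \<open>Im w = \<phi>\<close> the rotated integral is the Laplace integral rescaled by a positive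
  factor, so no rotation of contours is needed.\<close>

theorem remainder_rotated:
  assumes \<phi>: "\<bar>\<phi>\<bar> < pi / 2" and w: "\<bar>Im w - \<phi>\<bar> < 3 * pi / 2"
  shows "aw_remainder N w = (-1) ^ N / of_real pi * (exp (- (of_real (real (2 * N + 1) / 3) * (w - \<i> * of_real \<phi>)))
     * (\<integral>s. rot_integrand N \<phi> w s \<partial>pos_lborel))" (is "_ = ?G w")
proof (rule holomorphic_eq_on_strip[where a = \<phi> and b = "3 * pi / 2" and F = "aw_remainder N" and
      G = ?G])
  show "aw_remainder N holomorphic_on {w. \<bar>Im w - \<phi>\<bar> < 3 * pi / 2}" by (rule aw_remainder_holomorphic)
  show "(\<lambda>w. ?G w) holomorphic_on {w. \<bar>Im w - \<phi>\<bar> < 3 * pi / 2}"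
    by (intro holomorphic_intros rotated_integral_holomorphic \<phi>) auto
  fix u :: real
  define c where "c = exp (u / 3)"
  have c: "c > 0" by (simp add: c_def)
  have c3: "c ^ 3 = exp u" by (simp add: c_def flip: exp_of_nat_mult)
  have ci: "c * exp (- u / 3) = 1" by (simp add: c_def flip: exp_add)
  define K where "K = (\<lambda>s. exp (- exp (Complex u \<phi>) * of_real (s ^ 3)) * (of_real (s ^ (2 * N)) * awJ N (of_real s)))"
  have z: "Complex u \<phi> - \<i> * of_real \<phi> = of_real u" by (simp add: complex_eq_iff)
  have "rot_integrand N \<phi> (Complex u \<phi>) (c * s) = of_real (c ^ (2 * N)) * K s" for s
  proof -
    have A: "of_real (c * s) * exp (- complex_of_real u / 3) = complex_of_real s"
    proof -
      have "- complex_of_real u / 3 = of_real (- u / 3)" by simp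
      then have "of_real (c * s) * exp (- complex_of_real u / 3) = of_real (c * exp (- u / 3) * s)"
        by (simp only: exp_of_real of_real_mult mult_ac)
      then show ?thesis unfolding ci by simp
    qed
    have B: "cis \<phi> * of_real ((c * s) ^ 3) = exp (Complex u \<phi>) * of_real (s ^ 3)"
      unfolding power_mult_distrib c3 exp_eq_polar by simp
    show ?thesis
      unfolding rot_integrand_def z K_def mult_minus_left A B by (simp add: power_mult_distrib)
  qed
  then have R: "(\<integral>s. rot_integrand N \<phi> (Complex u \<phi>) s \<partial>pos_lborel) = of_real (c * c ^ (2 * N)) * (\<integral>s. K s \<partial>pos_lborel)"
    by (subst integral_pos_lborel_scale[OF c]) (simp add: scaleR_conv_of_real)
  have E: "exp (- (of_real (real (2 * N + 1) / 3) * (Complex u \<phi> - \<i> * of_real \<phi>))) * of_real (c * c ^ (2 * N)) = (1 :: complex)"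
  proof -
    have "c * c ^ (2 * N) = exp (real (2 * N + 1) / 3 * u)"
      unfolding c_def exp_of_nat_mult[symmetric] exp_add[symmetric] by (simp add: field_simps)
    moreover have "exp (- (of_real (real (2 * N + 1) / 3) * complex_of_real u)) = of_real (exp (- (real (2 * N + 1) / 3 * u)))"
      unfolding exp_of_real[symmetric] by (simp only: of_real_mult of_real_minus)
    ultimately show ?thesis unfolding z by (simp only: of_real_mult[symmetric] exp_add[symmetric]) simp
  qed
  have "exp (- (of_real (real (2 * N + 1) / 3) * (Complex u \<phi> - \<i> * of_real \<phi>)))
     * (\<integral>s. rot_integrand N \<phi> (Complex u \<phi>) s \<partial>pos_lborel) = (\<integral>s. K s \<partial>pos_lborel)"
    by (simp only: R E mult.assoc[symmetric] mult_1)
  then show "aw_remainder N (Complex u \<phi>) = ?G (Complex u \<phi>)"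
    using remainder_laplace[of "Complex u \<phi>" N] \<phi> by (simp add: K_def)
qed (rule w)

text \<open>The common source of both bounds: \<open>\<kappa>\<close> controls the denominator of
  the kernel, and the power of \<open>cos \<phi>\<close> is the price of the slower decay on the
  rotated ray. For (a) the angle \<phi> is 0.\<close>

lemma norm_remainder_le:
  assumes r: "r > 0" and \<phi>: "\<bar>\<phi>\<bar> < pi / 2" and \<theta>: "\<bar>\<theta> - \<phi>\<bar> < 3 * pi / 2" and \<kappa>: "\<kappa> > 0"
    "\<And>x. x \<ge> 0 \<Longrightarrow> \<kappa> \<le> norm (1 + of_real x * cis (- (2 / 3 * (\<theta> - \<phi>))))"
  shows "norm (aw_remainder N (surface_point r \<theta>)) \<le>
    1 / (3 * pi) * \<bar>aw_coeff N\<bar> * (Gamma (real (2 * N + 1) / 3) / r powr (real (2 * N + 1) / 3))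
      * (1 / (\<kappa> * cos \<phi> powr (real (2 * N + 1) / 3)))"
proof -
  define p where "p = real (2 * N + 1) / 3"
  define w where "w = surface_point r \<theta>"
  have w: "Re w = ln r" "Im w = \<theta>" by (simp_all add: w_def surface_point_def)
  have c: "cos \<phi> > 0" using \<phi> by (intro cos_gt_zero_pi) auto
  have w': "\<bar>Im w - \<phi>\<bar> < 3 * pi / 2" using \<theta> by (simp add: w)
  have J: "has_bochner_integral pos_lborel (\<lambda>s. aw_moment N / \<kappa> * (s ^ (2 * N) * exp (- cos \<phi> * s ^ 3)))
      (aw_moment N / \<kappa> * (Gamma p / (3 * cos \<phi> powr p)))"
    using integral_cubic_exp[OF c, of "2 * N"] unfolding p_def by (intro has_bochner_integral_mult_right)
  have bd: "norm (rot_integrand N \<phi> w s) \<le> aw_moment N / \<kappa> * (s ^ (2 * N) * exp (- cos \<phi> * s ^ 3))"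
    if "s \<in> space pos_lborel" for s
    using that \<kappa> w w' by (intro norm_rot_integrand_le) auto
  have int: "integrable pos_lborel (rot_integrand N \<phi> w)"
  proof (rule Bochner_Integration.integrable_bound)
    show "integrable pos_lborel (\<lambda>s. aw_moment N / \<kappa> * (s ^ (2 * N) * exp (- cos \<phi> * s ^ 3)))"
      using J by (simp only: has_bochner_integral_iff)
    show "AE s in pos_lborel. norm (rot_integrand N \<phi> w s) \<le> norm (aw_moment N / \<kappa> * (s ^ (2 * N) * exp (- cos \<phi> * s ^ 3)))"
      using bd by (intro AE_I2) (metis abs_ge_self order.trans real_norm_def)
  qed (rule rot_integrand_measurable[OF w'])
  have "norm (\<integral>s. rot_integrand N \<phi> w s \<partial>pos_lborel) \<le> (\<integral>s. aw_moment N / \<kappa> * (s ^ (2 * N) * exp (- cos \<phi> * s ^ 3)) \<partial>pos_lborel)"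
    using J int bd by (intro Bochner_Integration.integral_norm_bound_integral) (auto simp only: has_bochner_integral_iff)
  also have "\<dots> = aw_moment N / \<kappa> * (Gamma p / (3 * cos \<phi> powr p))" using J by (simp only: has_bochner_integral_iff)
  finally have B: "norm (\<integral>s. rot_integrand N \<phi> w s \<partial>pos_lborel) \<le> aw_moment N / \<kappa> * (Gamma p / (3 * cos \<phi> powr p))" .
  have "norm (exp (- (of_real p * (w - \<i> * of_real \<phi>)))) = 1 / r powr p"
    using r by (simp only: norm_exp_eq_Re) (simp add: w powr_def exp_minus divide_inverse)
  then have "norm (aw_remainder N w) = 1 / pi * (1 / r powr p * norm (\<integral>s. rot_integrand N \<phi> w s \<partial>pos_lborel))"
    unfolding remainder_rotated[OF \<phi> w'] p_def[symmetric] norm_mult by (simp add: norm_divide norm_power)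
  also have "\<dots> \<le> 1 / pi * (1 / r powr p * (aw_moment N / \<kappa> * (Gamma p / (3 * cos \<phi> powr p))))"
    using B by (intro mult_left_mono) auto
  also have "\<dots> = 1 / (3 * pi) * \<bar>aw_coeff N\<bar> * (Gamma p / r powr p) * (1 / (\<kappa> * cos \<phi> powr p))"
    using aw_moment_pos[of N] by (simp add: aw_coeff_eq abs_mult)
  finally show ?thesis by (simp only: w_def p_def)
qed

section \<open>The three estimates\<close>

text \<open>At \<open>\<bar>\<theta>\<bar> = 3 * pi / 4\<close> the angle
  \<open>2 / 3 * \<theta>\<close> reaches \<open>pi / 2\<close> in modulus. Up to there the kernel
  denominator has real part at least 1; beyond it only the distance
  \<open>\<bar>sin (2 / 3 * \<theta>)\<bar>\<close> to a line is left.\<close>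

lemma remainder_bound_a:
  assumes r: "r > 0" and \<theta>: "\<bar>\<theta>\<bar> < 3 * pi / 2"
  shows "norm (aw_remainder N (surface_point r \<theta>)) \<le>
    1 / (3 * pi) * \<bar>aw_coeff N\<bar> * (Gamma (real (2 * N + 1) / 3) / r powr (real (2 * N + 1) / 3))
      * (if 3 * pi / 4 < \<bar>\<theta>\<bar> then \<bar>1 / sin (2 / 3 * \<theta>)\<bar> else 1)"
proof (cases "3 * pi / 4 < \<bar>\<theta>\<bar>")
  case True
  define \<delta> where "\<delta> = pi - 2 / 3 * \<bar>\<theta>\<bar>"
  have \<delta>: "0 < \<delta>" "\<delta> \<le> pi / 2" using True \<theta> by (simp_all add: \<delta>_def field_simps)
  have s: "\<bar>sin (2 / 3 * \<theta>)\<bar> = sin \<delta>"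
  proof -
    have "sin (2 / 3 * \<bar>\<theta>\<bar>) = sin \<delta>" by (simp add: \<delta>_def)
    moreover have "\<bar>sin (2 / 3 * \<theta>)\<bar> = \<bar>sin (2 / 3 * \<bar>\<theta>\<bar>)\<bar>" by (cases "\<theta> \<ge> 0") auto
    moreover have "sin \<delta> > 0" using \<delta> by (intro sin_gt_zero) auto
    ultimately show ?thesis by simp
  qed
  have sp: "sin \<delta> > 0" using \<delta> by (intro sin_gt_zero) auto
  have "\<bar>- (2 / 3 * (\<theta> - 0))\<bar> = 2 / 3 * \<bar>\<theta>\<bar>" by (simp add: abs_mult)
  then have "sin \<delta> \<le> norm (1 + of_real x * cis (- (2 / 3 * (\<theta> - 0))))" if "x \<ge> 0" for x
    using \<delta> that by (intro norm_one_plus_cis_ge) (auto simp: \<delta>_def)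
  from norm_remainder_le[OF r _ _ sp this, of N] \<theta>
  show ?thesis using True by (simp only: if_True abs_divide s) simp
next
  case False
  have "cos (- (2 / 3 * (\<theta> - 0))) \<ge> 0"
  proof (rule cos_ge_zero)
    have "\<theta> \<le> 3 * pi / 4" "- \<theta> \<le> 3 * pi / 4" using False by auto
    then show "- (pi / 2) \<le> - (2 / 3 * (\<theta> - 0))" "- (2 / 3 * (\<theta> - 0)) \<le> pi / 2" by (simp_all add: field_simps)
  qed
  then have "1 \<le> norm (1 + of_real x * cis (- (2 / 3 * (\<theta> - 0))))" if "x \<ge> 0" for x
    using that by (intro norm_one_plus_cis_ge_one)
  from norm_remainder_le[OF r _ _ zero_less_one this, of N] \<theta>
  show ?thesis using False by simp
qed

text \<open>\<Xi> is the weighted mean of \<open>awJ N s / aw_moment N\<close> with the positive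
  weight \<open>g\<close>; \<open>awJ_real\<close> keeps this quotient strictly between 0 and
  1.\<close>

lemma remainder_positive_argument:
  assumes \<nu>: "\<nu> > 0"
  shows "\<exists>\<Xi>. 0 < \<Xi> \<and> \<Xi> < 1 \<and> aw_remainder N (surface_point \<nu> 0) =
      complex_of_real (1 / (3 * pi) * aw_coeff N
        * (Gamma (real (2 * N + 1) / 3) / \<nu> powr (real (2 * N + 1) / 3)) * \<Xi>)"
proof -
  define p where "p = real (2 * N + 1) / 3"
  define w where "w = surface_point \<nu> 0"
  have w: "w = of_real (ln \<nu>)" by (simp add: w_def surface_point_def complex_eq_iff)
  have ew: "exp w = of_real \<nu>" using \<nu> by (simp add: w exp_of_real)
  define g where "g = (\<lambda>s. s ^ (2 * N) * exp (- \<nu> * s ^ 3))"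
  define I where "I = Gamma p / (3 * \<nu> powr p)"
  have g: "integrable pos_lborel g" "integral\<^sup>L pos_lborel g = I"
    using integral_cubic_exp[OF \<nu>, of "2 * N"] unfolding has_bochner_integral_iff g_def I_def p_def by auto
  have I: "I > 0" using \<nu> by (simp add: I_def p_def Gamma_real_pos)
  define h where "h = (\<lambda>s. g s * Re (awJ N (of_real s)))"
  have gpos: "g s > 0" if "s > 0" for s using that by (simp add: g_def)
  have hb: "0 < h s" "h s < aw_moment N * g s" if "s > 0" for s
    using awJ_real(2,3)[OF that, of N] gpos[OF that] by (simp_all add: h_def mult.commute)
  have hint: "integrable pos_lborel h"
  proof (rule Bochner_Integration.integrable_bound)
    show "integrable pos_lborel (\<lambda>s. aw_moment N * g s)" by (intro integrable_mult_right g)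
    have "continuous_on {0<..} (\<lambda>s. Re (awJ N (of_real s)))"
      by (intro continuous_on_Re awJ_of_real_continuous)
    then have "continuous_on {0<..} h"
      unfolding h_def g_def by (rule continuous_on_mult[rotated]) (intro continuous_intros)
    then show "h \<in> borel_measurable pos_lborel" by (rule borel_measurable_pos_lborel)
    show "AE s in pos_lborel. norm (h s) \<le> norm (aw_moment N * g s)"
    proof (rule AE_I2)
      fix s assume "s \<in> space pos_lborel"
      then show "norm (h s) \<le> norm (aw_moment N * g s)" using hb[of s] by simp
    qed
  qed
  define H where "H = integral\<^sup>L pos_lborel h"
  have "integral\<^sup>L pos_lborel (\<lambda>s. 0) < H"
    unfolding H_def using hint hb by (intro integral_pos_lborel_less) auto
  then have H0: "0 < H" by simp
  have "H < integral\<^sup>L pos_lborel (\<lambda>s. aw_moment N * g s)"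
    unfolding H_def using hint hb g by (intro integral_pos_lborel_less) auto
  then have H1: "H < aw_moment N * I" using g by simp
  have "aw_remainder N w = (-1) ^ N / of_real pi *
     (\<integral>s. exp (- exp w * of_real (s ^ 3)) * (of_real (s ^ (2 * N)) * awJ N (of_real s)) \<partial>pos_lborel)"
    by (rule remainder_laplace) (simp add: w)
  also have "(\<integral>s. exp (- exp w * of_real (s ^ 3)) * (of_real (s ^ (2 * N)) * awJ N (of_real s)) \<partial>pos_lborel)
     = (\<integral>s. complex_of_real (h s) \<partial>pos_lborel)"
  proof (rule Bochner_Integration.integral_cong[OF refl])
    fix s assume "s \<in> space pos_lborel"
    then have s: "s > 0" by simp
    have "exp (- exp w * complex_of_real (s ^ 3)) = of_real (exp (- \<nu> * s ^ 3))"
      unfolding ew by (simp add: exp_of_real flip: of_real_mult of_real_minus of_real_power)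
    then show "exp (- exp w * of_real (s ^ 3)) * (of_real (s ^ (2 * N)) * awJ N (of_real s)) = complex_of_real (h s)"
      by (subst awJ_real(1)[OF s]) (simp add: h_def g_def mult_ac)
  qed
  also have "\<dots> = of_real H" by (simp add: H_def)
  finally have R: "aw_remainder N w = complex_of_real ((-1) ^ N / pi * H)" by simp
  define \<Xi> where "\<Xi> = H / (aw_moment N * I)"
  have m: "aw_moment N > 0" by (rule aw_moment_pos)
  have "0 < \<Xi>" "\<Xi> < 1" using H0 H1 m I by (simp_all add: \<Xi>_def)
  moreover have "(-1) ^ N / pi * H = 1 / (3 * pi) * aw_coeff N * (Gamma p / \<nu> powr p) * \<Xi>"
  proof -
    have "Gamma p / \<nu> powr p = 3 * I" by (simp add: I_def)
    moreover have "aw_moment N * I * \<Xi> = H" using m I by (simp add: \<Xi>_def)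
    ultimately have "1 / (3 * pi) * aw_coeff N * (Gamma p / \<nu> powr p) * \<Xi> = (-1) ^ N / pi * (aw_moment N * I * \<Xi>)"
      by (simp add: aw_coeff_eq)
    then show ?thesis using \<open>aw_moment N * I * \<Xi> = H\<close> by simp
  qed
  ultimately show ?thesis using R unfolding w_def p_def by auto
qed

text \<open>Replaces \<open>sin (2 / 3 * \<phi>)\<close> by \<open>sin \<phi>\<close>, which has a
  closed form at an arctangent. The difference of the sides increases, since the cosine decreases
  between 0 and \<open>pi\<close>.\<close>

lemma sin_two_thirds_ge:
  assumes "0 \<le> x" "x \<le> pi" shows "2 / 3 * sin x \<le> sin (2 / 3 * x)"
proof -
  have "cos y \<le> cos (2 / 3 * y)" if "0 \<le> y" "y \<le> x" for y
    using that assms by (intro cos_monotone_0_pi_le) auto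
  then have "sin (2 / 3 * 0) - 2 / 3 * sin 0 \<le> sin (2 / 3 * x) - 2 / 3 * sin x"
    by (intro DERIV_nonneg_imp_le[where f = "\<lambda>x. sin (2 / 3 * x) - 2 / 3 * sin x"
          and f' = "\<lambda>y. 2 / 3 * (cos (2 / 3 * y) - cos y)"])
      (use assms in \<open>auto intro!: derivative_eq_intros simp: algebra_simps\<close>)
  then show ?thesis by simp
qed

text \<open>The angle \<open>\<phi> = arctan (p\<^bsup>-1/2\<^esup>)\<close> with \<open>p = (2N+1)/3\<close> maximises \<open>sin \<phi> * cos \<phi> powr p\<close>.\<close>

lemma rotation_constant:
  fixes N :: nat
  defines "p \<equiv> real (2 * N + 1) / 3"
  defines "\<phi> \<equiv> arctan (1 / sqrt p)"
  shows "1 / (sin (2 / 3 * \<phi>) * cos \<phi> powr p) \<le> sqrt (3 * exp 1 / 2 * (real N + 2))"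
proof -
  have p: "p > 0" by (simp add: p_def)
  have \<phi>: "0 < \<phi>" "\<phi> < pi / 2" using p arctan_ubound[of "1 / sqrt p"] by (simp_all add: \<phi>_def)
  have sq: "1 + (1 / sqrt p)\<^sup>2 = (p + 1) / p" using p by (simp add: power_divide field_simps)
  have cosphi: "cos \<phi> = sqrt (p / (p + 1))"
    unfolding \<phi>_def cos_arctan sq using p by (simp add: real_sqrt_divide)
  have sinphi: "sin \<phi> = 1 / sqrt (p + 1)"
    unfolding \<phi>_def sin_arctan sq using p by (simp add: real_sqrt_divide)
  \<comment> \<open>The factor \<open>sqrt e\<close> of the constant:
    \<open>(1 + 1 / p) powr p\<close> is at most \<open>e\<close>.\<close>
  have "1 / cos \<phi> powr p = ((p + 1) / p) powr (p / 2)"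
    using p by (simp add: cosphi powr_half_sqrt[symmetric] powr_powr powr_divide)
  also have "\<dots> \<le> exp (1 / p) powr (p / 2)"
  proof (rule powr_mono2)
    show "(p + 1) / p \<le> exp (1 / p)" using exp_ge_add_one_self[of "1 / p"] p by (simp add: add_divide_distrib)
  qed (use p in auto)
  also have "\<dots> = exp (1 / 2)" using p by (simp add: powr_def)
  finally have C: "1 / cos \<phi> powr p \<le> exp (1 / 2)" .
  have "2 / 3 * sin \<phi> \<le> sin (2 / 3 * \<phi>)" using \<phi> by (intro sin_two_thirds_ge) auto
  then have S: "1 / sin (2 / 3 * \<phi>) \<le> 3 / 2 * sqrt (p + 1)"
  proof -
    assume *: "2 / 3 * sin \<phi> \<le> sin (2 / 3 * \<phi>)"
    have s0: "0 < 2 / 3 * sin \<phi>" using p by (simp add: sinphi)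
    have "1 / sin (2 / 3 * \<phi>) \<le> 1 / (2 / 3 * sin \<phi>)"
      using * s0 by (intro divide_left_mono mult_pos_pos) auto
    then show ?thesis by (simp add: sinphi)
  qed
  have "1 / (sin (2 / 3 * \<phi>) * cos \<phi> powr p) = 1 / sin (2 / 3 * \<phi>) * (1 / cos \<phi> powr p)" by simp
  also have "\<dots> \<le> (3 / 2 * sqrt (p + 1)) * exp (1 / 2)" using S C p by (intro mult_mono) auto
  \<comment> \<open>Here \<open>p + 1 = 2 / 3 * (N + 2)\<close>, so the square is
    \<open>9 / 4 * (p + 1) * e = 3 / 2 * e * (N + 2)\<close>.\<close>
  also have "\<dots> = sqrt (3 * exp 1 / 2 * (real N + 2))"
  proof (rule real_sqrt_unique[symmetric])
    have "exp (1 / 2 :: real) ^ 2 = exp 1" by (simp flip: exp_of_nat_mult)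
    moreover have "(sqrt (p + 1))\<^sup>2 = p + 1" using p by simp
    ultimately show "(3 / 2 * sqrt (p + 1) * exp (1 / 2))\<^sup>2 = 3 * exp 1 / 2 * (real N + 2)"
      unfolding power_mult_distrib by (simp add: p_def field_simps power2_eq_square)
  qed (use p in auto)
  finally show ?thesis .
qed

text \<open>Rotating towards \<theta>, with the sign of \<theta>, lowers the effective angle to
  \<open>\<bar>\<theta>\<bar> - \<phi>0\<close>. This stays below \<open>3 * pi / 2\<close> even at
  the end point \<open>\<bar>\<theta>\<bar> = 3 * pi / 2\<close>, with margin
  \<open>\<phi>0\<close>, so the bound is uniform in \<theta>.\<close>

lemma remainder_bound_c:
  assumes r: "r > 0" and \<theta>: "3 * pi / 4 < \<bar>\<theta>\<bar>" "\<bar>\<theta>\<bar> \<le> 3 * pi / 2"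
  shows "norm (aw_remainder N (surface_point r \<theta>)) \<le>
    sqrt (3 * exp 1 / 2 * (real N + 2)) * (1 / (3 * pi) * \<bar>aw_coeff N\<bar>
      * (Gamma (real (2 * N + 1) / 3) / r powr (real (2 * N + 1) / 3)))"
proof -
  define p where "p = real (2 * N + 1) / 3"
  define \<phi>0 where "\<phi>0 = arctan (1 / sqrt p)"
  define \<phi> where "\<phi> = (if \<theta> > 0 then \<phi>0 else - \<phi>0)"
  have p: "p > 0" by (simp add: p_def)
  have \<phi>0: "0 < \<phi>0" "\<phi>0 < pi / 2" using p arctan_ubound[of "1 / sqrt p"] by (simp_all add: \<phi>0_def)
  have ab: "\<bar>\<theta> - \<phi>\<bar> = \<bar>\<theta>\<bar> - \<phi>0" using \<theta> \<phi>0 by (auto simp: \<phi>_def)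
  have sp: "sin (2 / 3 * \<phi>0) > 0" using \<phi>0 by (intro sin_gt_zero) auto
  have \<kappa>: "sin (2 / 3 * \<phi>0) \<le> norm (1 + of_real x * cis (- (2 / 3 * (\<theta> - \<phi>))))" if "x \<ge> 0" for x
  proof (rule norm_one_plus_cis_ge[OF that])
    have "\<bar>- (2 / 3 * (\<theta> - \<phi>))\<bar> = 2 / 3 * \<bar>\<theta> - \<phi>\<bar>" by (simp only: abs_minus_cancel abs_mult)
    then show "\<bar>- (2 / 3 * (\<theta> - \<phi>))\<bar> \<le> pi - 2 / 3 * \<phi>0" using ab \<theta> by (simp add: field_simps)
  qed (use \<phi>0 in auto)
  have "\<bar>\<phi>\<bar> < pi / 2" "\<bar>\<theta> - \<phi>\<bar> < 3 * pi / 2" using \<phi>0 ab \<theta> by (auto simp: \<phi>_def)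
  from norm_remainder_le[OF r this sp \<kappa>, of N]
  have "norm (aw_remainder N (surface_point r \<theta>)) \<le> 1 / (3 * pi) * \<bar>aw_coeff N\<bar> * (Gamma p / r powr p)
      * (1 / (sin (2 / 3 * \<phi>0) * cos \<phi> powr p))" by (simp only: p_def)
  also have "cos \<phi> = cos \<phi>0" by (simp add: \<phi>_def)
  also have "1 / (3 * pi) * \<bar>aw_coeff N\<bar> * (Gamma p / r powr p) * (1 / (sin (2 / 3 * \<phi>0) * cos \<phi>0 powr p))
      \<le> 1 / (3 * pi) * \<bar>aw_coeff N\<bar> * (Gamma p / r powr p) * sqrt (3 * exp 1 / 2 * (real N + 2))"
    using rotation_constant[of N] Gamma_real_pos[OF p]
    unfolding \<phi>0_def p_def by (intro mult_left_mono) auto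
  finally show ?thesis by (simp only: p_def mult.commute)
qed

theorem mainTheorem6:
  fixes N :: nat
  shows "(\<forall>r \<theta> :: real. r > 0 \<and> \<bar>\<theta>\<bar> < 3 * pi / 2 \<longrightarrow>
            norm (aw_remainder N (surface_point r \<theta>)) \<le>
              1 / (3 * pi) * \<bar>aw_coeff N\<bar>
                * (Gamma (real (2 * N + 1) / 3) / r powr (real (2 * N + 1) / 3))
                * (if 3 * pi / 4 < \<bar>\<theta>\<bar> then \<bar>1 / sin (2 / 3 * \<theta>)\<bar> else 1))
       \<and> (\<forall>\<nu> :: real. \<nu> > 0 \<longrightarrow>
            (\<exists>\<Xi> :: real. 0 < \<Xi> \<and> \<Xi> < 1 \<and>
              aw_remainder N (surface_point \<nu> 0) =
                complex_of_real (1 / (3 * pi) * aw_coeff N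
                  * (Gamma (real (2 * N + 1) / 3) / \<nu> powr (real (2 * N + 1) / 3)) * \<Xi>)))
       \<and> (\<forall>r \<theta> :: real. r > 0 \<and> 3 * pi / 4 < \<bar>\<theta>\<bar> \<and> \<bar>\<theta>\<bar> \<le> 3 * pi / 2 \<longrightarrow>
            norm (aw_remainder N (surface_point r \<theta>)) \<le>
              sqrt (3 * exp 1 / 2 * (real N + 2))
                * (1 / (3 * pi) * \<bar>aw_coeff N\<bar>
                     * (Gamma (real (2 * N + 1) / 3) / r powr (real (2 * N + 1) / 3))))"
  using remainder_bound_a remainder_positive_argument remainder_bound_c by blast

end
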